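(* Let $m>n\ge1$, let $X\subseteq\mathbb{R}^m$ be bounded and open, let $Y\subseteq\mathbb{R}^n$ be bounded, open and convex with outward unit normal $\mathbf n_Y$ on $\partial Y$, let $c\in C^2(\overline X\times\overline Y)$ be twisted and non-degenerate, $V\in C^2(\overline Y)$, and $W\in C^2(\overline Y\times\overline Y)$ with $W(y,z)=W(z,y)$. Let $\mu$ be a given probability measure on $X$. Assume that there is a constant $C>0$ with $$D^2_{yy}c(x,y)+D^2V(y)+D^2_{yy}W(z,y)\ge C\,\mathrm{Id}\quad\text{for all }(x,y,z)\in X\times Y\times Y,$$ and that for each $x\in X$, $z\in Y$ and $y\in\partial Y$, $$[D_yc(x,y)+DV(y)+D_yW(y,z)]\cdot\mathbf n_Y(y)\ge0 .$$ Then for any minimizer $\nu$ over $P(\overline Y)$ of $$\nu\mapsto\mathcal T_c(\mu,\nu)+\int_YV(y)\,d\nu(y)+\frac12\int_Y\int_YW(y,z)\,d\nu(z)\,d\nu(y),$$ the model $(c,\mu,\nu)$ satisfies the generalized nestedness condition. Furthermore, if $c$, $V$ and $W$ are $C^k$ smooth (for any integer $k\ge2$), then the optimal map between $\mu$ and $\nu$ is $C^{k-1}$.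
   Context: $P(\overline Y)$ is the set of Borel probability measures on $\overline Y$. $\mathcal T_c(\mu,\nu)=\inf_{\gamma\in\Pi(\mu,\nu)}\int c\,d\gamma$, with $\Pi(\mu,\nu)$ the couplings of $\mu$ and $\nu$. Twisted: for each $x\in X$, $y\mapsto D_xc(x,y)$ is injective on $Y$. Non-degenerate: the matrix $D^2_{xy}c(x,y)$ has rank $n$ for each $(x,y)\in\overline X\times\overline Y$. Kantorovich potentials: $(u,v)$ maximizes $\int u\,d\mu+\int v\,d\nu$ among integrable pairs with $u(x)+v(y)\le c(x,y)$, and is $c$-concave, i.e. $u(x)=v^c(x):=\min_{y\in\overline Y}[c(x,y)-v(y)]$ and $v(y)=u^c(y):=\min_{x\in\overline X}[c(x,y)-u(x)]$. The pair is assumed unique up to replacing $(u,v)$ by $(u+a,v-a)$, $a\in\mathbb{R}$ (which holds for instance if $X$ is connected and $\mu$ has a density that is positive throughout $X$). Generalized nestedness condition for $(c,\mu,\nu)$: for $\nu$-almost every $y$, $v$ is differentiable at $y$ and $$\partial^cv(y):=\{x\in X:u(x)+v(y)=c(x,y)\}=X_=(y,Dv(y)):=\{x\in X:Dv(y)=D_yc(x,y)\}.$$ The optimal map between $\mu$ and $\nu$ is the map $T$ with $T_\#\mu=\nu$ and $\int c(x,T(x))\,d\mu(x)=\mathcal T_c(\mu,\nu)$.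
   Formalization: The integrals of V and W in the functional are taken over the closure of Y, not the open set Y: since ν ranges over P(closure of Y), integrating over Y alone would make mass on the boundary free of charge, and the theorem would be false. *)

theory Defs
  imports "HOL-Analysis.Analysis" "HOL-Probability.Probability_Measure"
begin

section \<open>Derivatives and functions that are smooth up to the boundary\<close>

text \<open>
  \<open>Ck_upto k U S f\<close>, for open \<open>U\<close> and \<open>U \<subseteq> S \<subseteq> closure U\<close>: all derivatives of \<open>f\<close> of order at
  most \<open>k\<close> exist in \<open>U\<close> and extend continuously to \<open>S\<close> (the values of \<open>f'\<close> on \<open>S - U\<close> are those of
  the extension).  Hence \<open>S = U\<close> gives the class \<open>C^k(U)\<close> and \<open>S = closure U\<close> the class
  \<open>C^k(closure U)\<close>.  The recursion is on directional derivatives, so that the type of \<open>f\<close> is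
  preserved; in finite dimension, continuity of \<open>\<lambda>x. f' x h\<close> for every \<open>h\<close> is continuity of \<open>f'\<close>.
\<close>

primrec Ck_upto ::
  "nat \<Rightarrow> 'a::euclidean_space set \<Rightarrow> 'a set \<Rightarrow> ('a \<Rightarrow> 'b::real_normed_vector) \<Rightarrow> bool" where
  "Ck_upto 0 U S f \<longleftrightarrow> continuous_on S f"
| "Ck_upto (Suc k) U S f \<longleftrightarrow> continuous_on S f \<and>
     (\<exists>f'. (\<forall>x\<in>U. (f has_derivative f' x) (at x)) \<and> (\<forall>h. Ck_upto k U S (\<lambda>x. f' x h)))"

abbreviation Ck_closure ::
  "nat \<Rightarrow> 'a::euclidean_space set \<Rightarrow> ('a \<Rightarrow> 'b::real_normed_vector) \<Rightarrow> bool" where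
  "Ck_closure k U f \<equiv> Ck_upto k U (closure U) f"

abbreviation Ck_open ::
  "nat \<Rightarrow> 'a::euclidean_space set \<Rightarrow> ('a \<Rightarrow> 'b::real_normed_vector) \<Rightarrow> bool" where
  "Ck_open k U f \<equiv> Ck_upto k U U f"

definition grad :: "('a::euclidean_space \<Rightarrow> real) \<Rightarrow> 'a \<Rightarrow> 'a" where
  "grad f x = (THE d. GDERIV f x :> d)"

definition hessian :: "(real ^ 'n \<Rightarrow> real) \<Rightarrow> real ^ 'n \<Rightarrow> real ^ 'n ^ 'n" where
  "hessian f x = jacobian (grad f) (at x)"

definition D_x :: "(real ^ 'm \<Rightarrow> real ^ 'n \<Rightarrow> real) \<Rightarrow> real ^ 'm \<Rightarrow> real ^ 'n \<Rightarrow> real ^ 'm" where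
  "D_x c x y = grad (\<lambda>x'. c x' y) x"

definition D_y :: "(real ^ 'm \<Rightarrow> real ^ 'n \<Rightarrow> real) \<Rightarrow> real ^ 'm \<Rightarrow> real ^ 'n \<Rightarrow> real ^ 'n" where
  "D_y c x y = grad (c x) y"

definition D2_xy :: "(real ^ 'm \<Rightarrow> real ^ 'n \<Rightarrow> real) \<Rightarrow> real ^ 'm \<Rightarrow> real ^ 'n \<Rightarrow> real ^ 'm ^ 'n" where
  "D2_xy c x y = jacobian (\<lambda>x'. D_y c x' y) (at x)"

text \<open>
  Derivatives of a function in \<open>C^k(closure U)\<close> at points of \<open>closure U\<close> are the values of their
  continuous extensions from the open set \<open>U\<close>.
\<close>

definition cont_ext ::
  "'a::topological_space set \<Rightarrow> ('a \<Rightarrow> 'b::t2_space) \<Rightarrow> 'a \<Rightarrow> 'b" where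
  "cont_ext U g p = Lim (at p within U) g"

lemma grad_eq:
  assumes "GDERIV f x :> d"
  shows "grad f x = d"
  unfolding grad_def
proof (rule the_equality)
  show "GDERIV f x :> d"
    by (fact assms)
next
  fix e assume "GDERIV f x :> e"
  then have "(\<lambda>h. h \<bullet> e) = (\<lambda>h. h \<bullet> d)"
    using assms unfolding gderiv_def by (rule has_derivative_unique)
  then have "(e - d) \<bullet> e = (e - d) \<bullet> d"
    by (rule fun_cong)
  then have "(e - d) \<bullet> (e - d) = 0"
    by (simp only: inner_diff_right)
  then show "e = d"
    by simp
qed

lemma cont_ext_eq:
  fixes g :: "'a::perfect_space \<Rightarrow> 'b::t2_space"
  assumes "open U" "continuous_on U g" "p \<in> U"
  shows "cont_ext U g p = g p"
proof -
  have "at p within U = at p"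
    using assms(3,1) by (rule at_within_open)
  moreover have "(g \<longlongrightarrow> g p) (at p within U)"
    using assms(2,3) by (simp only: continuous_on_def)
  ultimately show ?thesis
    unfolding cont_ext_def by (metis tendsto_Lim trivial_limit_at)
qed

definition outward_unit_normals :: "'a::real_inner set \<Rightarrow> 'a \<Rightarrow> 'a set" where
  "outward_unit_normals Y y = {p. norm p = 1 \<and> (\<forall>z\<in>Y. (z - y) \<bullet> p \<le> 0)}"

section \<open>Optimal transport\<close>

text \<open>
  Probability measures on a Borel set \<open>A\<close> are Borel probability measures on the ambient space that
  are concentrated on \<open>A\<close>.  Functions are meaningful only on the closures of the domains, so
  integrals are taken over these sets.
\<close>

definition prob_on :: "'a::topological_space set \<Rightarrow> 'a measure set" where
  "prob_on A = {\<mu>. prob_space \<mu> \<and> sets \<mu> = sets borel \<and> emeasure \<mu> A = 1}"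

definition couplings ::
  "'a::topological_space measure \<Rightarrow> 'b::topological_space measure \<Rightarrow> ('a \<times> 'b) measure set" where
  "couplings \<mu> \<nu> = {\<gamma>. prob_space \<gamma> \<and> sets \<gamma> = sets borel \<and>
     distr \<gamma> borel fst = \<mu> \<and> distr \<gamma> borel snd = \<nu>}"

definition transport_cost ::
  "(real ^ 'm \<Rightarrow> real ^ 'n \<Rightarrow> real) \<Rightarrow> (real ^ 'm) set \<Rightarrow> (real ^ 'n) set \<Rightarrow>
   (real ^ 'm) measure \<Rightarrow> (real ^ 'n) measure \<Rightarrow> real" where
  "transport_cost c X Y \<mu> \<nu> =
     (INF \<gamma>\<in>couplings \<mu> \<nu>. LINT p:closure X \<times> closure Y|\<gamma>. c (fst p) (snd p))"

definition twisted ::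
  "(real ^ 'm \<Rightarrow> real ^ 'n \<Rightarrow> real) \<Rightarrow> (real ^ 'm) set \<Rightarrow> (real ^ 'n) set \<Rightarrow> bool" where
  "twisted c X Y \<longleftrightarrow> (\<forall>x\<in>X. inj_on (D_x c x) Y)"

definition nondegenerate ::
  "(real ^ 'm \<Rightarrow> real ^ 'n \<Rightarrow> real) \<Rightarrow> (real ^ 'm) set \<Rightarrow> (real ^ 'n) set \<Rightarrow> bool" where
  "nondegenerate c X Y \<longleftrightarrow> (\<forall>x\<in>closure X. \<forall>y\<in>closure Y.
     rank (cont_ext (X \<times> Y) (\<lambda>(x, y). D2_xy c x y) (x, y)) = CARD('n))"

definition dual_admissible ::
  "(real ^ 'm \<Rightarrow> real ^ 'n \<Rightarrow> real) \<Rightarrow> (real ^ 'm) set \<Rightarrow> (real ^ 'n) set \<Rightarrow>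
   (real ^ 'm) measure \<Rightarrow> (real ^ 'n) measure \<Rightarrow> (real ^ 'm \<Rightarrow> real) \<Rightarrow> (real ^ 'n \<Rightarrow> real) \<Rightarrow> bool" where
  "dual_admissible c X Y \<mu> \<nu> u v \<longleftrightarrow>
     set_integrable \<mu> (closure X) u \<and> set_integrable \<nu> (closure Y) v \<and>
     (\<forall>x\<in>closure X. \<forall>y\<in>closure Y. u x + v y \<le> c x y)"

definition dual_value ::
  "(real ^ 'm) set \<Rightarrow> (real ^ 'n) set \<Rightarrow> (real ^ 'm) measure \<Rightarrow> (real ^ 'n) measure \<Rightarrow>
   (real ^ 'm \<Rightarrow> real) \<Rightarrow> (real ^ 'n \<Rightarrow> real) \<Rightarrow> real" where
  "dual_value X Y \<mu> \<nu> u v = (LINT x:closure X|\<mu>. u x) + (LINT y:closure Y|\<nu>. v y)"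

definition is_minimum :: "real set \<Rightarrow> real \<Rightarrow> bool" where
  "is_minimum A a \<longleftrightarrow> a \<in> A \<and> (\<forall>b\<in>A. a \<le> b)"

definition c_concave_pair ::
  "(real ^ 'm \<Rightarrow> real ^ 'n \<Rightarrow> real) \<Rightarrow> (real ^ 'm) set \<Rightarrow> (real ^ 'n) set \<Rightarrow>
   (real ^ 'm \<Rightarrow> real) \<Rightarrow> (real ^ 'n \<Rightarrow> real) \<Rightarrow> bool" where
  "c_concave_pair c X Y u v \<longleftrightarrow>
     (\<forall>x\<in>closure X. is_minimum ((\<lambda>y. c x y - v y) ` closure Y) (u x)) \<and>
     (\<forall>y\<in>closure Y. is_minimum ((\<lambda>x. c x y - u x) ` closure X) (v y))"

definition kantorovich_potentials ::
  "(real ^ 'm \<Rightarrow> real ^ 'n \<Rightarrow> real) \<Rightarrow> (real ^ 'm) set \<Rightarrow> (real ^ 'n) set \<Rightarrow>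
   (real ^ 'm) measure \<Rightarrow> (real ^ 'n) measure \<Rightarrow> (real ^ 'm \<Rightarrow> real) \<Rightarrow> (real ^ 'n \<Rightarrow> real) \<Rightarrow> bool" where
  "kantorovich_potentials c X Y \<mu> \<nu> u v \<longleftrightarrow>
     dual_admissible c X Y \<mu> \<nu> u v \<and>
     (\<forall>u' v'. dual_admissible c X Y \<mu> \<nu> u' v' \<longrightarrow>
        dual_value X Y \<mu> \<nu> u' v' \<le> dual_value X Y \<mu> \<nu> u v) \<and>
     c_concave_pair c X Y u v"

definition unique_potentials ::
  "(real ^ 'm \<Rightarrow> real ^ 'n \<Rightarrow> real) \<Rightarrow> (real ^ 'm) set \<Rightarrow> (real ^ 'n) set \<Rightarrow>
   (real ^ 'm) measure \<Rightarrow> (real ^ 'n) measure \<Rightarrow> bool" where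
  "unique_potentials c X Y \<mu> \<nu> \<longleftrightarrow>
     (\<forall>u v u' v'. kantorovich_potentials c X Y \<mu> \<nu> u v \<longrightarrow>
        kantorovich_potentials c X Y \<mu> \<nu> u' v' \<longrightarrow>
        (\<exists>a. (\<forall>x\<in>closure X. u' x = u x + a) \<and> (\<forall>y\<in>closure Y. v' y = v y - a)))"

text \<open>
  The measure \<open>\<nu>\<close> lives on \<open>closure Y\<close>, which is also the domain of \<open>v\<close>.  Differentiability at \<open>y\<close> is
  therefore taken relative to \<open>closure Y\<close>; it is the usual one for \<open>y \<in> Y\<close>, and for open convex \<open>Y\<close>
  the vector \<open>p = Dv(y)\<close> is unique also if \<open>y\<close> lies on the boundary.
\<close>

definition generalized_nestedness ::
  "(real ^ 'm \<Rightarrow> real ^ 'n \<Rightarrow> real) \<Rightarrow> (real ^ 'm) set \<Rightarrow> (real ^ 'n) set \<Rightarrow>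
   (real ^ 'm) measure \<Rightarrow> (real ^ 'n) measure \<Rightarrow> bool" where
  "generalized_nestedness c X Y \<mu> \<nu> \<longleftrightarrow>
     (\<exists>u v. kantorovich_potentials c X Y \<mu> \<nu> u v) \<and>
     (\<forall>u v. kantorovich_potentials c X Y \<mu> \<nu> u v \<longrightarrow>
       (AE y in \<nu>. \<exists>p. (v has_derivative (\<lambda>h. h \<bullet> p)) (at y within closure Y) \<and>
          {x\<in>X. u x + v y = c x y} =
          {x\<in>X. p = cont_ext (X \<times> Y) (\<lambda>(x, y). D_y c x y) (x, y)}))"

definition optimal_map ::
  "(real ^ 'm \<Rightarrow> real ^ 'n \<Rightarrow> real) \<Rightarrow> (real ^ 'm) set \<Rightarrow> (real ^ 'n) set \<Rightarrow>
   (real ^ 'm) measure \<Rightarrow> (real ^ 'n) measure \<Rightarrow> (real ^ 'm \<Rightarrow> real ^ 'n) \<Rightarrow> bool" where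
  "optimal_map c X Y \<mu> \<nu> T \<longleftrightarrow>
     T \<in> measurable \<mu> borel \<and> T ` X \<subseteq> closure Y \<and> distr \<mu> borel T = \<nu> \<and>
     (LINT x:X|\<mu>. c x (T x)) = transport_cost c X Y \<mu> \<nu>"

definition energy ::
  "(real ^ 'm \<Rightarrow> real ^ 'n \<Rightarrow> real) \<Rightarrow> (real ^ 'n \<Rightarrow> real) \<Rightarrow> (real ^ 'n \<Rightarrow> real ^ 'n \<Rightarrow> real) \<Rightarrow>
   (real ^ 'm) set \<Rightarrow> (real ^ 'n) set \<Rightarrow> (real ^ 'm) measure \<Rightarrow> (real ^ 'n) measure \<Rightarrow> real" where
  "energy c V W X Y \<mu> \<nu> =
     transport_cost c X Y \<mu> \<nu> + (LINT y:closure Y|\<nu>. V y) +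
     1 / 2 * (LINT y:closure Y|\<nu>. LINT z:closure Y|\<nu>. W y z)"

end

theory Submission
  imports Defs "HOL-Probability.Probability_Mass_Function"
begin

text \<open>
  Put \<open>F y = V y + \<integral> W y z d\<nu>(z)\<close>.  For \<open>x \<in> X\<close> the function \<open>c x + F\<close> is strongly convex on
  \<open>closure Y\<close>, and by the boundary condition its minimizer \<open>T x\<close> is its only critical point.
  Let \<open>w x\<close> be the minimum.  Since \<open>\<T>\<^sub>c(\<mu>, \<cdot>)\<close> is convex, comparing \<open>\<nu>\<close> with
  \<open>(1 - t) \<nu> + t T\<^sub># \<mu>\<close> gives \<open>\<T>\<^sub>c(\<mu>, \<nu>) + \<integral> F d\<nu> \<le> \<integral> w d\<mu>\<close>, while every coupling \<open>\<gamma>\<close> of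
  \<open>\<mu>\<close> and \<open>\<nu>\<close> satisfies \<open>\<integral> c d\<gamma> + \<integral> F d\<nu> - \<integral> w d\<mu> \<ge> C/2 \<integral> |y - T x|\<^sup>2 d\<gamma>\<close>.  Hence \<open>\<nu> = T\<^sub># \<mu>\<close>,
  \<open>T\<close> is the optimal map, and \<open>(w, w\<^sup>c)\<close> are potentials with \<open>w\<^sup>c = - F\<close> on \<open>T(X)\<close>; neither the
  existence of optimal couplings nor Kantorovich duality is needed.  The potentials are unique, so
  \<open>u x + v y = c x y\<close> for \<open>y \<in> T(X)\<close> means \<open>T x = y\<close>, that is, \<open>D\<^sub>y c x y = - DF y = Dv y\<close>.
  The regularity of \<open>T\<close> is that of the solution of \<open>D\<^sub>y c x (T x) + DF (T x) = 0\<close>, an implicit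
  function problem up to the boundary of \<open>Y\<close>.
\<close>

text \<open>The obstacle is the boundary of \<open>Y\<close>: \<open>\<nu>\<close> may charge it and
  \<open>T x\<close> may lie on it, while the Hessian bound is assumed inside the domains only and
  no function is continued beyond the closures. Derivatives are therefore carried as continuous
  extensions \<open>c'\<close>, \<open>V'\<close>, \<open>W'\<close> to the closures and used
  relative to these sets, and the Hessian bound is integrated along segments first, since its
  first-order form passes to the boundary by continuity alone. The boundary condition serves one
  purpose: it upgrades the variational inequality at a minimizer on the boundary to a vanishing
  derivative. This is what makes \<open>T x\<close> the solution of an equation even there. On the
  side of transport, every comparison is stated for an arbitrary coupling, with the infimum taken
  only at the end, so that approximate minimizers suffice.\<close>

text \<open>Whatever is assumed or computed only inside a domain reaches its boundary through this
  lemma, after being rewritten as the sign of one continuous function.\<close>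

lemma closure_nonneg:
  fixes f :: "'a::metric_space \<Rightarrow> real"
  assumes "continuous_on S f" "U \<subseteq> S" "S \<subseteq> closure U" "\<And>x. x \<in> U \<Longrightarrow> 0 \<le> f x" "x \<in> S"
  shows "0 \<le> f x"
proof -
  obtain s where s: "\<And>n. s n \<in> U" "s \<longlonglongrightarrow> x"
    using assms(3,5) closure_sequential by blast
  then have "(\<lambda>n. f (s n)) \<longlonglongrightarrow> f x"
    using assms(1,2,5) unfolding continuous_on_sequentially comp_def by blast
  then show ?thesis
    by (rule LIMSEQ_le_const) (use s(1) assms(4) in blast)
qed

lemma closure_eq:
  fixes f g :: "'a::metric_space \<Rightarrow> 'b::real_normed_vector"
  assumes "continuous_on S f" "continuous_on S g" "U \<subseteq> S" "S \<subseteq> closure U"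
    "\<And>x. x \<in> U \<Longrightarrow> f x = g x" "x \<in> S"
  shows "f x = g x"
proof -
  \<comment> \<open>An equality is the sign condition for minus the norm of the difference.\<close>
  have "0 \<le> - norm (f x - g x)"
    by (rule closure_nonneg[where S = S and U = U]) (use assms in \<open>auto intro!: continuous_intros\<close>)
  then show ?thesis by simp
qed

section \<open>Functions that are smooth up to the boundary\<close>

lemma Ck_upto_continuous_on: "Ck_upto k U S f \<Longrightarrow> continuous_on S f"
  by (cases k) auto

lemma Ck_upto_SucE:
  assumes "Ck_upto (Suc k) U S f"
  obtains f' where "\<And>x. x \<in> U \<Longrightarrow> (f has_derivative f' x) (at x)" "\<And>h. Ck_upto k U S (\<lambda>x. f' x h)"
  using assms by auto

lemma Ck_upto_SucI:
  assumes "continuous_on S f" "\<And>x. x \<in> U \<Longrightarrow> (f has_derivative f' x) (at x)"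
    "\<And>h. Ck_upto k U S (\<lambda>x. f' x h)"
  shows "Ck_upto (Suc k) U S f"
  using assms by auto

lemma Ck_upto_subset:
  assumes "Ck_upto k U S f" "U' \<subseteq> U" "S' \<subseteq> S"
  shows "Ck_upto k U' S' f"
  using assms(1)
proof (induction k arbitrary: f)
  case 0
  then show ?case using assms(3) by (auto intro: continuous_on_subset)
next
  case (Suc k)
  obtain f' where f': "\<And>x. x \<in> U \<Longrightarrow> (f has_derivative f' x) (at x)" "\<And>h. Ck_upto k U S (\<lambda>x. f' x h)"
    using Ck_upto_SucE[OF Suc.prems] by blast
  show ?case
    by (rule Ck_upto_SucI[where f' = f'])
      (use f' Suc assms(2,3) Ck_upto_continuous_on[OF Suc.prems] in \<open>auto intro: continuous_on_subset\<close>)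
qed

lemma Ck_upto_Suc_imp: "Ck_upto (Suc k) U S f \<Longrightarrow> Ck_upto k U S f"
proof (induction k arbitrary: f)
  case (Suc k)
  obtain f' where f': "\<And>x. x \<in> U \<Longrightarrow> (f has_derivative f' x) (at x)" "\<And>h. Ck_upto (Suc k) U S (\<lambda>x. f' x h)"
    using Ck_upto_SucE[OF Suc.prems] by blast
  show ?case
    by (rule Ck_upto_SucI[where f' = f'])
      (use f' Suc.IH Ck_upto_continuous_on[OF Suc.prems] in blast)+
qed simp

lemma Ck_upto_cong:
  assumes "open U" "U \<subseteq> S" "\<And>x. x \<in> S \<Longrightarrow> f x = g x" "Ck_upto k U S f"
  shows "Ck_upto k U S g"
proof (cases k)
  case 0
  then show ?thesis using assms(3,4) by (auto cong: continuous_on_cong)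
next
  case (Suc j)
  obtain f' where f': "\<And>x. x \<in> U \<Longrightarrow> (f has_derivative f' x) (at x)" "\<And>h. Ck_upto j U S (\<lambda>x. f' x h)"
    using Ck_upto_SucE assms(4) Suc by blast
  have "(g has_derivative f' x) (at x)" if "x \<in> U" for x
    by (rule has_derivative_transform_within_open[OF f'(1)[OF that] assms(1) that]) (use assms in auto)
  moreover have "continuous_on S g"
    using Ck_upto_continuous_on[OF assms(4)] assms(3) by (auto cong: continuous_on_cong)
  ultimately show ?thesis
    using f'(2) unfolding Suc by (intro Ck_upto_SucI) blast+
qed

lemma Ck_upto_const: "Ck_upto k U S (\<lambda>x. a)"
proof (induction k arbitrary: a)
  case (Suc k)
  show ?case
    by (rule Ck_upto_SucI[where f' = "\<lambda>x h. 0"]) (use Suc in auto)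
qed simp

lemma Ck_upto_add:
  assumes "Ck_upto k U S f" "Ck_upto k U S g"
  shows "Ck_upto k U S (\<lambda>x. f x + g x)"
  using assms
proof (induction k arbitrary: f g)
  case 0
  then show ?case by (auto intro: continuous_on_add)
next
  case (Suc k)
  obtain f' where f': "\<And>x. x \<in> U \<Longrightarrow> (f has_derivative f' x) (at x)" "\<And>h. Ck_upto k U S (\<lambda>x. f' x h)"
    using Ck_upto_SucE[OF Suc.prems(1)] by blast
  obtain g' where g': "\<And>x. x \<in> U \<Longrightarrow> (g has_derivative g' x) (at x)" "\<And>h. Ck_upto k U S (\<lambda>x. g' x h)"
    using Ck_upto_SucE[OF Suc.prems(2)] by blast
  show ?case
    by (rule Ck_upto_SucI[where f' = "\<lambda>x h. f' x h + g' x h"])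
      (use f' g' Suc.IH Suc.prems[THEN Ck_upto_continuous_on] in \<open>auto intro!: continuous_on_add has_derivative_add\<close>)
qed

lemma Ck_upto_sum:
  assumes "\<And>i. i \<in> I \<Longrightarrow> Ck_upto k U S (f i)"
  shows "Ck_upto k U S (\<lambda>x. \<Sum>i\<in>I. f i x)"
  using assms by (induction I rule: infinite_finite_induct) (auto intro: Ck_upto_const Ck_upto_add)

lemma Ck_upto_bounded_linear:
  assumes "bounded_linear L" "Ck_upto k U S f"
  shows "Ck_upto k U S (\<lambda>x. L (f x))"
  using assms(2)
proof (induction k arbitrary: f)
  case 0
  then show ?case by (auto intro: bounded_linear.continuous_on[OF assms(1)])
next
  case (Suc k)
  obtain f' where f': "\<And>x. x \<in> U \<Longrightarrow> (f has_derivative f' x) (at x)" "\<And>h. Ck_upto k U S (\<lambda>x. f' x h)"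
    using Ck_upto_SucE[OF Suc.prems] by blast
  show ?case
    by (rule Ck_upto_SucI[where f' = "\<lambda>x h. L (f' x h)"])
      (use f' Suc.IH Suc.prems[THEN Ck_upto_continuous_on] in
        \<open>auto intro!: bounded_linear.continuous_on[OF assms(1)] bounded_linear.has_derivative[OF assms(1)]\<close>)
qed

lemma Ck_upto_scaleR:
  assumes "Ck_upto k U S s" "Ck_upto k U S f"
  shows "Ck_upto k U S (\<lambda>x. s x *\<^sub>R f x)"
  using assms
proof (induction k arbitrary: s f)
  case 0
  then show ?case by (auto intro: continuous_on_scaleR)
next
  case (Suc k)
  obtain s' where s': "\<And>x. x \<in> U \<Longrightarrow> (s has_derivative s' x) (at x)" "\<And>h. Ck_upto k U S (\<lambda>x. s' x h)"
    using Ck_upto_SucE[OF Suc.prems(1)] by blast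
  obtain f' where f': "\<And>x. x \<in> U \<Longrightarrow> (f has_derivative f' x) (at x)" "\<And>h. Ck_upto k U S (\<lambda>x. f' x h)"
    using Ck_upto_SucE[OF Suc.prems(2)] by blast
  show ?case
  proof (rule Ck_upto_SucI[where f' = "\<lambda>x h. s x *\<^sub>R f' x h + s' x h *\<^sub>R f x"])
    show "continuous_on S (\<lambda>x. s x *\<^sub>R f x)"
      using Suc.prems[THEN Ck_upto_continuous_on] by (rule continuous_on_scaleR)
    show "((\<lambda>x. s x *\<^sub>R f x) has_derivative (\<lambda>h. s x *\<^sub>R f' x h + s' x h *\<^sub>R f x)) (at x)"
      if "x \<in> U" for x
      by (rule has_derivative_scaleR[OF s'(1) f'(1)]) (fact that)+
    show "Ck_upto k U S (\<lambda>x. s x *\<^sub>R f' x h + s' x h *\<^sub>R f x)" for h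
      using Suc.IH Suc.prems[THEN Ck_upto_Suc_imp] s'(2) f'(2) by (intro Ck_upto_add) auto
  qed
qed

text \<open>The recursion of \<open>Ck_upto\<close> controls \<open>A x h\<close> only for a fixed
  direction \<open>h\<close>. Expanding a varying argument in the basis leaves a finite sum of
  products of functions with known regularity.\<close>

lemma Ck_upto_apply_linear:
  fixes A :: "'a::euclidean_space \<Rightarrow> 'b::euclidean_space \<Rightarrow> 'c::real_normed_vector"
  assumes "open U" "U \<subseteq> S" "\<And>x. x \<in> S \<Longrightarrow> linear (A x)"
    and A: "\<And>h. Ck_upto k U S (\<lambda>x. A x h)" and s: "Ck_upto k U S s"
  shows "Ck_upto k U S (\<lambda>x. A x (s x))"
proof (rule Ck_upto_cong[OF assms(1,2)])
  fix x assume x: "x \<in> S"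
  interpret linear "A x" by (rule assms(3)) (rule x)
  show "(\<Sum>b\<in>Basis. (s x \<bullet> b) *\<^sub>R A x b) = A x (s x)"
    by (subst (2) euclidean_representation[symmetric]) (simp add: sum scaleR)
next
  show "Ck_upto k U S (\<lambda>x. \<Sum>b\<in>Basis. (s x \<bullet> b) *\<^sub>R A x b)"
    by (intro Ck_upto_sum Ck_upto_scaleR A Ck_upto_bounded_linear[OF bounded_linear_inner_left s])
qed

lemma Ck_upto_snd:
  assumes "Ck_upto k B SB f"
  shows "Ck_upto k (A \<times> B) (SA \<times> SB) (\<lambda>p. f (snd p))"
  using assms
proof (induction k arbitrary: f)
  case 0
  then show ?case by (auto intro!: continuous_intros continuous_on_compose2[of SB f])
next
  case (Suc k)
  obtain f' where f': "\<And>x. x \<in> B \<Longrightarrow> (f has_derivative f' x) (at x)" "\<And>h. Ck_upto k B SB (\<lambda>x. f' x h)"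
    using Ck_upto_SucE[OF Suc.prems] by blast
  show ?case
  proof (rule Ck_upto_SucI[where f' = "\<lambda>p h. f' (snd p) (snd h)"])
    show "continuous_on (SA \<times> SB) (\<lambda>p. f (snd p))"
      using Ck_upto_continuous_on[OF Suc.prems]
      by (auto intro!: continuous_intros continuous_on_compose2[of SB f])
    show "((\<lambda>p. f (snd p)) has_derivative (\<lambda>h. f' (snd p) (snd h))) (at p)" if "p \<in> A \<times> B" for p
      by (rule has_derivative_compose[OF has_derivative_snd[OF has_derivative_ident]])
        (use f'(1) that in auto)
    show "Ck_upto k (A \<times> B) (SA \<times> SB) (\<lambda>p. f' (snd p) (snd h))" for h
      by (rule Suc.IH) (rule f'(2))
  qed
qed

lemma Ck_upto_slice:
  assumes "Ck_upto k (A \<times> B) (SA \<times> SB) (\<lambda>(x, y). f x y)" "x \<in> A" "x \<in> SA"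
  shows "Ck_upto k B SB (f x)"
  using assms(1)
proof (induction k arbitrary: f)
  case 0
  then have "continuous_on ({x} \<times> SB) (\<lambda>(x, y). f x y)"
    using assms(3) by (auto intro: continuous_on_subset)
  then have "continuous_on SB (\<lambda>y. (\<lambda>(x, y). f x y) (x, y))"
    by (rule continuous_on_compose2) (auto intro!: continuous_intros)
  then show ?case by simp
next
  case (Suc k)
  obtain f' where f': "\<And>p. p \<in> A \<times> B \<Longrightarrow> ((\<lambda>(x, y). f x y) has_derivative f' p) (at p)"
    "\<And>h. Ck_upto k (A \<times> B) (SA \<times> SB) (\<lambda>p. f' p h)"
    using Ck_upto_SucE[OF Suc.prems] by blast
  show ?case
  proof (rule Ck_upto_SucI[where f' = "\<lambda>y h. f' (x, y) (0, h)"])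
    have "continuous_on ({x} \<times> SB) (\<lambda>(x, y). f x y)"
      using Ck_upto_continuous_on[OF Suc.prems] assms(3) by (auto intro: continuous_on_subset)
    then have "continuous_on SB (\<lambda>y. (\<lambda>(x, y). f x y) (x, y))"
      by (rule continuous_on_compose2) (auto intro!: continuous_intros)
    then show "continuous_on SB (f x)" by simp
    show "(f x has_derivative (\<lambda>h. f' (x, y) (0, h))) (at y)" if "y \<in> B" for y
    proof -
      have "((\<lambda>y. (\<lambda>(x, y). f x y) (x, y)) has_derivative (\<lambda>h. f' (x, y) (0, h))) (at y)"
        by (rule has_derivative_compose[where f = "Pair x", OF has_derivative_Pair[OF has_derivative_const has_derivative_ident]])
          (use f'(1) that assms(2) in auto)
      then show ?thesis by simp
    qed
    show "Ck_upto k B SB (\<lambda>y. f' (x, y) (0, h))" for h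
      by (rule Suc.IH[of "\<lambda>x y. f' (x, y) (0, h)"]) (use f'(2) in \<open>simp add: case_prod_unfold\<close>)
  qed
qed

text \<open>\<open>Ck_upto\<close> only asserts that some derivative with regular extension exists.
  A concrete \<open>D\<close> that is continuous up to \<open>S\<close> agrees with it inside by
  uniqueness of derivatives and on the rest of \<open>S\<close> by density.\<close>

lemma Ck_upto_Suc_deriv:
  assumes "open U" "U \<subseteq> S" "S \<subseteq> closure U" "Ck_upto (Suc k) U S f"
    and D: "\<And>p. p \<in> U \<Longrightarrow> (f has_derivative D p) (at p)" "continuous_on S (\<lambda>p. D p h)"
  shows "Ck_upto k U S (\<lambda>p. D p h)"
proof -
  obtain f' where f': "\<And>x. x \<in> U \<Longrightarrow> (f has_derivative f' x) (at x)" "\<And>h. Ck_upto k U S (\<lambda>x. f' x h)"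
    using Ck_upto_SucE[OF assms(4)] by blast
  have "f' x h = D x h" if "x \<in> U" for x
    using has_derivative_unique[OF f'(1) D(1)] that by simp
  then have "f' x h = D x h" if "x \<in> S" for x
    using closure_eq[OF Ck_upto_continuous_on[OF f'(2)] D(2) assms(2,3) _ that] by blast
  then show ?thesis
    by (rule Ck_upto_cong[OF assms(1,2) _ f'(2)])
qed

text \<open>At points of \<open>S - U\<close> the value \<open>f' x\<close> is merely a limit of
  derivatives; linearity survives because it consists of equalities between continuous functions of
  \<open>x\<close>.\<close>

lemma derivative_extension_linear:
  assumes "U \<subseteq> S" "S \<subseteq> closure U" "\<And>x. x \<in> U \<Longrightarrow> (f has_derivative f' x) (at x)"
    "\<And>h. continuous_on S (\<lambda>x. f' x h)" "x \<in> S"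
  shows "linear (f' x)"
proof (rule linearI)
  have lin: "linear (f' x)" if "x \<in> U" for x
    using assms(3)[OF that] has_derivative_linear by blast
  show "f' x (b + d) = f' x b + f' x d" for b d
    by (rule closure_eq[OF assms(4) continuous_on_add[OF assms(4) assms(4)] assms(1,2) _ assms(5)])
      (use lin linear_add in blast)
  show "f' x (r *\<^sub>R b) = r *\<^sub>R f' x b" for r b
    by (rule closure_eq[OF assms(4) continuous_on_scaleR[OF continuous_on_const assms(4)] assms(1,2) _ assms(5)])
      (use lin linear_scale in blast)
qed

lemma continuous_on_apply_linear:
  fixes A :: "'a::topological_space \<Rightarrow> 'b::euclidean_space \<Rightarrow> 'c::real_normed_vector"
  assumes "\<And>x. x \<in> S \<Longrightarrow> linear (A x)" "\<And>h. continuous_on S (\<lambda>x. A x h)" "continuous_on S s"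
  shows "continuous_on S (\<lambda>x. A x (s x))"
proof -
  have "A x (s x) = (\<Sum>b\<in>Basis. (s x \<bullet> b) *\<^sub>R A x b)" if "x \<in> S" for x
  proof -
    interpret linear "A x" by (rule assms(1)) (rule that)
    show ?thesis
      by (subst euclidean_representation[of "s x", symmetric]) (simp only: sum scaleR)
  qed
  moreover have "continuous_on S (\<lambda>x. \<Sum>b\<in>Basis. (s x \<bullet> b) *\<^sub>R A x b)"
    by (intro continuous_intros assms)
  ultimately show ?thesis by (simp cong: continuous_on_cong)
qed

text \<open>In finite dimension continuity in each direction is continuity in operator norm, and
  compactness makes it uniform. The bound is uniform in \<open>h\<close>, as the mean value estimate
  requires.\<close>

lemma linear_family_uniformly_continuous:
  fixes A :: "'a::metric_space \<Rightarrow> 'b::euclidean_space \<Rightarrow> 'c::real_normed_vector"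
  assumes "compact S" "\<And>x. x \<in> S \<Longrightarrow> linear (A x)" "\<And>h. continuous_on S (\<lambda>x. A x h)" "0 < e"
  obtains d where "0 < d"
    "\<And>x y h. x \<in> S \<Longrightarrow> y \<in> S \<Longrightarrow> dist x y < d \<Longrightarrow> norm (A x h - A y h) \<le> e * norm h"
proof -
  \<comment> \<open>\<open>D (x, y)\<close> dominates the operator norm of \<open>A x - A y\<close>
    and vanishes on the diagonal, so its uniform continuity, applied at \<open>(x, y)\<close> and
    \<open>(y, y)\<close>, is the claim.\<close>
  define D where "D = (\<lambda>p. \<Sum>b\<in>Basis. norm (A (fst p) b - A (snd p) b))"
  have "continuous_on (S \<times> S) D"
    unfolding D_def
    by (intro continuous_intros continuous_on_compose2[OF assms(3)]) auto
  then have "uniformly_continuous_on (S \<times> S) D"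
    using assms(1) by (intro compact_uniformly_continuous compact_Times)
  then obtain d where d: "d > 0"
    "\<And>p q. p \<in> S \<times> S \<Longrightarrow> q \<in> S \<times> S \<Longrightarrow> dist q p < d \<Longrightarrow> dist (D q) (D p) < e"
    using assms(4) unfolding uniformly_continuous_on_def by meson
  have "norm (A x h - A y h) \<le> e * norm h" if xy: "x \<in> S" "y \<in> S" "dist x y < d" for x y h
  proof -
    have "dist (D (x, y)) (D (y, y)) < e"
      by (rule d(2)) (use xy in \<open>auto simp: dist_Pair_Pair\<close>)
    then have De: "D (x, y) \<le> e"
      by (simp add: D_def dist_real_def)
    have lin: "A z h = (\<Sum>b\<in>Basis. (h \<bullet> b) *\<^sub>R A z b)" if "z \<in> S" for z
    proof -
      interpret linear "A z" by (rule assms(2)) (rule that)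
      show ?thesis
        by (subst euclidean_representation[of h, symmetric]) (simp only: sum scaleR)
    qed
    have "A x h - A y h = (\<Sum>b\<in>Basis. (h \<bullet> b) *\<^sub>R (A x b - A y b))"
      using xy by (simp add: lin sum_subtractf[symmetric] scaleR_diff_right)
    also have "norm \<dots> \<le> (\<Sum>b\<in>Basis. norm h * norm (A x b - A y b))"
      by (rule sum_norm_le) (auto intro!: mult_right_mono simp: Basis_le_norm)
    also have "\<dots> = D (x, y) * norm h"
      by (simp add: D_def sum_distrib_left[symmetric] mult.commute)
    also have "\<dots> \<le> e * norm h"
      using De by (intro mult_right_mono) auto
    finally show ?thesis .
  qed
  then show thesis
    using d(1) that by blast
qed

text \<open>On a bounded convex set the mean value theorem makes the first-order expansion uniform, so that
  it survives the passage to the boundary.\<close>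

lemma uniform_derivative_closure:
  fixes f :: "'a::euclidean_space \<Rightarrow> 'b::real_normed_vector"
  assumes U: "open U" "convex U" "bounded U"
    and f: "continuous_on (closure U) f" "\<And>x. x \<in> U \<Longrightarrow> (f has_derivative f' x) (at x)"
    and f': "\<And>h. continuous_on (closure U) (\<lambda>x. f' x h)"
    and "0 < e"
  obtains d where "0 < d"
    "\<And>p q. p \<in> closure U \<Longrightarrow> q \<in> closure U \<Longrightarrow> dist p q < d \<Longrightarrow>
       norm (f q - f p - f' p (q - p)) \<le> e * norm (q - p)"
proof -
  have lin: "linear (f' x)" if "x \<in> closure U" for x
    by (rule derivative_extension_linear[OF closure_subset order_refl f(2) f' that])
  obtain d where d: "0 < d" and
    dd: "\<And>x y h. x \<in> closure U \<Longrightarrow> y \<in> closure U \<Longrightarrow> dist x y < d \<Longrightarrow> norm (f' x h - f' y h) \<le> e * norm h"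
    using linear_family_uniformly_continuous[of "closure U" f', OF _ lin f' \<open>0 < e\<close>] U(3)
    by (metis compact_closure)
  \<comment> \<open>The strict inequality makes the distance constraint open. This is why close
    pairs in the closure are limits of close pairs of interior points.\<close>
  define U2 where "U2 = (U \<times> U) \<inter> {p. dist (fst p) (snd p) < d}"
  define S2 where "S2 = (closure U \<times> closure U) \<inter> {p. dist (fst p) (snd p) < d}"
  have op: "open {p::'a \<times> 'a. dist (fst p) (snd p) < d}"
    by (intro open_Collect_less continuous_intros)
  have sub: "U2 \<subseteq> S2" "S2 \<subseteq> closure U2"
    using open_Int_closure_subset[OF op, of "U \<times> U"] closure_subset[of U]
    unfolding U2_def S2_def closure_Times by (auto simp: Int_commute)
  define g where "g = (\<lambda>(p, q). e * norm (q - p) - norm (f q - f p - f' p (q - p)))"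
  have "0 \<le> g z" if "z \<in> S2" for z
  proof (rule closure_nonneg[OF _ sub _ that])
    have "continuous_on (closure U \<times> closure U) (\<lambda>z. f' (fst z) (snd z - fst z))"
      by (rule continuous_on_apply_linear)
        (auto intro!: lin continuous_intros continuous_on_compose2[OF f'])
    then have "continuous_on (closure U \<times> closure U) g"
      unfolding g_def case_prod_unfold
      by (intro continuous_intros continuous_on_compose2[OF f(1)]) auto
    then show "continuous_on S2 g"
      by (rule continuous_on_subset) (auto simp: S2_def)
  next
    fix z assume "z \<in> U2"
    then obtain p q where z: "z = (p, q)" "p \<in> U" "q \<in> U" "dist p q < d"
      by (auto simp: U2_def)
    \<comment> \<open>The segment from \<open>p\<close> to \<open>q\<close> stays in this convex
      set, on which \<open>f'\<close> differs from \<open>f' p\<close> by at most \<open>e\<close>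
      in operator norm.\<close>
    let ?N = "U \<inter> ball p d"
    have "norm (f q - f p - f' p (q - p)) \<le> norm (q - p) * e"
    proof (rule differentiable_bound_linearization[where S = ?N])
      have "convex ?N" using U(2) by (intro convex_Int convex_ball)
      moreover have "p \<in> ?N" "q \<in> ?N" using z d by auto
      ultimately show "p + t *\<^sub>R (q - p) \<in> ?N" if "t \<in> {0..1}" for t
        using that convexD_alt[of ?N p q t] by (simp add: algebra_simps)
      show "p \<in> ?N" by fact
      show "(f has_derivative f' x) (at x within ?N)" if "x \<in> ?N" for x
        using f(2) that by (auto intro: has_derivative_at_withinI)
      show "onorm (f' x - f' p) \<le> e" if "x \<in> ?N" for x
        unfolding fun_diff_def
        by (rule onorm_le) (use dd[of x p] that z closure_subset[of U] in \<open>auto simp: dist_commute\<close>)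
    qed
    then show "0 \<le> g z" by (simp add: g_def z mult.commute)
  qed
  then have "norm (f q - f p - f' p (q - p)) \<le> e * norm (q - p)"
    if "p \<in> closure U" "q \<in> closure U" "dist p q < d" for p q
    using that by (force simp: S2_def g_def)
  with d show thesis by (rule that)
qed

lemma has_derivative_closure:
  fixes f :: "'a::euclidean_space \<Rightarrow> 'b::real_normed_vector"
  assumes U: "open U" "convex U" "bounded U"
    and f: "continuous_on (closure U) f" "\<And>x. x \<in> U \<Longrightarrow> (f has_derivative f' x) (at x)"
    and f': "\<And>h. continuous_on (closure U) (\<lambda>x. f' x h)"
    and x: "x \<in> closure U"
  shows "(f has_derivative f' x) (at x within closure U)"
proof -
  have "linear (f' x)"
    by (rule derivative_extension_linear[OF closure_subset order_refl f(2) f' x])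
  then show ?thesis
    unfolding has_derivative_within_alt
  proof (intro conjI allI impI)
    show "bounded_linear (f' x)"
      using \<open>linear (f' x)\<close> by (simp add: linear_conv_bounded_linear)
    fix e :: real assume "0 < e"
    then show "\<exists>d>0. \<forall>y\<in>closure U. norm (y - x) < d \<longrightarrow> norm (f y - f x - f' x (y - x)) \<le> e * norm (y - x)"
      using uniform_derivative_closure[OF U f f'] x by (metis dist_norm norm_minus_commute)
  qed
qed

text \<open>The first factor need not be convex, because differentiability is local.\<close>

lemma has_derivative_Times_closure:
  fixes f :: "'a::euclidean_space \<times> 'b::euclidean_space \<Rightarrow> 'c::real_normed_vector"
  assumes A: "open A" and B: "open B" "convex B" "bounded B"
    and f: "continuous_on (A \<times> closure B) f" "\<And>p. p \<in> A \<times> B \<Longrightarrow> (f has_derivative f' p) (at p)"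
    and f': "\<And>h. continuous_on (A \<times> closure B) (\<lambda>p. f' p h)"
    and p: "p \<in> A \<times> closure B"
  shows "(f has_derivative f' p) (at p within A \<times> closure B)"
proof -
  obtain r where r: "r > 0" "cball (fst p) r \<subseteq> A"
    using A p open_contains_cball by (metis mem_Sigma_iff prod.collapse)
  have cl: "closure (ball (fst p) r \<times> B) = cball (fst p) r \<times> closure B"
    using r(1) by (simp add: closure_Times)
  have sub: "cball (fst p) r \<times> closure B \<subseteq> A \<times> closure B" "ball (fst p) r \<times> B \<subseteq> A \<times> B"
    using r(2) ball_subset_cball by auto
  have "(f has_derivative f' p) (at p within cball (fst p) r \<times> closure B)"
    unfolding cl[symmetric]
  proof (rule has_derivative_closure)
    show "open (ball (fst p) r \<times> B)" using B by (intro open_Times) auto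
    show "convex (ball (fst p) r \<times> B)" using B by (intro convex_Times) auto
    show "bounded (ball (fst p) r \<times> B)" using B by (intro bounded_Times) auto
    show "continuous_on (closure (ball (fst p) r \<times> B)) f"
      unfolding cl using f(1) sub(1) by (rule continuous_on_subset)
    show "continuous_on (closure (ball (fst p) r \<times> B)) (\<lambda>p. f' p h)" for h
      unfolding cl using f' sub(1) by (rule continuous_on_subset)
    show "p \<in> closure (ball (fst p) r \<times> B)"
      unfolding cl using p r(1) by (auto simp: mem_Times_iff)
    show "(f has_derivative f' x) (at x)" if "x \<in> ball (fst p) r \<times> B" for x
      using f(2) that sub(2) by blast
  qed
  moreover have "at p within cball (fst p) r \<times> closure B = at p within A \<times> closure B"
  proof (rule at_within_nhd)
    show "p \<in> ball (fst p) r \<times> UNIV" using r(1) by (auto simp: mem_Times_iff)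
    show "open (ball (fst p) r \<times> UNIV)" by (intro open_Times) auto
    show "cball (fst p) r \<times> closure B \<inter> ball (fst p) r \<times> UNIV - {p} =
      A \<times> closure B \<inter> ball (fst p) r \<times> UNIV - {p}"
      using r(2) ball_subset_cball by auto
  qed
  ultimately show ?thesis by simp
qed

lemma Ck_upto_le: "Ck_upto k U S f \<Longrightarrow> j \<le> k \<Longrightarrow> Ck_upto j U S f"
  by (induction k) (auto simp del: Ck_upto.simps(2) simp: le_Suc_eq dest: Ck_upto_Suc_imp)

section \<open>Integrals over a compact set that depend on a parameter\<close>

lemma set_integrable_compact:
  fixes f :: "'a::euclidean_space \<Rightarrow> real"
  assumes "finite_measure M" "sets M = sets borel" "compact K" "continuous_on K f"
  shows "set_integrable M K f"
proof -
  obtain B where "\<And>x. x \<in> K \<Longrightarrow> \<bar>f x\<bar> \<le> B"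
    using compact_imp_bounded[OF compact_continuous_image[OF assms(4,3)]]
    by (auto simp: bounded_iff)
  then have "AE x in M. norm (indicator K x *\<^sub>R f x) \<le> \<bar>B\<bar>"
    by (intro AE_I2) (force simp: indicator_def)
  moreover have "(\<lambda>x. indicator K x *\<^sub>R f x) \<in> borel_measurable M"
    using borel_measurable_continuous_on_indicator[OF borel_compact[OF assms(3)] assms(4)]
      measurable_cong_sets[OF assms(2) refl] by blast
  ultimately show ?thesis
    unfolding set_integrable_def by (rule finite_measure.integrable_const_bound[OF assms(1)])
qed

lemma set_integral_compact_bound:
  fixes f :: "'a::euclidean_space \<Rightarrow> real"
  assumes "finite_measure M" "sets M = sets borel" "compact K" "continuous_on K f"
    "\<And>x. x \<in> K \<Longrightarrow> \<bar>f x\<bar> \<le> e" "0 \<le> e"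
  shows "\<bar>LINT x:K|M. f x\<bar> \<le> e * measure M (space M)"
proof -
  interpret finite_measure M by fact
  have "norm (LINT x|M. indicator K x *\<^sub>R f x) \<le> (LINT x|M. e)"
    by (rule Bochner_Integration.integral_norm_bound_integral)
      (use set_integrable_compact[OF assms(1-4)] assms(5,6) in
        \<open>auto simp: set_integrable_def indicator_def\<close>)
  then show ?thesis by (simp add: set_lebesgue_integral_def mult.commute)
qed

lemma continuous_on_Pair_slice:
  assumes "continuous_on (S \<times> K) g" "y \<in> S"
  shows "continuous_on K (\<lambda>z. g (y, z))"
  by (rule continuous_on_compose2[OF assms(1)]) (use assms(2) in \<open>auto intro!: continuous_intros\<close>)

lemma continuous_on_parameter_integral:
  fixes g :: "'a::euclidean_space \<times> 'b::euclidean_space \<Rightarrow> real"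
  assumes M: "finite_measure M" "sets M = sets borel"
    and K: "compact S" "compact K" and g: "continuous_on (S \<times> K) g"
  shows "continuous_on S (\<lambda>y. LINT z:K|M. g (y, z))"
  unfolding continuous_on_iff
proof (intro ballI allI impI)
  fix y and e :: real
  assume y: "y \<in> S" and "0 < e"
  define m where "m = measure M (space M)"
  have "m \<ge> 0" by (simp add: m_def)
  \<comment> \<open>The summand 1 allows total mass zero and keeps the final estimate
    strict.\<close>
  define e' where "e' = e / (m + 1)"
  have e': "0 < e'" "e' * m < e"
    using \<open>0 < e\<close> \<open>m \<ge> 0\<close> by (auto simp: e'_def field_simps)
  have "uniformly_continuous_on (S \<times> K) g"
    using K g by (intro compact_uniformly_continuous compact_Times)
  then obtain d where d: "d > 0"
    "\<And>p q. p \<in> S \<times> K \<Longrightarrow> q \<in> S \<times> K \<Longrightarrow> dist q p < d \<Longrightarrow> dist (g q) (g p) < e'"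
    using e' unfolding uniformly_continuous_on_def by meson
  have "dist (LINT z:K|M. g (y', z)) (LINT z:K|M. g (y, z)) < e"
    if y': "y' \<in> S" "dist y' y < d" for y'
  proof -
    note cont = continuous_on_Pair_slice[OF g y'(1)] continuous_on_Pair_slice[OF g y]
    have "\<bar>LINT z:K|M. g (y', z) - g (y, z)\<bar> \<le> e' * m"
      unfolding m_def
    proof (rule set_integral_compact_bound[OF M K(2)])
      show "\<bar>g (y', z) - g (y, z)\<bar> \<le> e'" if "z \<in> K" for z
        using d(2)[of "(y, z)" "(y', z)"] that y' y by (auto simp: dist_Pair_Pair dist_real_def)
    qed (use e' in \<open>auto intro!: continuous_on_diff cont\<close>)
    moreover have "(LINT z:K|M. g (y', z) - g (y, z)) = (LINT z:K|M. g (y', z)) - (LINT z:K|M. g (y, z))"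
      by (rule set_integral_diff) (intro set_integrable_compact[OF M K(2)] cont)+
    ultimately show ?thesis using e' by (simp add: dist_real_def)
  qed
  then show "\<exists>d>0. \<forall>y'\<in>S. dist y' y < d \<longrightarrow> dist (LINT z:K|M. g (y', z)) (LINT z:K|M. g (y, z)) < e"
    using d(1) by blast
qed

text \<open>\<open>M\<close> may charge the boundary of \<open>B\<close>, so the expansion in
  \<open>y\<close> is needed for \<open>z\<close> on the boundary as well. The uniform first-order
  expansion on the closure of \<open>A \<times> B\<close> bounds the remainder by the same multiple
  of \<open>norm (y' - y)\<close> for all \<open>z\<close>, and integration preserves this bound up
  to the total mass.\<close>

lemma has_derivative_parameter_integral:
  fixes g :: "'a::euclidean_space \<times> 'b::euclidean_space \<Rightarrow> real"
  assumes M: "finite_measure M" "sets M = sets borel"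
    and A: "open A" "convex A" "bounded A" and B: "open B" "convex B" "bounded B"
    and g: "continuous_on (closure A \<times> closure B) g"
      "\<And>p. p \<in> A \<times> B \<Longrightarrow> (g has_derivative g' p) (at p)"
    and g': "\<And>h. continuous_on (closure A \<times> closure B) (\<lambda>p. g' p h)"
    and y: "y \<in> closure A"
  shows "((\<lambda>y. LINT z:closure B|M. g (y, z)) has_derivative
    (\<lambda>h. LINT z:closure B|M. g' (y, z) (h, 0))) (at y within closure A)"
proof -
  let ?K = "closure B"
  have K: "compact ?K" using B by (simp add: compact_closure)
  have lin: "linear (g' p)" if "p \<in> closure A \<times> ?K" for p
    by (rule derivative_extension_linear[where U = "A \<times> B" and S = "closure A \<times> ?K" and f = g])
      (use g g' that closure_subset[of A] closure_subset[of B] in \<open>auto simp: closure_Times\<close>)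
  have int': "set_integrable M ?K (\<lambda>z. g' (y, z) h)" for h
    by (intro set_integrable_compact[OF M K] continuous_on_Pair_slice[OF g' y])
  have int: "set_integrable M ?K (\<lambda>z. g (y, z))" if "y \<in> closure A" for y
    by (intro set_integrable_compact[OF M K] continuous_on_Pair_slice[OF g(1) that])
  define I where "I = (\<lambda>h. LINT z:?K|M. g' (y, z) (h, 0))"
  have linI: "linear I"
  proof (rule linearI)
    fix h k
    have "I (h + k) = (LINT z:?K|M. g' (y, z) (h, 0) + g' (y, z) (k, 0))"
      unfolding I_def
    proof (rule set_lebesgue_integral_cong)
      show "?K \<in> sets M" using M(2) by simp
      show "\<forall>z. z \<in> ?K \<longrightarrow> g' (y, z) (h + k, 0) = g' (y, z) (h, 0) + g' (y, z) (k, 0)"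
        using linear_add[OF lin, of "(y, z)" "(h, 0)" "(k, 0)" for z] y by auto
    qed
    then show "I (h + k) = I h + I k"
      by (simp add: I_def set_integral_add int')
  next
    fix r :: real and h
    have "I (r *\<^sub>R h) = (LINT z:?K|M. r * g' (y, z) (h, 0))"
      unfolding I_def
    proof (rule set_lebesgue_integral_cong)
      show "?K \<in> sets M" using M(2) by simp
      show "\<forall>z. z \<in> ?K \<longrightarrow> g' (y, z) (r *\<^sub>R h, 0) = r * g' (y, z) (h, 0)"
        using linear_scale[OF lin, of "(y, z)" r "(h, 0)" for z] y by auto
    qed
    then show "I (r *\<^sub>R h) = r *\<^sub>R I h"
      by (simp add: I_def)
  qed
  have "\<exists>d>0. \<forall>y'\<in>closure A. norm (y' - y) < d \<longrightarrow>
      norm ((LINT z:?K|M. g (y', z)) - (LINT z:?K|M. g (y, z)) - I (y' - y)) \<le> e * norm (y' - y)"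
    if "0 < e" for e
  proof -
    define m where "m = measure M (space M)"
    have "m \<ge> 0" by (simp add: m_def)
    define e' where "e' = e / (m + 1)"
    have e': "0 < e'" "e' * m \<le> e"
      using \<open>0 < e\<close> \<open>m \<ge> 0\<close> by (auto simp: e'_def field_simps)
    obtain d where d: "d > 0"
      "\<And>p q. p \<in> closure (A \<times> B) \<Longrightarrow> q \<in> closure (A \<times> B) \<Longrightarrow> dist p q < d \<Longrightarrow>
         norm (g q - g p - g' p (q - p)) \<le> e' * norm (q - p)"
      using uniform_derivative_closure[of "A \<times> B" g g' e'] A B g g' e'(1)
      by (metis open_Times convex_Times bounded_Times closure_Times)
    have "norm ((LINT z:?K|M. g (y', z)) - (LINT z:?K|M. g (y, z)) - I (y' - y)) \<le> e * norm (y' - y)"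
      if y': "y' \<in> closure A" "norm (y' - y) < d" for y'
    proof -
      note cont = continuous_on_Pair_slice[OF g(1) y'(1)] continuous_on_Pair_slice[OF g(1) y]
        continuous_on_Pair_slice[OF g' y]
      have "\<bar>LINT z:?K|M. g (y', z) - g (y, z) - g' (y, z) (y' - y, 0)\<bar> \<le> (e' * norm (y' - y)) * m"
        unfolding m_def
      proof (rule set_integral_compact_bound[OF M K])
        show "\<bar>g (y', z) - g (y, z) - g' (y, z) (y' - y, 0)\<bar> \<le> e' * norm (y' - y)" if "z \<in> ?K" for z
          using d(2)[of "(y, z)" "(y', z)"] that y' y
          by (auto simp: dist_Pair_Pair dist_norm closure_Times norm_minus_commute norm_Pair)
      qed (use e' in \<open>auto intro!: continuous_on_diff cont\<close>)
      also have "\<dots> \<le> e * norm (y' - y)"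
        using mult_right_mono[OF e'(2) norm_ge_zero[of "y' - y"]] by (simp add: mult_ac)
      also have "(LINT z:?K|M. g (y', z) - g (y, z) - g' (y, z) (y' - y, 0)) =
          (LINT z:?K|M. g (y', z)) - (LINT z:?K|M. g (y, z)) - I (y' - y)"
        unfolding I_def
        using int[OF y'(1)] int[OF y] int' by (simp add: set_integral_diff)
      finally show ?thesis by simp
    qed
    then show ?thesis using d(1) by blast
  qed
  then show ?thesis
    unfolding I_def[symmetric] has_derivative_within_alt
    using linI by (simp add: linear_conv_bounded_linear)
qed

lemma Ck_upto_parameter_integral:
  fixes g :: "'a::euclidean_space \<times> 'b::euclidean_space \<Rightarrow> real"
  assumes M: "finite_measure M" "sets M = sets borel"
    and A: "open A" "convex A" "bounded A" and B: "open B" "convex B" "bounded B"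
    and g: "Ck_upto k (A \<times> B) (closure A \<times> closure B) g"
  shows "Ck_upto k A (closure A) (\<lambda>y. LINT z:closure B|M. g (y, z))"
  using g
proof (induction k arbitrary: g)
  case 0
  then show ?case
    using continuous_on_parameter_integral[OF M, of "closure A" "closure B" g] A(3) B(3)
    by (simp add: compact_closure)
next
  case (Suc k)
  obtain g' where g': "\<And>p. p \<in> A \<times> B \<Longrightarrow> (g has_derivative g' p) (at p)"
    "\<And>h. Ck_upto k (A \<times> B) (closure A \<times> closure B) (\<lambda>p. g' p h)"
    using Ck_upto_SucE[OF Suc.prems] by blast
  have der: "((\<lambda>y. LINT z:closure B|M. g (y, z)) has_derivative
      (\<lambda>h. LINT z:closure B|M. g' (y, z) (h, 0))) (at y within closure A)" if "y \<in> closure A" for y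
    by (rule has_derivative_parameter_integral[OF M A B Ck_upto_continuous_on[OF Suc.prems] g'(1)
          Ck_upto_continuous_on[OF g'(2)] that])
  show ?case
  proof (rule Ck_upto_SucI[where f' = "\<lambda>y h. LINT z:closure B|M. g' (y, z) (h, 0)"])
    show "continuous_on (closure A) (\<lambda>y. LINT z:closure B|M. g (y, z))"
      by (rule has_derivative_continuous_on) (rule der)
    show "((\<lambda>y. LINT z:closure B|M. g (y, z)) has_derivative
        (\<lambda>h. LINT z:closure B|M. g' (y, z) (h, 0))) (at y)" if y: "y \<in> A" for y
    proof -
      have "((\<lambda>y. LINT z:closure B|M. g (y, z)) has_derivative
          (\<lambda>h. LINT z:closure B|M. g' (y, z) (h, 0))) (at y within A)"
        by (rule has_derivative_subset[OF der[OF subsetD[OF closure_subset y]] closure_subset])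
      then show ?thesis by (simp add: at_within_open[OF y A(1)])
    qed
    show "Ck_upto k A (closure A) (\<lambda>y. LINT z:closure B|M. g' (y, z) (h, 0))" for h
      by (rule Suc.IH) (rule g'(2))
  qed
qed

section \<open>Composition and implicit functions\<close>

text \<open>\<open>T x\<close> may lie on the boundary of \<open>B\<close>, where \<open>g\<close>
  is differentiable only relative to \<open>A \<times> closure B\<close>. The graph of
  \<open>T\<close> stays in that set, so the relative chain rule applies, and since \<open>A\<close>
  is open its conclusion is an ordinary derivative in \<open>x\<close>.\<close>

lemma Ck_upto_compose_graph:
  fixes g :: "'a::euclidean_space \<times> 'b::euclidean_space \<Rightarrow> 'c::real_normed_vector"
  assumes A: "open A" and B: "open B" "convex B" "bounded B"
    and g: "Ck_upto k (A \<times> B) (A \<times> closure B) g"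
    and T: "Ck_upto k A A T" "\<And>x. x \<in> A \<Longrightarrow> T x \<in> closure B"
  shows "Ck_upto k A A (\<lambda>x. g (x, T x))"
  using g T(1)
proof (induction k arbitrary: g)
  case 0
  then show ?case
    using T(2) by (auto intro!: continuous_on_compose2[of "A \<times> closure B" g] continuous_intros)
next
  case (Suc k)
  obtain g' where g': "\<And>p. p \<in> A \<times> B \<Longrightarrow> (g has_derivative g' p) (at p)"
    "\<And>h. Ck_upto k (A \<times> B) (A \<times> closure B) (\<lambda>p. g' p h)"
    using Ck_upto_SucE[OF Suc.prems(1)] by blast
  obtain T' where T': "\<And>x. x \<in> A \<Longrightarrow> (T has_derivative T' x) (at x)" "\<And>h. Ck_upto k A A (\<lambda>x. T' x h)"
    using Ck_upto_SucE[OF Suc.prems(2)] by blast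
  have der: "(g has_derivative g' p) (at p within A \<times> closure B)" if "p \<in> A \<times> closure B" for p
    by (rule has_derivative_Times_closure[OF A B Ck_upto_continuous_on[OF Suc.prems(1)] g'(1)
          Ck_upto_continuous_on[OF g'(2)] that])
  have lin: "linear (g' p)" if "p \<in> A \<times> closure B" for p
    using has_derivative_linear[OF der[OF that]] .
  have IH: "Ck_upto k A A (\<lambda>x. g' (x, T x) h)" for h
    by (rule Suc.IH[OF g'(2) Ck_upto_Suc_imp[OF Suc.prems(2)]])
  show ?case
  proof (rule Ck_upto_SucI[where f' = "\<lambda>x h. g' (x, T x) (h, T' x h)"])
    show "continuous_on A (\<lambda>x. g (x, T x))"
      using Ck_upto_continuous_on[OF Suc.prems(1)] Ck_upto_continuous_on[OF Suc.prems(2)] T(2)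
      by (auto intro!: continuous_on_compose2[of "A \<times> closure B" g] continuous_intros)
    show "((\<lambda>x. g (x, T x)) has_derivative (\<lambda>h. g' (x, T x) (h, T' x h))) (at x)" if x: "x \<in> A" for x
    proof -
      have "((\<lambda>x. (x, T x)) has_derivative (\<lambda>h. (h, T' x h))) (at x within A)"
        using T'(1)[OF x] by (auto intro!: derivative_eq_intros intro: has_derivative_at_withinI)
      moreover have "(g has_derivative g' (x, T x)) (at (x, T x) within (\<lambda>x. (x, T x)) ` A)"
        by (rule has_derivative_subset[OF der]) (use T(2) x in auto)
      ultimately have "((\<lambda>x. g (x, T x)) has_derivative (\<lambda>h. g' (x, T x) (h, T' x h))) (at x within A)"
        by (rule has_derivative_in_compose)
      then show ?thesis using at_within_open[OF x A] by simp
    qed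
    fix h
    have "Ck_upto k A A (\<lambda>x. g' (x, T x) (0, T' x h))"
    proof (rule Ck_upto_apply_linear[where A = "\<lambda>x s. g' (x, T x) (0, s)", OF A order_refl _ _ T'(2)])
      show "linear (\<lambda>s. g' (x, T x) (0, s))" if "x \<in> A" for x
        using linear_compose[OF _ lin[of "(x, T x)"], of "Pair 0"] T(2) that
        by (simp add: o_def linear_iff)
    qed (rule IH)
    then have "Ck_upto k A A (\<lambda>x. g' (x, T x) (h, 0) + g' (x, T x) (0, T' x h))"
      by (intro Ck_upto_add IH)
    then show "Ck_upto k A A (\<lambda>x. g' (x, T x) (h, T' x h))"
      by (rule Ck_upto_cong[OF A order_refl, rotated])
        (use T(2) in \<open>simp flip: linear_add[OF lin]\<close>)
  qed
qed

lemma coercive_linear_inverse: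
  fixes f :: "'b::euclidean_space \<Rightarrow> 'b"
  assumes "linear f" "0 < C" "\<And>h. C * norm h \<le> norm (f h)"
  obtains g where "linear g" "\<And>h. f (g h) = h"
proof -
  have "h = 0" if "f h = 0" for h
    using assms(3)[of h] assms(2) that by (simp add: mult_le_0_iff)
  then have "inj f"
    using linear_injective_0[OF assms(1)] by blast
  then show thesis
    using linear_injective_isomorphism[OF assms(1)] that by blast
qed

text \<open>The bound \<open>C\<close> controls the inverses of all \<open>A x\<close> at once, so
  \<open>S x - S x0\<close> is estimated by the residual \<open>b x - A x (S x0)\<close>, in which
  the argument of \<open>A x\<close> is frozen. The derivative of \<open>S\<close> solves a system
  with the same \<open>A\<close> and a new right-hand side, hence the induction with
  \<open>b\<close> and \<open>S\<close> arbitrary.\<close>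

lemma Ck_upto_solve_linear:
  fixes A :: "'a::euclidean_space \<Rightarrow> 'b::euclidean_space \<Rightarrow> 'b"
  assumes U: "open U" and lin: "\<And>x. x \<in> U \<Longrightarrow> linear (A x)"
    and C: "0 < C" "\<And>x h. x \<in> U \<Longrightarrow> C * norm h \<le> norm (A x h)"
    and A: "\<And>s. Ck_upto k U U (\<lambda>x. A x s)" and b: "Ck_upto k U U b"
    and S: "\<And>x. x \<in> U \<Longrightarrow> A x (S x) = b x"
  shows "Ck_upto k U U S"
  using A b S
proof (induction k arbitrary: b S)
  case 0
  have "continuous_on U S"
    unfolding continuous_on_def
  proof
    fix x0 assume x0: "x0 \<in> U"
    have "((\<lambda>x. b x - A x (S x0)) \<longlongrightarrow> b x0 - A x0 (S x0)) (at x0 within U)"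
      by (intro tendsto_diff) (use 0(1,2) x0 in \<open>simp_all add: continuous_on_def\<close>)
    then have "((\<lambda>x. inverse C * norm (b x - A x (S x0))) \<longlongrightarrow> 0) (at x0 within U)"
      unfolding 0(3)[OF x0] using tendsto_mult_right_zero[OF tendsto_norm_zero] by fastforce
    then have "((\<lambda>x. S x - S x0) \<longlongrightarrow> 0) (at x0 within U)"
    proof (rule Lim_null_comparison[rotated])
      have "norm (S x - S x0) \<le> inverse C * norm (b x - A x (S x0))" if "x \<in> U" for x
        using C(2)[OF that, of "S x - S x0"] C(1) 0(3)[OF that] linear_diff[OF lin[OF that]]
        by (simp add: field_simps)
      then show "\<forall>\<^sub>F x in at x0 within U. norm (S x - S x0) \<le> inverse C * norm (b x - A x (S x0))"
        by (auto simp: eventually_at_filter)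
    qed
    then show "(S \<longlongrightarrow> S x0) (at x0 within U)"
      using LIM_zero_iff by blast
  qed
  then show ?case by simp
next
  case (Suc k)
  have "\<forall>s. \<exists>A'. (\<forall>x\<in>U. ((\<lambda>x. A x s) has_derivative A' x) (at x)) \<and> (\<forall>h. Ck_upto k U U (\<lambda>x. A' x h))"
    using Suc.prems(1) by auto
  then obtain A' where A': "\<And>x s. x \<in> U \<Longrightarrow> ((\<lambda>x. A x s) has_derivative A' s x) (at x)"
    "\<And>s h. Ck_upto k U U (\<lambda>x. A' s x h)"
    by metis
  obtain b' where b': "\<And>x. x \<in> U \<Longrightarrow> (b has_derivative b' x) (at x)" "\<And>h. Ck_upto k U U (\<lambda>x. b' x h)"
    using Ck_upto_SucE[OF Suc.prems(2)] by blast
  have "\<forall>x\<in>U. \<exists>N. linear N \<and> (\<forall>h. A x (N h) = h)"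
    using coercive_linear_inverse[OF lin C(1) C(2)] by metis
  then obtain N where N: "\<And>x. x \<in> U \<Longrightarrow> linear (N x)" "\<And>x h. x \<in> U \<Longrightarrow> A x (N x h) = h"
    by metis
  have Sk: "Ck_upto k U U S"
    by (rule Suc.IH[OF Ck_upto_Suc_imp[OF Suc.prems(1)] Ck_upto_Suc_imp[OF Suc.prems(2)] Suc.prems(3)])
  \<comment> \<open>Found by differentiating \<open>A x (S x) = b x\<close> formally and solving for
    the derivative of \<open>S\<close>.\<close>
  define S' where "S' = (\<lambda>x h. N x (b' x h - A' (S x) x h))"
  have AS': "A x (S' x h) = b' x h - A' (S x) x h" if "x \<in> U" for x h
    using N(2)[OF that] by (simp add: S'_def)
  have der: "(S has_derivative S' x0) (at x0)" if x0: "x0 \<in> U" for x0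
  proof -
    have linA': "linear (\<lambda>h. b' x0 h - A' (S x0) x0 h)"
      using has_derivative_linear[OF has_derivative_diff[OF b'(1)[OF x0] A'(1)[OF x0]]] .
    have linS': "linear (S' x0)"
      using linear_compose[OF linA' N(1)[OF x0]] by (simp add: S'_def o_def)
    \<comment> \<open>This is \<open>A x\<close> applied to the first-order remainder of
      \<open>S\<close> at \<open>x0\<close>. Written with \<open>A x\<close> in fixed directions
      only, it is differentiable at \<open>x0\<close> with derivative zero, and coercivity turns
      this into a bound on the remainder itself.\<close>
    define D where "D = (\<lambda>x. b x - A x (S x0) - (\<Sum>e\<in>Basis. ((x - x0) \<bullet> e) *\<^sub>R A x (S' x0 e)))"
    have "(D has_derivative (\<lambda>h. b' x0 h - A' (S x0) x0 h -
        (\<Sum>e\<in>Basis. ((x0 - x0) \<bullet> e) *\<^sub>R A' (S' x0 e) x0 h + (h \<bullet> e) *\<^sub>R A x0 (S' x0 e)))) (at x0)"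
      unfolding D_def
      by (intro has_derivative_diff b'(1) A'(1) x0 has_derivative_sum has_derivative_scaleR)
        (auto intro!: derivative_eq_intros)
    moreover have "(\<Sum>e\<in>Basis. (h \<bullet> e) *\<^sub>R A x0 (S' x0 e)) = b' x0 h - A' (S x0) x0 h" for h
    proof -
      have "(\<Sum>e\<in>Basis. (h \<bullet> e) *\<^sub>R A x0 (S' x0 e)) = A x0 (S' x0 (\<Sum>e\<in>Basis. (h \<bullet> e) *\<^sub>R e))"
        by (simp only: linear_sum[OF linS'] linear_scale[OF linS'] linear_sum[OF lin[OF x0]] linear_scale[OF lin[OF x0]])
      then show ?thesis by (simp add: euclidean_representation AS'[OF x0])
    qed
    ultimately have "(D has_derivative (\<lambda>h. 0)) (at x0)" by simp
    moreover have "D x0 = 0" using Suc.prems(3)[OF x0] by (simp add: D_def)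
    ultimately have D: "\<exists>d>0. \<forall>x. norm (x - x0) < d \<longrightarrow> norm (D x) \<le> e * norm (x - x0)" if "0 < e" for e
      using that unfolding has_derivative_at_alt by simp
    obtain r where r: "r > 0" "ball x0 r \<subseteq> U"
      using U x0 open_contains_ball by blast
    show ?thesis
      unfolding has_derivative_at_alt
    proof (intro conjI allI impI)
      show "bounded_linear (S' x0)" using linS' by (simp add: linear_conv_bounded_linear)
      fix e :: real assume "0 < e"
      then obtain d where d: "d > 0" "\<And>x. norm (x - x0) < d \<Longrightarrow> norm (D x) \<le> (C * e) * norm (x - x0)"
        using D[of "C * e"] C(1) by auto
      have "norm (S x - S x0 - S' x0 (x - x0)) \<le> e * norm (x - x0)" if "norm (x - x0) < min d r" for x
      proof -
        have x: "x \<in> U" using that r by (auto simp: dist_norm norm_minus_commute)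
        have "S' x0 (x - x0) = (\<Sum>e\<in>Basis. ((x - x0) \<bullet> e) *\<^sub>R S' x0 e)"
          by (subst euclidean_representation[of "x - x0", symmetric])
            (simp only: linear_sum[OF linS'] linear_scale[OF linS'])
        then have "A x (S x - S x0 - S' x0 (x - x0)) = D x"
          unfolding D_def
          by (simp add: linear_diff[OF lin[OF x]] linear_sum[OF lin[OF x]] linear_scale[OF lin[OF x]] Suc.prems(3)[OF x])
        then have "C * norm (S x - S x0 - S' x0 (x - x0)) \<le> norm (D x)"
          using C(2)[OF x] by metis
        also have "\<dots> \<le> C * (e * norm (x - x0))"
          using d(2) that by (simp add: mult.assoc)
        finally show ?thesis using C(1) by simp
      qed
      then show "\<exists>d>0. \<forall>x. norm (x - x0) < d \<longrightarrow> norm (S x - S x0 - S' x0 (x - x0)) \<le> e * norm (x - x0)"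
        using d(1) r(1) by (intro exI[of _ "min d r"]) auto
    qed
  qed
  show ?case
  proof (rule Ck_upto_SucI[where f' = S'])
    show "continuous_on U S" using Ck_upto_continuous_on[OF Sk] .
    show "(S has_derivative S' x) (at x)" if "x \<in> U" for x using der[OF that] .
    fix h
    have "Ck_upto k U U (\<lambda>x. A' (S x) x h)"
    proof (rule Ck_upto_apply_linear[where A = "\<lambda>x s. A' s x h", OF U order_refl _ A'(2) Sk])
      fix x assume x: "x \<in> U"
      \<comment> \<open>\<open>A'\<close> was chosen separately for each \<open>s\<close>, so its
        linearity in \<open>s\<close> has to be recovered from the uniqueness of
        derivatives.\<close>
      have "((\<lambda>x. A x s + A x t) has_derivative A' (s + t) x) (at x)" for s t
        by (rule has_derivative_transform_within_open[OF A'(1)[OF x] U x])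
          (simp add: linear_add[OF lin])
      then have "A' (s + t) x = (\<lambda>h. A' s x h + A' t x h)" for s t
        using has_derivative_unique[OF _ has_derivative_add[OF A'(1)[OF x] A'(1)[OF x]]] by blast
      moreover have "((\<lambda>x. r *\<^sub>R A x s) has_derivative A' (r *\<^sub>R s) x) (at x)" for r s
        by (rule has_derivative_transform_within_open[OF A'(1)[OF x] U x])
          (simp add: linear_scale[OF lin])
      then have "A' (r *\<^sub>R s) x = (\<lambda>h. r *\<^sub>R A' s x h)" for r s
        using has_derivative_unique[OF _ has_derivative_scaleR_right[OF A'(1)[OF x]]] by blast
      ultimately show "linear (\<lambda>s. A' s x h)"
        by (intro linearI) simp_all
    qed
    then have "Ck_upto k U U (\<lambda>x. b' x h + - A' (S x) x h)"
      by (intro Ck_upto_add b'(2) Ck_upto_bounded_linear[OF bounded_linear_minus[OF bounded_linear_ident]])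
    then show "Ck_upto k U U (\<lambda>x. S' x h)"
      by (rule Suc.IH[OF Ck_upto_Suc_imp[OF Suc.prems(1)]]) (simp add: AS')
  qed
qed

text \<open>Strong monotonicity replaces the extension of \<open>G\<close> beyond the boundary that the usual implicit
  function theorem would need where \<open>T x\<close> lies on the boundary.\<close>

lemma Ck_upto_implicit:
  fixes G :: "'a::euclidean_space \<times> 'b::euclidean_space \<Rightarrow> 'b"
  assumes A: "open A" and B: "open B" "convex B" "bounded B"
    and G: "Ck_upto (Suc k) (A \<times> B) (A \<times> closure B) G"
    and T: "\<And>x. x \<in> A \<Longrightarrow> T x \<in> closure B" "\<And>x. x \<in> A \<Longrightarrow> G (x, T x) = 0"
    and C: "0 < C" "\<And>x y z. x \<in> A \<Longrightarrow> y \<in> closure B \<Longrightarrow> z \<in> closure B \<Longrightarrow>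
      C * (norm (y - z))\<^sup>2 \<le> (G (x, y) - G (x, z)) \<bullet> (y - z)"
  shows "Ck_upto (Suc k) A A T"
proof -
  obtain G' where G': "\<And>p. p \<in> A \<times> B \<Longrightarrow> (G has_derivative G' p) (at p)"
    "\<And>h. Ck_upto k (A \<times> B) (A \<times> closure B) (\<lambda>p. G' p h)"
    using Ck_upto_SucE[OF G] by blast
  note contG' = Ck_upto_continuous_on[OF G'(2)]
  have der: "(G has_derivative G' p) (at p within A \<times> closure B)" if "p \<in> A \<times> closure B" for p
    by (rule has_derivative_Times_closure[OF A B Ck_upto_continuous_on[OF G] G'(1) contG' that])
  have lin: "linear (G' p)" if "p \<in> A \<times> closure B" for p
    using has_derivative_linear[OF der[OF that]] .
  \<comment> \<open>Strong monotonicity of \<open>G\<close> in its second argument differentiates to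
    coercivity of the partial derivative. This is shown where \<open>y\<close> can be moved in every
    direction and then passed to the boundary of \<open>B\<close>.\<close>
  have "0 \<le> G' p (0, h) \<bullet> h - C * (norm h)\<^sup>2" if "p \<in> A \<times> B" for p h
  proof (rule ccontr)
    assume neg: "\<not> 0 \<le> G' p (0, h) \<bullet> h - C * (norm h)\<^sup>2"
    obtain x y where p: "p = (x, y)" "x \<in> A" "y \<in> B" using \<open>p \<in> A \<times> B\<close> by auto
    obtain r where r: "r > 0" "ball y r \<subseteq> B" using p B(1) open_contains_ball by blast
    \<comment> \<open>Strong monotonicity between \<open>y\<close> and
      \<open>y + t *\<^sub>R h\<close> says \<open>0 \<le> t * f t\<close>, whereas a negative
      derivative at 0 together with \<open>f 0 = 0\<close> would give \<open>f t < 0\<close> for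
      small positive \<open>t\<close>.\<close>
    define f where "f = (\<lambda>t. (G (x, y + t *\<^sub>R h) - G (x, y)) \<bullet> h - C * t * (norm h)\<^sup>2)"
    have "((\<lambda>t. G (x, y + t *\<^sub>R h)) has_derivative (\<lambda>t. G' p (0, t *\<^sub>R h))) (at 0)"
      by (rule has_derivative_compose[where g = G and g' = "G' p" and f = "\<lambda>t. (x, y + t *\<^sub>R h)"])
        (auto intro!: derivative_eq_intros G'(1)[of p, unfolded p(1)] simp: p)
    moreover have "G' p (0, t *\<^sub>R h) = t *\<^sub>R G' p (0, h)" for t
      using linear_scale[OF lin, of p t "(0, h)"] p closure_subset[of B] by auto
    ultimately have "(f has_real_derivative G' p (0, h) \<bullet> h - C * (norm h)\<^sup>2) (at 0)"
      unfolding f_def has_field_derivative_def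
      by (auto intro!: derivative_eq_intros simp: algebra_simps)
    from DERIV_neg_dec_right[OF this] neg
    obtain d where d: "d > 0" "\<And>t. 0 < t \<Longrightarrow> t < d \<Longrightarrow> f t < f 0" by auto
    \<comment> \<open>Small enough for the decrease of \<open>f\<close> and for
      \<open>y + t *\<^sub>R h\<close> to stay in the ball of radius \<open>r\<close>; the summand 1
      covers \<open>h = 0\<close>.\<close>
    define t where "t = min (d / 2) (r / (2 * (norm h + 1)))"
    have t: "0 < t" "t < d" using d r by (auto simp: t_def add_nonneg_pos)
    have "t \<le> r / (2 * (norm h + 1))" by (simp add: t_def)
    then have "t * norm h \<le> r / (2 * (norm h + 1)) * norm h" by (rule mult_right_mono) simp
    also have "\<dots> = r * (norm h / (2 * (norm h + 1)))" by simp
    also have "\<dots> < r * 1"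
    proof (rule mult_strict_left_mono[OF _ r(1)])
      have "a / (2 * (a + 1)) < 1" if "0 \<le> a" for a :: real
        using that by (simp add: divide_less_eq)
      from this[OF norm_ge_zero] show "norm h / (2 * (norm h + 1)) < 1" .
    qed
    also have "\<dots> = r" by simp
    finally have "y + t *\<^sub>R h \<in> B" using r t by (auto simp: dist_norm subset_iff)
    then have "C * (norm (t *\<^sub>R h))\<^sup>2 \<le> (G (x, y + t *\<^sub>R h) - G (x, y)) \<bullet> (t *\<^sub>R h)"
      using C(2)[of x "y + t *\<^sub>R h" y] p closure_subset[of B] by auto
    then have "0 \<le> t * f t"
      by (simp add: f_def power_mult_distrib power2_eq_square algebra_simps)
    then have "0 \<le> f t" using t(1) by (simp add: zero_le_mult_iff)
    moreover have "f 0 = 0" by (simp add: f_def)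
    ultimately show False using d(2)[OF t] by simp
  qed
  then have "0 \<le> G' p (0, h) \<bullet> h - C * (norm h)\<^sup>2" if "p \<in> A \<times> closure B" for p h
    by (intro closure_nonneg[where U = "A \<times> B" and S = "A \<times> closure B" and
          f = "\<lambda>p. G' p (0, h) \<bullet> h - C * (norm h)\<^sup>2", OF _ _ _ _ that])
      (use closure_subset[of A] closure_subset[of B] in \<open>auto intro!: continuous_intros contG' simp: closure_Times\<close>)
  then have coercive: "C * norm h \<le> norm (G' p (0, h))" if "p \<in> A \<times> closure B" for p h
  proof -
    have "C * norm h * norm h \<le> G' p (0, h) \<bullet> h"
      using \<open>\<And>p h. p \<in> A \<times> closure B \<Longrightarrow> 0 \<le> G' p (0, h) \<bullet> h - C * (norm h)\<^sup>2\<close>[OF that, of h]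
      by (simp add: power2_eq_square)
    also have "\<dots> \<le> norm (G' p (0, h)) * norm h" by (rule norm_cauchy_schwarz)
    finally show ?thesis
      by (cases "h = 0") (auto simp: mult_le_cancel_right)
  qed
  define E where "E = (\<lambda>x s. G' (x, T x) (0, s))"
  have linE: "linear (E x)" if "x \<in> A" for x
    using linear_compose[OF _ lin[of "(x, T x)"], of "Pair 0"] T(1) that
    by (simp add: o_def linear_iff E_def)
  have E: "C * norm h \<le> norm (E x h)" if "x \<in> A" for x h
    using coercive T(1) that by (simp add: E_def)
  have "\<forall>x\<in>A. \<exists>N. linear N \<and> (\<forall>h. E x (N h) = h)"
    using coercive_linear_inverse[OF linE C(1) E] by metis
  then obtain N where N: "\<And>x. x \<in> A \<Longrightarrow> linear (N x)" "\<And>x h. x \<in> A \<Longrightarrow> E x (N x h) = h"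
    by metis
  \<comment> \<open>Found by differentiating \<open>G (x, T x) = 0\<close> formally.\<close>
  define T' where "T' = (\<lambda>x h. N x (- G' (x, T x) (h, 0)))"
  have ET': "E x (T' x h) = - G' (x, T x) (h, 0)" if "x \<in> A" for x h
    using N(2)[OF that] by (simp add: T'_def)
  have derT: "(T has_derivative T' x0) (at x0)" if x0: "x0 \<in> A" for x0
  proof -
    let ?p = "(x0, T x0)"
    have p: "?p \<in> A \<times> closure B" using x0 T(1) by auto
    have "linear (\<lambda>h. - G' ?p (h, 0))"
      using lin[OF p] linear_add[OF lin[OF p], of "(_, 0)" "(_, 0)"] linear_scale[OF lin[OF p], of _ "(_, 0)"]
      by (intro linearI) simp_all
    from linear_compose[OF this N(1)[OF x0]] have linT': "linear (T' x0)"
      by (simp add: T'_def o_def)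
    have split: "G' ?p (h, k) = G' ?p (h, 0) + E x0 k" for h k
      using linear_add[OF lin[OF p], of "(h, 0)" "(0, k)"] by (simp add: E_def)
    obtain r where r: "r > 0" "ball x0 r \<subseteq> A"
      using A x0 open_contains_ball by blast
    have "(G has_derivative G' ?p) (at ?p within (\<lambda>x. (x, T x0)) ` A)"
      by (rule has_derivative_subset[OF der[OF p]]) (use p in auto)
    then have "((\<lambda>x. G (x, T x0)) has_derivative (\<lambda>h. G' ?p (h, 0))) (at x0 within A)"
      by (rule has_derivative_in_compose[where f = "\<lambda>x. (x, T x0)", rotated])
        (auto intro!: derivative_eq_intros)
    then have derx: "((\<lambda>x. G (x, T x0)) has_derivative (\<lambda>h. G' ?p (h, 0))) (at x0)"
      using at_within_open[OF x0 A] by simp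
    obtain K where K: "K > 0" "\<And>h. norm (G' ?p (h, 0)) \<le> norm h * K"
      using bounded_linear.pos_bounded[OF has_derivative_bounded_linear[OF derx]] by blast
    obtain d1 where d1: "d1 > 0" "\<And>x. norm (x - x0) < d1 \<Longrightarrow>
        norm (G (x, T x0) - G ?p - G' ?p (x - x0, 0)) \<le> 1 * norm (x - x0)"
      using conjunct2[OF derx[unfolded has_derivative_at_alt], rule_format, OF zero_less_one] by blast
    \<comment> \<open>Near \<open>x0\<close>, \<open>G (x, T x0)\<close> has norm at most
      \<open>(K + 1) * norm (x - x0)\<close>: \<open>K\<close> bounds the partial derivative in
      \<open>x\<close>, and 1 is the tolerance of the expansion. Strong monotonicity between
      \<open>T x\<close> and \<open>T x0\<close> then costs a division by \<open>C\<close>.\<close>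
    define L where "L = (K + 1) / C"
    have L: "L > 0" using K C(1) by (simp add: L_def)
    have lip: "norm (T x - T x0) \<le> L * norm (x - x0)" if x: "norm (x - x0) < min d1 r" for x
    proof -
      have xA: "x \<in> A" using x r by (auto simp: dist_norm norm_minus_commute)
      have "norm (G (x, T x0)) \<le> (K + 1) * norm (x - x0)"
        using d1(2)[of x] K(2)[of "x - x0"] x T(2)[OF x0]
          norm_triangle_ineq[of "G (x, T x0) - G' ?p (x - x0, 0)" "G' ?p (x - x0, 0)"]
        by (simp add: algebra_simps)
      moreover have "C * norm (T x - T x0) * norm (T x - T x0) \<le> norm (G (x, T x0)) * norm (T x - T x0)"
      proof -
        have "C * norm (T x - T x0) * norm (T x - T x0) \<le> (- G (x, T x0)) \<bullet> (T x - T x0)"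
          using C(2)[OF xA T(1)[OF xA] T(1)[OF x0]] T(2)[OF xA] by (simp add: power2_eq_square)
        also have "\<dots> \<le> norm (- G (x, T x0)) * norm (T x - T x0)" by (rule norm_cauchy_schwarz)
        finally show ?thesis by simp
      qed
      then have "C * norm (T x - T x0) \<le> norm (G (x, T x0))"
        by (cases "T x = T x0") (auto simp: mult_le_cancel_right)
      ultimately show ?thesis using C(1) by (simp add: L_def field_simps)
    qed
    show ?thesis
      unfolding has_derivative_at_alt
    proof (intro conjI allI impI)
      show "bounded_linear (T' x0)" using linT' by (simp add: linear_conv_bounded_linear)
      fix e :: real assume "0 < e"
      \<comment> \<open>The point \<open>(x, T x)\<close> moves by at most
        \<open>(1 + L) * norm (x - x0)\<close>, and coercivity will divide by \<open>C\<close>;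
        these factors cancel to leave \<open>e\<close>.\<close>
      define e' where "e' = C * e / (1 + L)"
      have "e' > 0" using \<open>0 < e\<close> C(1) L by (simp add: e'_def)
      then obtain d2 where d2: "d2 > 0" "\<And>q. q \<in> A \<times> closure B \<Longrightarrow> norm (q - ?p) < d2 \<Longrightarrow>
          norm (G q - G ?p - G' ?p (q - ?p)) \<le> e' * norm (q - ?p)"
        using conjunct2[OF der[OF p, unfolded has_derivative_within_alt], rule_format, OF \<open>e' > 0\<close>] by blast
      define d where "d = min (min d1 r) (d2 / (1 + L))"
      have "norm (T x - T x0 - T' x0 (x - x0)) \<le> e * norm (x - x0)" if x: "norm (x - x0) < d" for x
      proof -
        have xA: "x \<in> A" using x r by (auto simp: dist_norm norm_minus_commute d_def)
        have l: "norm (T x - T x0) \<le> L * norm (x - x0)" using lip x by (simp add: d_def)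
        have "norm ((x, T x) - ?p) \<le> norm (x - x0) + norm (T x - T x0)"
          using norm_Pair_le[of "x - x0" "T x - T x0"] by simp
        with l have n: "norm ((x, T x) - ?p) \<le> (1 + L) * norm (x - x0)" by (simp add: algebra_simps)
        also have "\<dots> < d2" using x L by (simp add: d_def field_simps)
        finally have "norm (G (x, T x) - G ?p - G' ?p ((x, T x) - ?p)) \<le> e' * norm ((x, T x) - ?p)"
          using d2(2)[of "(x, T x)"] xA T(1) by simp
        also have "\<dots> \<le> e' * ((1 + L) * norm (x - x0))"
          using n \<open>e' > 0\<close> by (intro mult_left_mono) auto
        also have "\<dots> = C * (e * norm (x - x0))" using L by (simp add: e'_def)
        finally have "norm (G' ?p ((x, T x) - ?p)) \<le> C * (e * norm (x - x0))"
          using T(2) x0 xA by simp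
        moreover have "G' ?p ((x, T x) - ?p) = E x0 (T x - T x0 - T' x0 (x - x0))"
          using split[of "x - x0" "T x - T x0"] linear_diff[OF linE[OF x0]] ET'[OF x0] by simp
        ultimately have "C * norm (T x - T x0 - T' x0 (x - x0)) \<le> C * (e * norm (x - x0))"
          using E[OF x0, of "T x - T x0 - T' x0 (x - x0)"] by simp
        then show ?thesis using C(1) by simp
      qed
      moreover have "d > 0" using d1 r d2 L by (simp add: d_def)
      ultimately show "\<exists>d>0. \<forall>x. norm (x - x0) < d \<longrightarrow>
          norm (T x - T x0 - T' x0 (x - x0)) \<le> e * norm (x - x0)"
        by blast
    qed
  qed
  have contT: "continuous_on A T"
    using derT by (meson has_derivative_at_withinI has_derivative_continuous_on)
  \<comment> \<open>Regularity is bootstrapped: if \<open>T\<close> has order \<open>i\<close>, so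
    do the coefficients \<open>G' (x, T x)\<close> of the linear system for \<open>T'\<close>, hence
    \<open>T'\<close> itself. The limit is the order \<open>k\<close> of \<open>G'\<close>.\<close>
  have "i \<le> Suc k \<Longrightarrow> Ck_upto i A A T" for i
  proof (induction i)
    case 0
    show ?case using contT by simp
  next
    case (Suc i)
    have comp: "Ck_upto i A A (\<lambda>x. G' (x, T x) h)" for h
      by (rule Ck_upto_compose_graph[OF A B Ck_upto_le[OF G'(2)]]) (use Suc T(1) in auto)
    show ?case
    proof (rule Ck_upto_SucI[where f' = T'])
      show "Ck_upto i A A (\<lambda>x. T' x h)" for h
      proof (rule Ck_upto_solve_linear[OF A linE C(1) E])
        show "Ck_upto i A A (\<lambda>x. E x s)" for s unfolding E_def by (rule comp)
        show "Ck_upto i A A (\<lambda>x. - G' (x, T x) (h, 0))"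
          by (intro Ck_upto_bounded_linear[OF bounded_linear_minus[OF bounded_linear_ident]] comp)
      qed (use ET' in auto)
    qed (use contT derT in auto)
  qed
  then show ?thesis by blast
qed

section \<open>Strong convexity from Hessians\<close>

lemma grad_has_derivative:
  fixes f :: "'a::euclidean_space \<Rightarrow> real"
  assumes "(f has_derivative D) (at x)"
  shows "grad f x \<bullet> h = D h"
proof -
  have lin: "linear D" using assms by (rule has_derivative_linear)
  define d where "d = (\<Sum>b\<in>Basis. D b *\<^sub>R b)"
  have D: "D h = h \<bullet> d" for h
    by (subst euclidean_representation[of h, symmetric])
      (simp only: linear_sum[OF lin] linear_scale[OF lin] d_def inner_sum_right inner_scaleR_right real_scaleR_def mult.commute)
  have "GDERIV f x :> d"
    unfolding gderiv_def D[symmetric] by (rule assms)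
  then have "grad f x = d" by (rule grad_eq)
  then show ?thesis using D by (simp add: inner_commute)
qed

text \<open>The Hessian is the Jacobian of \<open>grad\<close>, while \<open>Ck_upto\<close>
  provides derivatives of single directional derivatives. Expanding \<open>grad f\<close> in the
  basis on the open set \<open>Y\<close> makes it differentiable, which is what gives the Jacobian
  its meaning.\<close>

lemma Ck_open_2_along_line:
  fixes f :: "real ^ 'n \<Rightarrow> real"
  assumes Y: "open Y" and f: "Ck_upto 2 Y Y f" and t: "a + t *\<^sub>R h \<in> Y"
  shows "((\<lambda>t. f (a + t *\<^sub>R h)) has_real_derivative grad f (a + t *\<^sub>R h) \<bullet> h) (at t)"
    and "((\<lambda>t. grad f (a + t *\<^sub>R h) \<bullet> h) has_real_derivative h \<bullet> (hessian f (a + t *\<^sub>R h) *v h)) (at t)"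
proof -
  obtain f' where f': "\<And>x. x \<in> Y \<Longrightarrow> (f has_derivative f' x) (at x)" "\<And>h. Ck_upto 1 Y Y (\<lambda>x. f' x h)"
    using f Ck_upto_SucE unfolding Suc_1[symmetric] by blast
  let ?x = "a + t *\<^sub>R h"
  have line: "((\<lambda>t. a + t *\<^sub>R h) has_derivative (\<lambda>s. s *\<^sub>R h)) (at t)"
    by (auto intro!: derivative_eq_intros)
  have "((\<lambda>t. f (a + t *\<^sub>R h)) has_derivative (\<lambda>s. f' ?x (s *\<^sub>R h))) (at t)"
    by (rule has_derivative_compose[OF line f'(1)[OF t]])
  moreover have "f' ?x (s *\<^sub>R h) = (grad f ?x \<bullet> h) * s" for s
    using grad_has_derivative[OF f'(1)[OF t]] linear_scale[OF has_derivative_linear[OF f'(1)[OF t]]]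
    by (simp add: mult.commute)
  ultimately show "((\<lambda>t. f (a + t *\<^sub>R h)) has_real_derivative grad f ?x \<bullet> h) (at t)"
    by (simp add: has_field_derivative_def)
  have "\<forall>b. \<exists>D. ((\<lambda>x. f' x b) has_derivative D) (at ?x)"
    using f'(2) t unfolding One_nat_def by (blast elim: Ck_upto_SucE)
  then obtain D where D: "\<And>b. ((\<lambda>x. f' x b) has_derivative D b) (at ?x)" by metis
  have "grad f x = (\<Sum>b\<in>Basis. f' x b *\<^sub>R b)" if "x \<in> Y" for x
    by (simp add: euclidean_representation flip: grad_has_derivative[OF f'(1)[OF that]])
  then have grad: "(\<Sum>b\<in>Basis. f' x b *\<^sub>R b) = grad f x" if "x \<in> Y" for x
    using that by simp
  have "((\<lambda>x. \<Sum>b\<in>Basis. f' x b *\<^sub>R b) has_derivative (\<lambda>h. \<Sum>b\<in>Basis. D b h *\<^sub>R b)) (at ?x)"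
    by (intro has_derivative_sum has_derivative_scaleR_left D)
  then have der: "(grad f has_derivative (\<lambda>h. \<Sum>b\<in>Basis. D b h *\<^sub>R b)) (at ?x)"
    by (rule has_derivative_transform_within_open[OF _ Y t]) (rule grad)
  from differentiableI[OF this]
  have "(grad f has_derivative (\<lambda>k. hessian f ?x *v k)) (at ?x)"
    unfolding hessian_def by (rule iffD1[OF jacobian_works])
  then have "((\<lambda>t. grad f (a + t *\<^sub>R h)) has_derivative (\<lambda>s. hessian f ?x *v (s *\<^sub>R h))) (at t)"
    by (rule has_derivative_compose[OF line])
  then have "((\<lambda>t. grad f (a + t *\<^sub>R h)) has_derivative (\<lambda>s. s *\<^sub>R (hessian f ?x *v h))) (at t)"
    by (simp add: matrix_vector_mult_scaleR)
  then show "((\<lambda>t. grad f (a + t *\<^sub>R h) \<bullet> h) has_real_derivative h \<bullet> (hessian f ?x *v h)) (at t)"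
    unfolding has_field_derivative_def
    by (auto intro!: derivative_eq_intros simp: inner_commute mult.commute)
qed

text \<open>On the line through \<open>a\<close> and \<open>b\<close>, subtracting the parabola with
  second derivative \<open>C * (h \<bullet> h)\<close> leaves a function \<open>q\<close> with
  nonnegative second derivative. The claim is that \<open>q 1\<close> lies above the tangent of
  \<open>q\<close> at 0.\<close>

lemma hessian_sum_strongly_convex:
  fixes f g k :: "real ^ 'n \<Rightarrow> real"
  assumes Y: "open Y" "convex Y" and C2: "Ck_upto 2 Y Y f" "Ck_upto 2 Y Y g" "Ck_upto 2 Y Y k"
    and hess: "\<And>y h. y \<in> Y \<Longrightarrow> C * (h \<bullet> h) \<le> h \<bullet> ((hessian f y + hessian g y + hessian k y) *v h)"
    and ab: "a \<in> Y" "b \<in> Y"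
  shows "C / 2 * (norm (b - a))\<^sup>2 \<le> (f b + g b + k b) - (f a + g a + k a) -
    (grad f a + grad g a + grad k a) \<bullet> (b - a)"
proof -
  define h where "h = b - a"
  define A where "A = {t::real. a + t *\<^sub>R h \<in> Y}"
  define q where "q = (\<lambda>t. f (a + t *\<^sub>R h) + g (a + t *\<^sub>R h) + k (a + t *\<^sub>R h) - C / 2 * (h \<bullet> h) * t\<^sup>2)"
  define q' where "q' = (\<lambda>t. grad f (a + t *\<^sub>R h) \<bullet> h + grad g (a + t *\<^sub>R h) \<bullet> h +
    grad k (a + t *\<^sub>R h) \<bullet> h - C * (h \<bullet> h) * t)"
  define q'' where "q'' = (\<lambda>t. h \<bullet> (hessian f (a + t *\<^sub>R h) *v h) + h \<bullet> (hessian g (a + t *\<^sub>R h) *v h) +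
    h \<bullet> (hessian k (a + t *\<^sub>R h) *v h) - C * (h \<bullet> h))"
  have A: "open A" "convex A"
  proof -
    have "A = (\<lambda>t. a + t *\<^sub>R h) -` Y" by (auto simp: A_def)
    moreover have "open ((\<lambda>t::real. a + t *\<^sub>R h) -` Y)"
      using Y(1) by (intro open_vimage) (auto intro!: continuous_intros)
    ultimately show "open A" by simp
    show "convex A"
    proof (rule convexI)
      fix s t u v :: real
      assume *: "s \<in> A" "t \<in> A" "0 \<le> u" "0 \<le> v" "u + v = 1"
      then have "u *\<^sub>R (a + s *\<^sub>R h) + v *\<^sub>R (a + t *\<^sub>R h) \<in> Y"
        using convexD[OF Y(2)] by (simp add: A_def)
      moreover have "u *\<^sub>R (a + s *\<^sub>R h) + v *\<^sub>R (a + t *\<^sub>R h) = (u + v) *\<^sub>R a + (u * s + v * t) *\<^sub>R h"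
        by (simp add: algebra_simps)
      ultimately show "u *\<^sub>R s + v *\<^sub>R t \<in> A" using * by (simp add: A_def)
    qed
  qed
  have q': "DERIV q t :> q' t" and q'': "DERIV q' t :> q'' t" and q''_nonneg: "0 \<le> q'' t" if "t \<in> A" for t
  proof -
    have t: "a + t *\<^sub>R h \<in> Y" using that by (simp add: A_def)
    note d = C2[THEN Ck_open_2_along_line(1)[OF Y(1) _ t]] C2[THEN Ck_open_2_along_line(2)[OF Y(1) _ t]]
    show "DERIV q t :> q' t"
      unfolding q_def q'_def by (auto intro!: derivative_eq_intros d)
    show "DERIV q' t :> q'' t"
      unfolding q'_def q''_def by (auto intro!: derivative_eq_intros d)
    show "0 \<le> q'' t"
      using hess[OF t, of h] by (simp add: q''_def matrix_vector_mult_add_rdistrib inner_add_right)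
  qed
  have "convex_on A q"
    by (rule f''_ge0_imp_convex[OF A(2) q' q'' q''_nonneg])
  moreover have "0 \<in> A" "1 \<in> A" using ab by (auto simp: A_def h_def)
  ultimately have "q 1 - q 0 \<ge> q' 0 * (1 - 0)"
    by (intro convex_on_imp_above_tangent[where A = A])
      (use A q' in \<open>auto simp: convex_connected interior_open intro: has_field_derivative_at_within\<close>)
  then show ?thesis
    by (simp add: q_def q'_def h_def inner_add_left power2_norm_eq_inner)
qed

lemma minimum_convex_derivative_nonneg:
  assumes "(f has_derivative D) (at y within S)" "convex S" "y \<in> S" "z \<in> S"
    "\<And>x. x \<in> S \<Longrightarrow> f y \<le> (f x :: real)"
  shows "0 \<le> D (z - y)"
proof (rule ccontr)
  assume neg: "\<not> 0 \<le> D (z - y)"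
  have S: "y + t *\<^sub>R (z - y) \<in> S" if "t \<in> {0..1}" for t
    using convexD_alt[OF assms(2-4), of t] that by (simp add: algebra_simps)
  have "((\<lambda>t. y + t *\<^sub>R (z - y)) has_derivative (\<lambda>t. t *\<^sub>R (z - y))) (at 0 within {0..1})"
    by (auto intro!: derivative_eq_intros)
  moreover have "(f has_derivative D) (at (y + 0 *\<^sub>R (z - y)) within (\<lambda>t. y + t *\<^sub>R (z - y)) ` {0..1})"
  proof -
    have "(\<lambda>t. y + t *\<^sub>R (z - y)) ` {0..1} \<subseteq> S" using S by blast
    from has_derivative_subset[OF assms(1) this] show ?thesis by simp
  qed
  ultimately have "((\<lambda>t. f (y + t *\<^sub>R (z - y))) has_derivative (\<lambda>t. D (t *\<^sub>R (z - y)))) (at 0 within {0..1})"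
    by (rule has_derivative_in_compose)
  moreover have "D (t *\<^sub>R (z - y)) = D (z - y) * t" for t
    using linear_scale[OF has_derivative_linear[OF assms(1)]] by (simp add: mult.commute)
  ultimately have "((\<lambda>t. f (y + t *\<^sub>R (z - y))) has_real_derivative D (z - y)) (at 0 within {0..1})"
    by (simp add: has_field_derivative_def)
  from has_real_derivative_neg_dec_right[OF this] neg
  obtain d where d: "d > 0" "\<And>h. h > 0 \<Longrightarrow> 0 + h \<in> {0..1} \<Longrightarrow> h < d \<Longrightarrow>
      f (y + 0 *\<^sub>R (z - y)) > f (y + (0 + h) *\<^sub>R (z - y))"
    by (auto simp: not_le)
  define h where "h = min (d / 2) 1"
  have "h > 0" "0 + h \<in> {0..1}" "h < d" using d(1) by (auto simp: h_def)
  from d(2)[OF this] assms(5)[OF S[of h]] \<open>0 + h \<in> {0..1}\<close> show False by simp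
qed

lemma set_integral_prob_ge:
  fixes q :: "'a::euclidean_space \<Rightarrow> real"
  assumes "M \<in> prob_on K" "compact K" "continuous_on K q" "\<And>z. z \<in> K \<Longrightarrow> k \<le> q z"
  shows "k \<le> (LINT z:K|M. q z)"
proof -
  interpret prob_space M using assms(1) by (simp add: prob_on_def)
  have M: "finite_measure M" "sets M = sets borel" "measure M K = 1"
    using assms(1) by (auto simp: prob_on_def measure_def finite_measure_axioms)
  have "(LINT z:K|M. k) = k"
    using assms(2) M by (simp add: set_lebesgue_integral_def borel_compact)
  moreover have "(LINT z:K|M. k) \<le> (LINT z:K|M. q z)"
    by (rule set_integral_mono) (use set_integrable_compact[OF M(1,2) assms(2)] assms in auto)
  ultimately show ?thesis by simp
qed

section \<open>The first-order condition\<close>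

text \<open>\<open>c'\<close>, \<open>V'\<close> and \<open>W'\<close> are the derivatives, extended continuously to the closures of the domains.\<close>

locale smooth_model =
  fixes X :: "'a::euclidean_space set" and Y :: "'b::euclidean_space set"
    and c :: "'a \<Rightarrow> 'b \<Rightarrow> real" and V :: "'b \<Rightarrow> real" and W :: "'b \<Rightarrow> 'b \<Rightarrow> real"
    and c' :: "'a \<times> 'b \<Rightarrow> 'a \<times> 'b \<Rightarrow> real" and V' :: "'b \<Rightarrow> 'b \<Rightarrow> real"
    and W' :: "'b \<times> 'b \<Rightarrow> 'b \<times> 'b \<Rightarrow> real"
    and \<nu> :: "'b measure" and C :: real
  assumes X: "open X" "bounded X" and Y: "open Y" "convex Y" "bounded Y"
    and c_continuous: "continuous_on (closure X \<times> closure Y) (\<lambda>(x, y). c x y)"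
    and V_continuous: "continuous_on (closure Y) V"
    and W_continuous: "continuous_on (closure Y \<times> closure Y) (\<lambda>(y, z). W y z)"
    and c_derivative: "\<And>p. p \<in> X \<times> Y \<Longrightarrow> ((\<lambda>(x, y). c x y) has_derivative c' p) (at p)"
    and V_derivative: "\<And>y. y \<in> Y \<Longrightarrow> (V has_derivative V' y) (at y)"
    and W_derivative: "\<And>p. p \<in> Y \<times> Y \<Longrightarrow> ((\<lambda>(y, z). W y z) has_derivative W' p) (at p)"
    and c'_continuous: "\<And>h. continuous_on (closure X \<times> closure Y) (\<lambda>p. c' p h)"
    and V'_continuous: "\<And>h. continuous_on (closure Y) (\<lambda>y. V' y h)"
    and W'_continuous: "\<And>h. continuous_on (closure Y \<times> closure Y) (\<lambda>p. W' p h)"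
    and \<nu>: "\<nu> \<in> prob_on (closure Y)"
    and C: "0 < C"
    and strong_convexity: "\<And>x a b z. x \<in> X \<Longrightarrow> a \<in> Y \<Longrightarrow> b \<in> Y \<Longrightarrow> z \<in> Y \<Longrightarrow>
      C / 2 * (norm (b - a))\<^sup>2 \<le> (c x b + V b + W b z) - (c x a + V a + W a z) -
        (c' (x, a) (0, b - a) + V' a (b - a) + W' (a, z) (b - a, 0))"
    and boundary: "\<And>x y z p. x \<in> X \<Longrightarrow> z \<in> Y \<Longrightarrow> y \<in> frontier Y \<Longrightarrow> p \<in> outward_unit_normals Y y \<Longrightarrow>
      0 \<le> c' (x, y) (0, p) + V' y p + W' (y, z) (p, 0)"
begin

text \<open>The first variation at \<open>\<nu>\<close> of the potential and interaction energies.
  Both arguments of the symmetric \<open>W\<close> vary with \<open>\<nu>\<close>, which cancels the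
  factor 1/2 of the energy.\<close>

definition F :: "'b \<Rightarrow> real" where
  "F y = V y + (LINT z:closure Y|\<nu>. W y z)"

definition F' :: "'b \<Rightarrow> 'b \<Rightarrow> real" where
  "F' y h = V' y h + (LINT z:closure Y|\<nu>. W' (y, z) (h, 0))"

lemma compact_closures: "compact (closure X)" "compact (closure Y)"
  using X Y by (auto simp: compact_closure)

lemma \<nu>_finite: "finite_measure \<nu>" "sets \<nu> = sets borel"
  using \<nu> by (auto simp: prob_on_def prob_space.finite_measure)

lemma Y_nonempty: "Y \<noteq> {}"
  using \<nu> by (auto simp: prob_on_def)

lemma F_continuous: "continuous_on (closure Y) F"
  unfolding F_def
  using continuous_on_parameter_integral[OF \<nu>_finite compact_closures(2,2) W_continuous]
  by (intro continuous_on_add V_continuous) simp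

lemma F'_continuous: "continuous_on (closure Y) (\<lambda>y. F' y h)"
  unfolding F'_def
  using continuous_on_parameter_integral[OF \<nu>_finite compact_closures(2,2) W'_continuous]
  by (intro continuous_on_add V'_continuous)

lemma F_has_derivative:
  assumes "y \<in> closure Y"
  shows "(F has_derivative F' y) (at y within closure Y)"
proof -
  have "((\<lambda>y. V y + (LINT z:closure Y|\<nu>. (\<lambda>(y, z). W y z) (y, z))) has_derivative
      (\<lambda>h. V' y h + (LINT z:closure Y|\<nu>. W' (y, z) (h, 0)))) (at y within closure Y)"
    by (intro has_derivative_add has_derivative_closure[OF Y V_continuous V_derivative V'_continuous assms]
        has_derivative_parameter_integral[OF \<nu>_finite Y Y W_continuous W_derivative W'_continuous assms])
  then show ?thesis
    by (simp add: F_def[abs_def] F'_def[abs_def])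
qed

lemma Times_subset: "X \<times> Y \<subseteq> X \<times> closure Y" "X \<times> closure Y \<subseteq> closure (X \<times> Y)"
    "X \<times> closure Y \<subseteq> closure X \<times> closure Y"
  using closure_subset[of X] closure_subset[of Y] by (auto simp: closure_Times)

lemma c_continuous_snd: "x \<in> closure X \<Longrightarrow> continuous_on (closure Y) (c x)"
  using continuous_on_Pair_slice[OF c_continuous] by simp

lemma c_has_derivative:
  assumes "x \<in> X" "y \<in> closure Y"
  shows "(c x has_derivative (\<lambda>h. c' (x, y) (0, h))) (at y within closure Y)"
proof -
  have "((\<lambda>(x, y). c x y) has_derivative c' (x, y)) (at (x, y) within X \<times> closure Y)"
    by (rule has_derivative_Times_closure[OF X(1) Y continuous_on_subset[OF c_continuous Times_subset(3)]
          c_derivative continuous_on_subset[OF c'_continuous Times_subset(3)]]) (use assms in auto)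
  then have "((\<lambda>(x, y). c x y) has_derivative c' (x, y)) (at (x, y) within Pair x ` closure Y)"
    by (rule has_derivative_subset) (use assms in auto)
  then have "((\<lambda>y. (\<lambda>(x, y). c x y) (x, y)) has_derivative (\<lambda>h. c' (x, y) (0, h))) (at y within closure Y)"
    by (rule has_derivative_in_compose[where f = "Pair x", rotated]) (auto intro!: derivative_eq_intros)
  then show ?thesis by simp
qed

lemma linear_c': "p \<in> closure X \<times> closure Y \<Longrightarrow> linear (c' p)"
  by (rule derivative_extension_linear[OF _ _ c_derivative c'_continuous])
    (use closure_subset[of X] closure_subset[of Y] in \<open>auto simp: closure_Times\<close>)

lemma linear_V': "y \<in> closure Y \<Longrightarrow> linear (V' y)"
  by (rule derivative_extension_linear[OF closure_subset order_refl V_derivative V'_continuous])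

lemma linear_W': "p \<in> closure Y \<times> closure Y \<Longrightarrow> linear (W' p)"
  by (rule derivative_extension_linear[OF _ _ W_derivative W'_continuous])
    (use closure_subset[of Y] in \<open>auto simp: closure_Times\<close>)

text \<open>All three points of \<open>Y\<close> have to reach the boundary: \<open>a\<close> will
  be a minimizer, \<open>b\<close> an arbitrary competitor, and \<open>z\<close> is integrated
  against a measure that may charge the boundary. The inequality is continuous in the
  triple.\<close>

lemma strong_convexity_closure:
  assumes x: "x \<in> X" and abz: "a \<in> closure Y" "b \<in> closure Y" "z \<in> closure Y"
  shows "C / 2 * (norm (b - a))\<^sup>2 \<le> (c x b + V b + W b z) - (c x a + V a + W a z) -
    (c' (x, a) (0, b - a) + V' a (b - a) + W' (a, z) (b - a, 0))"
proof -
  let ?S = "closure Y \<times> closure Y \<times> closure Y"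
  define q where "q = (\<lambda>(a, b, z). (c x b + V b + W b z) - (c x a + V a + W a z) -
    (c' (x, a) (0, b - a) + V' a (b - a) + W' (a, z) (b - a, 0)) - C / 2 * (norm (b - a))\<^sup>2)"
  have x': "x \<in> closure X" using x closure_subset by blast
  have c1: "continuous_on ?S (\<lambda>p. c' (x, fst p) (0, fst (snd p) - fst p))"
    by (rule continuous_on_apply_linear[where A = "\<lambda>p. c' (x, fst p)"])
      (auto intro!: linear_c' x' continuous_intros continuous_on_compose2[OF c'_continuous])
  have c2: "continuous_on ?S (\<lambda>p. V' (fst p) (fst (snd p) - fst p))"
    by (rule continuous_on_apply_linear[where A = "\<lambda>p. V' (fst p)"])
      (auto intro!: linear_V' continuous_intros continuous_on_compose2[OF V'_continuous])
  have c3: "continuous_on ?S (\<lambda>p. W' (fst p, snd (snd p)) (fst (snd p) - fst p, 0))"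
    by (rule continuous_on_apply_linear[where A = "\<lambda>p. W' (fst p, snd (snd p))"])
      (auto intro!: linear_W' continuous_intros continuous_on_compose2[OF W'_continuous])
  have "continuous_on ?S (\<lambda>p. (\<lambda>(y, z). W y z) (fst p, snd (snd p)))"
    by (rule continuous_on_compose2[OF W_continuous]) (auto intro!: continuous_intros)
  moreover have "continuous_on ?S (\<lambda>p. (\<lambda>(y, z). W y z) (snd p))"
    by (rule continuous_on_compose2[OF W_continuous]) (auto intro!: continuous_intros)
  ultimately have c4: "continuous_on ?S (\<lambda>p. W (fst p) (snd (snd p)))"
      "continuous_on ?S (\<lambda>p. W (fst (snd p)) (snd (snd p)))"
    by (simp_all add: case_prod_unfold)
  have c5: "continuous_on ?S (\<lambda>p. c x (fst p))" "continuous_on ?S (\<lambda>p. c x (fst (snd p)))"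
      "continuous_on ?S (\<lambda>p. V (fst p))" "continuous_on ?S (\<lambda>p. V (fst (snd p)))"
    by (auto intro!: continuous_intros continuous_on_compose2[OF c_continuous_snd[OF x']]
        continuous_on_compose2[OF V_continuous])
  have "0 \<le> q (a, b, z)"
  proof (rule closure_nonneg[where S = ?S and U = "Y \<times> Y \<times> Y"])
    show "continuous_on ?S q"
      unfolding q_def case_prod_unfold
      by (intro continuous_intros c1 c2 c3 c4 c5)
    show "Y \<times> Y \<times> Y \<subseteq> ?S" using closure_subset[of Y] by auto
    show "?S \<subseteq> closure (Y \<times> Y \<times> Y)" by (simp add: closure_Times)
    show "0 \<le> q p" if "p \<in> Y \<times> Y \<times> Y" for p
      using that strong_convexity[OF x] by (auto simp: q_def)
    show "(a, b, z) \<in> ?S" using abz by simp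
  qed
  then show ?thesis by (simp add: q_def)
qed

lemma strong_convexity_F:
  assumes x: "x \<in> X" and ab: "a \<in> closure Y" "b \<in> closure Y"
  shows "C / 2 * (norm (b - a))\<^sup>2 \<le> (c x b + F b) - (c x a + F a) - (c' (x, a) (0, b - a) + F' a (b - a))"
proof -
  let ?K = "closure Y"
  note cont = continuous_on_Pair_slice[OF W_continuous ab(1), simplified]
    continuous_on_Pair_slice[OF W_continuous ab(2), simplified] continuous_on_Pair_slice[OF W'_continuous ab(1)]
  note int = cont[THEN set_integrable_compact[OF \<nu>_finite compact_closures(2)]]
  \<comment> \<open>With the terms free of \<open>z\<close> moved to the left, this is a constant
    lower bound for an integrand, and integrating against a measure of mass one keeps the constant
    \<open>C\<close>.\<close>
  have "C / 2 * (norm (b - a))\<^sup>2 - (c x b + V b - c x a - V a - c' (x, a) (0, b - a) - V' a (b - a)) \<le>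
      (LINT z:?K|\<nu>. W b z - W a z - W' (a, z) (b - a, 0))"
  proof (rule set_integral_prob_ge[OF \<nu> compact_closures(2)])
    show "continuous_on ?K (\<lambda>z. W b z - W a z - W' (a, z) (b - a, 0))"
      by (intro continuous_on_diff cont)
    show "C / 2 * (norm (b - a))\<^sup>2 - (c x b + V b - c x a - V a - c' (x, a) (0, b - a) - V' a (b - a)) \<le>
        W b z - W a z - W' (a, z) (b - a, 0)" if "z \<in> ?K" for z
      using strong_convexity_closure[OF x ab that] by simp
  qed
  also have "\<dots> = (LINT z:?K|\<nu>. W b z) - (LINT z:?K|\<nu>. W a z) - (LINT z:?K|\<nu>. W' (a, z) (b - a, 0))"
    by (simp add: set_integral_diff int)
  finally show ?thesis by (simp add: F_def F'_def)
qed

lemma boundary_F: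
  assumes x: "x \<in> X" and y: "y \<in> frontier Y" and p: "p \<in> outward_unit_normals Y y"
  shows "0 \<le> c' (x, y) (0, p) + F' y p"
proof -
  have y': "y \<in> closure Y" using y by (simp add: frontier_def)
  note cont = continuous_on_Pair_slice[OF W'_continuous y']
  have "0 \<le> c' (x, y) (0, p) + V' y p + W' (y, z) (p, 0)" if "z \<in> closure Y" for z
  proof (rule closure_nonneg[OF _ closure_subset order_refl _ that])
    show "continuous_on (closure Y) (\<lambda>z. c' (x, y) (0, p) + V' y p + W' (y, z) (p, 0))"
      by (intro continuous_on_add continuous_on_const cont)
  qed (rule boundary[OF x _ y p])
  then have "- (c' (x, y) (0, p) + V' y p) \<le> (LINT z:closure Y|\<nu>. W' (y, z) (p, 0))"
    by (intro set_integral_prob_ge[OF \<nu> compact_closures(2) cont]) force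
  then show ?thesis by (simp add: F'_def)
qed

section \<open>The c-transform \<open>w\<close> of \<open>- F\<close> and the point
  \<open>T x\<close> where it is attained\<close>

definition w :: "'a \<Rightarrow> real" where
  "w x = (INF y\<in>closure Y. c x y + F y)"

lemma w_attained:
  assumes "x \<in> closure X"
  obtains y where "y \<in> closure Y" "w x = c x y + F y"
proof -
  have cont: "continuous_on (closure Y) (\<lambda>y. c x y + F y)"
    by (intro continuous_on_add c_continuous_snd assms F_continuous)
  obtain y where y: "y \<in> closure Y" "\<And>z. z \<in> closure Y \<Longrightarrow> c x y + F y \<le> c x z + F z"
    using continuous_attains_inf[OF compact_closures(2) _ cont] Y_nonempty by auto
  then have "w x = c x y + F y"
    unfolding w_def by (intro cInf_eq_minimum) auto
  with y(1) show thesis by (rule that)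
qed

lemma w_le:
  assumes "x \<in> closure X" "y \<in> closure Y"
  shows "w x \<le> c x y + F y"
proof -
  have "compact ((\<lambda>y. c x y + F y) ` closure Y)"
    by (intro compact_continuous_image continuous_on_add c_continuous_snd assms F_continuous compact_closures)
  then have "bdd_below ((\<lambda>y. c x y + F y) ` closure Y)"
    by (intro bounded_imp_bdd_below compact_imp_bounded)
  then show ?thesis
    unfolding w_def using assms(2) by (rule cINF_lower)
qed

text \<open>Off \<open>X\<close> the value is irrelevant; a constant keeps the map Borel measurable.\<close>

definition T :: "'a \<Rightarrow> 'b" where
  "T x = (if x \<in> X then SOME y. y \<in> closure Y \<and> w x = c x y + F y else SOME y. y \<in> closure Y)"

lemma T_in_closure: "T x \<in> closure Y"
proof (cases "x \<in> X")
  case True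
  then have "x \<in> closure X" using closure_subset by blast
  then have "\<exists>y. y \<in> closure Y \<and> w x = c x y + F y" using w_attained by metis
  from someI_ex[OF this] show ?thesis using True by (simp add: T_def)
next
  case False
  have "\<exists>y. y \<in> closure Y" using Y_nonempty closure_subset by blast
  from someI_ex[OF this] show ?thesis using False by (simp add: T_def)
qed

lemma w_T:
  assumes "x \<in> X"
  shows "w x = c x (T x) + F (T x)"
proof -
  have "x \<in> closure X" using assms closure_subset by blast
  then have "\<exists>y. y \<in> closure Y \<and> w x = c x y + F y" using w_attained by metis
  from someI_ex[OF this] show ?thesis using assms by (simp add: T_def)
qed

text \<open>At a minimizer on the boundary, minimality only says that \<open>D\<close> is
  nonnegative on \<open>z - T x\<close> for \<open>z\<close> in \<open>closure Y\<close>. If the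
  gradient \<open>g\<close> of \<open>D\<close> were nonzero, this would make its opposite direction
  an outward normal; there the boundary condition demands a nonnegative value of \<open>D\<close>,
  yet the value is \<open>- norm g\<close>.\<close>

lemma critical_T:
  assumes x: "x \<in> X"
  shows "c' (x, T x) (0, h) + F' (T x) h = 0"
proof -
  let ?y = "T x"
  define D where "D = (\<lambda>h. c' (x, ?y) (0, h) + F' ?y h)"
  have x': "x \<in> closure X" using x closure_subset by blast
  have der: "((\<lambda>y. c x y + F y) has_derivative D) (at ?y within closure Y)"
    unfolding D_def by (intro has_derivative_add c_has_derivative[OF x] F_has_derivative T_in_closure)
  have lin: "linear D" using has_derivative_linear[OF der] .
  have min: "0 \<le> D (z - ?y)" if "z \<in> closure Y" for z
    by (rule minimum_convex_derivative_nonneg[OF der convex_closure[OF Y(2)] T_in_closure that])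
      (use w_le[OF x'] w_T[OF x] in auto)
  define g where "g = (\<Sum>b\<in>Basis. D b *\<^sub>R b)"
  have D: "D h = h \<bullet> g" for h
    by (subst euclidean_representation[of h, symmetric])
      (simp only: linear_sum[OF lin] linear_scale[OF lin] g_def inner_sum_right inner_scaleR_right real_scaleR_def mult.commute)
  have "g = 0"
  proof (rule ccontr)
    assume "g \<noteq> 0"
    \<comment> \<open>The direction of steepest descent. Inside \<open>Y\<close> a short step along
      it contradicts minimality, on the boundary it is the normal to be tested.\<close>
    define p where "p = - (g /\<^sub>R norm g)"
    have p: "norm p = 1" "D p = - norm g"
      using \<open>g \<noteq> 0\<close> by (simp_all add: p_def D dot_square_norm power2_eq_square)
    show False
    proof (cases "?y \<in> Y")
      case True
      then obtain e where e: "e > 0" "cball ?y e \<subseteq> Y" using Y(1) open_contains_cball by blast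
      then have "?y + e *\<^sub>R p \<in> closure Y" using p closure_subset by (force simp: dist_norm)
      from min[OF this] have "0 \<le> e * D p" by (simp add: linear_scale[OF lin])
      then show False using e p \<open>g \<noteq> 0\<close> by (simp add: mult_le_0_iff)
    next
      case False
      then have "?y \<in> frontier Y" using T_in_closure Y(1) by (simp add: frontier_def interior_open)
      moreover have "p \<in> outward_unit_normals Y ?y"
        unfolding outward_unit_normals_def
      proof (safe)
        show "norm p = 1" by (fact p)
        fix z assume "z \<in> Y"
        then have "0 \<le> (z - ?y) \<bullet> g" using min[of z] closure_subset[of Y] by (auto simp: D)
        then show "(z - ?y) \<bullet> p \<le> 0" using \<open>g \<noteq> 0\<close> by (simp add: p_def zero_le_divide_iff)
      qed
      ultimately have "0 \<le> D p" unfolding D_def by (rule boundary_F[OF x])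
      then show False using p \<open>g \<noteq> 0\<close> by simp
    qed
  qed
  then show ?thesis using D[of h] by (simp add: D_def)
qed

text \<open>Strong convexity based at \<open>T x\<close>, where the first-order term vanishes.
  Integrated over a coupling, this is the stability estimate behind all statements about
  optimality.\<close>

lemma gap_lower_bound:
  assumes "x \<in> X" "y \<in> closure Y"
  shows "C / 2 * (norm (y - T x))\<^sup>2 \<le> c x y + F y - w x"
  using strong_convexity_F[OF assms(1) T_in_closure assms(2), of x] critical_T[OF assms(1)] w_T[OF assms(1)]
  by simp

lemma T_unique:
  assumes "x \<in> X" "y \<in> closure Y" "w x = c x y + F y"
  shows "T x = y"
proof -
  have "C / 2 * (norm (y - T x))\<^sup>2 \<le> 0" using gap_lower_bound[OF assms(1,2)] assms(3) by simp
  then show ?thesis using C by (simp add: mult_le_0_iff)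
qed

text \<open>Strong convexity is now based at the critical point \<open>y\<close>: it bounds the
  squared distance to \<open>T x\<close> by a difference that minimality of \<open>T x\<close> makes
  nonpositive.\<close>

lemma T_unique_critical:
  assumes "x \<in> X" "y \<in> closure Y" "\<And>h. c' (x, y) (0, h) + F' y h = 0"
  shows "T x = y"
proof -
  have "x \<in> closure X" using assms(1) closure_subset by blast
  from w_le[OF this assms(2)] have "c x (T x) + F (T x) \<le> c x y + F y"
    using w_T[OF assms(1)] by simp
  with strong_convexity_F[OF assms(1,2) T_in_closure, of x] assms(3)
  have "C / 2 * (norm (T x - y))\<^sup>2 \<le> 0" by simp
  then show ?thesis using C by (simp add: mult_le_0_iff)
qed

text \<open>One order is lost in passing from \<open>c x + F\<close> to its gradient in
  \<open>y\<close>, none in solving for the zero of that gradient.\<close>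

lemma Ck_T:
  assumes "Ck_closure (Suc (Suc k)) (X \<times> Y) (\<lambda>(x, y). c x y)" "Ck_closure (Suc (Suc k)) Y V"
    "Ck_closure (Suc (Suc k)) (Y \<times> Y) (\<lambda>(y, z). W y z)"
  shows "Ck_open (Suc k) X T"
proof -
  define \<Phi> where "\<Phi> = (\<lambda>p. (\<lambda>(x, y). c x y) p + F (snd p))"
  define D where "D = (\<lambda>p h. c' p h + F' (snd p) (snd h))"
  have opn: "open (X \<times> Y)" using X(1) Y(1) by (rule open_Times)
  have Ck_F: "Ck_upto (Suc (Suc k)) Y (closure Y) F"
    unfolding F_def
    using Ck_upto_parameter_integral[OF \<nu>_finite Y Y] assms(3)
    by (intro Ck_upto_add assms(2)) (fastforce simp: closure_Times simp del: Ck_upto.simps)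
  have \<Phi>: "Ck_upto (Suc (Suc k)) (X \<times> Y) (X \<times> closure Y) \<Phi>"
    unfolding \<Phi>_def
    by (intro Ck_upto_add Ck_upto_snd Ck_F Ck_upto_subset[OF assms(1)] order_refl Times_subset)
  have der: "(\<Phi> has_derivative D p) (at p)" if "p \<in> X \<times> Y" for p
    unfolding \<Phi>_def D_def
  proof (intro has_derivative_add c_derivative that)
    have p: "snd p \<in> Y" using that by auto
    have "(F has_derivative F' (snd p)) (at (snd p) within Y)"
      using has_derivative_subset[OF F_has_derivative closure_subset] p closure_subset[of Y] by blast
    then have "(F has_derivative F' (snd p)) (at (snd p))"
      by (simp add: at_within_open[OF p Y(1)])
    then show "((\<lambda>p. F (snd p)) has_derivative (\<lambda>h. F' (snd p) (snd h))) (at p)"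
      by (rule has_derivative_compose[OF has_derivative_snd[OF has_derivative_ident]])
  qed
  have cont: "continuous_on (X \<times> closure Y) (\<lambda>p. D p h)" for h
    unfolding D_def
    by (intro continuous_on_add continuous_on_subset[OF c'_continuous Times_subset(3)]
        continuous_on_compose2[OF F'_continuous continuous_on_snd[OF continuous_on_id]]) auto
  have CkD: "Ck_upto (Suc k) (X \<times> Y) (X \<times> closure Y) (\<lambda>p. D p h)" for h
    by (rule Ck_upto_Suc_deriv[OF opn Times_subset(1,2) \<Phi> der cont])
  \<comment> \<open>The gradient of \<open>c x + F\<close> at \<open>y\<close>, as a function of
    both variables, assembled from directional derivatives that are already known to be regular up
    to the boundary.\<close>
  define G where "G = (\<lambda>p. \<Sum>b\<in>Basis. D p (0, b) *\<^sub>R b)"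
  have G: "G (x, y) \<bullet> h = c' (x, y) (0, h) + F' y h" if "x \<in> X" "y \<in> closure Y" for x y h
  proof -
    define L where "L = (\<lambda>h. c' (x, y) (0, h) + F' y h)"
    have lin: "linear L"
      unfolding L_def
      using has_derivative_linear[OF has_derivative_add[OF c_has_derivative[OF that] F_has_derivative[OF that(2)]]] .
    have "L h = L (\<Sum>b\<in>Basis. (h \<bullet> b) *\<^sub>R b)" by (simp only: euclidean_representation)
    also have "\<dots> = (\<Sum>b\<in>Basis. (h \<bullet> b) *\<^sub>R L b)"
      by (simp only: linear_sum[OF lin] linear_scale[OF lin])
    also have "\<dots> = (\<Sum>b\<in>Basis. L b *\<^sub>R b) \<bullet> h"
      by (simp add: inner_sum_left inner_sum_right inner_commute mult.commute)
    also have "(\<Sum>b\<in>Basis. L b *\<^sub>R b) = G (x, y)"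
      by (simp add: G_def D_def L_def)
    finally show ?thesis by (simp add: L_def)
  qed
  show ?thesis
  proof (rule Ck_upto_implicit[OF X(1) Y])
    show "Ck_upto (Suc k) (X \<times> Y) (X \<times> closure Y) G"
      unfolding G_def
      by (intro Ck_upto_sum Ck_upto_bounded_linear[OF bounded_linear_scaleR_left CkD])
    show "T x \<in> closure Y" for x by (rule T_in_closure)
    show "G (x, T x) = 0" if "x \<in> X" for x
      using G[OF that T_in_closure, of x "G (x, T x)"] critical_T[OF that] by simp
    show "0 < C" by (rule C)
    show "C * (norm (y - z))\<^sup>2 \<le> (G (x, y) - G (x, z)) \<bullet> (y - z)"
      if "x \<in> X" "y \<in> closure Y" "z \<in> closure Y" for x y z
    proof -
      \<comment> \<open>Adding strong convexity based at \<open>y\<close> to that based at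
        \<open>z\<close> cancels the function values; the two constants \<open>C / 2\<close> make up
        \<open>C\<close>.\<close>
      have "C / 2 * (norm (z - y))\<^sup>2 \<le> (c x z + F z) - (c x y + F y) - G (x, y) \<bullet> (z - y)"
        unfolding G[OF that(1,2)] by (rule strong_convexity_F[OF that])
      moreover have "C / 2 * (norm (y - z))\<^sup>2 \<le> (c x y + F y) - (c x z + F z) - G (x, z) \<bullet> (y - z)"
        unfolding G[OF that(1,3)] by (rule strong_convexity_F[OF that(1,3,2)])
      ultimately show ?thesis
        by (simp add: norm_minus_commute inner_diff_left inner_diff_right)
    qed
  qed
qed

end

section \<open>Couplings\<close>

lemma borel_measurable_fst_snd:
  "fst \<in> borel_measurable (borel :: ('a::second_countable_topology \<times> 'b::second_countable_topology) measure)"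
  "snd \<in> borel_measurable (borel :: ('a \<times> 'b) measure)"
  by (auto intro!: borel_measurable_continuous_onI continuous_intros)

lemma measurable_of_borel:
  "sets M = sets borel \<Longrightarrow> f \<in> measurable borel N \<Longrightarrow> f \<in> measurable M N"
  using measurable_cong_sets[of M borel N N] by simp

lemma prob_onD:
  assumes "M \<in> prob_on A"
  shows "prob_space M" "sets M = sets borel" "emeasure M A = 1"
  using assms by (auto simp: prob_on_def)

lemma AE_prob_on:
  assumes "M \<in> prob_on A"
  shows "AE x in M. x \<in> A"
proof -
  interpret prob_space M using assms by (rule prob_onD)
  have "prob A = 1" using prob_onD(3)[OF assms] by (simp add: measure_def)
  then show ?thesis by (rule AE_prob_1)
qed

lemma prob_onI:
  assumes "prob_space M" "sets M = sets borel" "AE x in M. x \<in> A" "A \<in> sets borel"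
  shows "M \<in> prob_on A"
proof -
  interpret prob_space M by fact
  have "prob A = 1" using assms by (subst prob_eq_1) auto
  then show ?thesis using assms by (simp add: prob_on_def emeasure_eq_measure)
qed

lemma couplingsD:
  assumes "\<gamma> \<in> couplings M N"
  shows "prob_space \<gamma>" "sets \<gamma> = sets borel" "distr \<gamma> borel fst = M" "distr \<gamma> borel snd = N"
  using assms by (auto simp: couplings_def)

lemma couplings_nonempty:
  fixes M :: "'a::euclidean_space measure" and N :: "'b::euclidean_space measure"
  assumes "prob_space M" "sets M = sets borel" "prob_space N" "sets N = sets borel"
  shows "M \<Otimes>\<^sub>M N \<in> couplings M N"
proof -
  interpret M: prob_space M by fact
  interpret N: prob_space N by fact
  interpret pair_prob_space M N ..
  have sets: "sets (M \<Otimes>\<^sub>M N) = sets borel"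
    using sets_pair_measure_cong[OF assms(2,4)] by (simp only: borel_prod)
  have "distr (M \<Otimes>\<^sub>M N) borel fst = distr (M \<Otimes>\<^sub>M N) M fst"
    by (rule distr_cong) (use assms in auto)
  then have "distr (M \<Otimes>\<^sub>M N) borel fst = M" by (simp add: N.distr_pair_fst)
  moreover have "distr (M \<Otimes>\<^sub>M N) borel snd = N"
  proof (rule measure_eqI)
    fix A assume "A \<in> sets (distr (M \<Otimes>\<^sub>M N) borel snd)"
    then have A: "A \<in> sets N" using assms by simp
    have snd: "snd \<in> measurable (M \<Otimes>\<^sub>M N) borel"
      using measurable_snd[of M N] unfolding measurable_cong_sets[OF refl assms(4)] .
    have "snd -` A \<inter> space (M \<Otimes>\<^sub>M N) = space M \<times> A"
      using sets.sets_into_space[OF A] by (auto simp: space_pair_measure)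
    then show "emeasure (distr (M \<Otimes>\<^sub>M N) borel snd) A = emeasure N A"
      using A N.emeasure_pair_measure_Times[OF sets.top[of M] A] assms(4)
      by (simp add: emeasure_distr[OF snd] M.emeasure_space_1)
  qed (use assms in simp)
  ultimately show ?thesis
    using sets prob_space_axioms by (simp add: couplings_def)
qed

lemma graph_coupling:
  fixes M :: "'a::euclidean_space measure" and S :: "'a \<Rightarrow> 'b::euclidean_space"
  assumes "prob_space M" "sets M = sets borel" "S \<in> borel_measurable M"
  shows "distr M borel (\<lambda>x. (x, S x)) \<in> couplings M (distr M borel S)"
proof -
  have m: "(\<lambda>x. (x, S x)) \<in> borel_measurable M"
    by (rule borel_measurable_Pair[OF measurable_ident_sets[OF assms(2)] assms(3)])
  have "distr (distr M borel (\<lambda>x. (x, S x))) borel fst = distr M borel (\<lambda>x. x)"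
    by (subst distr_distr[OF borel_measurable_fst_snd(1) m]) (simp add: comp_def)
  also have "\<dots> = M"
    by (rule distr_id2) (simp only: assms(2))
  finally have "distr (distr M borel (\<lambda>x. (x, S x))) borel fst = M" .
  moreover have "distr (distr M borel (\<lambda>x. (x, S x))) borel snd = distr M borel S"
    by (subst distr_distr[OF borel_measurable_fst_snd(2) m]) (simp add: comp_def)
  moreover have "sets (distr M borel (\<lambda>x. (x, S x))) = sets borel"
    by simp
  moreover note prob_space.prob_space_distr[OF assms(1) m]
  ultimately show ?thesis
    unfolding couplings_def by blast
qed

text \<open>Moving a fraction \<open>t\<close> of the mass from \<open>\<gamma>\<close> onto the graph of \<open>S\<close>.\<close>

lemma mixture_with_graph:
  fixes \<gamma> :: "('a::euclidean_space \<times> 'b::euclidean_space) measure"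
  assumes \<gamma>: "prob_space \<gamma>" "sets \<gamma> = sets borel" and S: "S \<in> borel_measurable borel"
    and t: "0 \<le> t" "t \<le> 1"
  obtains \<eta> where "prob_space \<eta>" "sets \<eta> = sets borel" "distr \<eta> borel fst = distr \<gamma> borel fst"
    "\<And>f B. f \<in> borel_measurable borel \<Longrightarrow> (\<And>p. \<bar>f p\<bar> \<le> (B::real)) \<Longrightarrow>
       (LINT p|\<eta>. f p) = t * (LINT p|\<gamma>. f (fst p, S (fst p))) + (1 - t) * (LINT p|\<gamma>. f p)"
proof -
  let ?B = "measure_pmf (bernoulli_pmf t)"
  interpret \<gamma>: prob_space \<gamma> by fact
  interpret P: pair_prob_space \<gamma> ?B ..
  let ?P = "\<gamma> \<Otimes>\<^sub>M ?B"
  \<comment> \<open>A coin with success probability \<open>t\<close> decides whether a point is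
    moved. The mixture is thereby an image measure, and its first marginal is unchanged because both
    branches keep the first coordinate.\<close>
  define m where "m = (\<lambda>(p, b). if b then (fst p, S (fst p)) else p)"
  have fst: "fst \<in> measurable ?P borel"
    using measurable_fst[of \<gamma> ?B] unfolding measurable_cong_sets[OF refl \<gamma>(2)] .
  have graph: "(\<lambda>p::'a \<times> 'b. (fst p, S (fst p))) \<in> borel_measurable borel"
    using borel_measurable_Pair[OF borel_measurable_fst_snd(1) measurable_compose[OF borel_measurable_fst_snd(1) S]]
    by simp
  have m: "m \<in> measurable ?P borel"
    unfolding m_def case_prod_unfold
  proof (rule measurable_If)
    show "(\<lambda>x. (fst (fst x), S (fst (fst x)))) \<in> borel_measurable ?P"
      using measurable_compose[OF fst graph] .
    show "fst \<in> borel_measurable ?P" by (rule fst)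
    have "snd \<in> measurable ?P (count_space UNIV)" by simp
    then show "{x \<in> space ?P. snd x} \<in> sets ?P" by (rule predE)
  qed
  show thesis
  proof (rule that)
    show "prob_space (distr ?P borel m)" by (rule P.prob_space_distr[OF m])
    show "sets (distr ?P borel m) = sets borel" by simp
    have "distr (distr ?P borel m) borel fst = distr ?P borel (fst \<circ> fst)"
      unfolding distr_distr[OF borel_measurable_fst_snd(1) m]
      by (rule distr_cong) (auto simp: m_def split: prod.splits)
    also have "\<dots> = distr (distr ?P \<gamma> fst) borel fst"
      by (rule distr_distr[symmetric, OF measurable_of_borel[OF \<gamma>(2) borel_measurable_fst_snd(1)]]) simp
    finally show "distr (distr ?P borel m) borel fst = distr \<gamma> borel fst"
      by (simp add: measure_pmf.distr_pair_fst)
    fix f :: "'a \<times> 'b \<Rightarrow> real" and B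
    assume f: "f \<in> borel_measurable borel" "\<And>p. \<bar>f p\<bar> \<le> B"
    have int: "integrable ?P (\<lambda>x. f (m x))"
      by (rule P.integrable_const_bound[of _ B]) (use f measurable_compose[OF m] in auto)
    have "(LINT p|distr ?P borel m. f p) = (LINT x|?P. f (m x))"
      by (rule integral_distr[OF m f(1)])
    also have "\<dots> = (LINT p|\<gamma>. LINT b|?B. f (m (p, b)))"
      by (rule P.integral_fst'[OF int, symmetric])
    also have "\<dots> = (LINT p|\<gamma>. f (fst p, S (fst p)) * t + f p * (1 - t))"
      using t by (simp add: m_def)
    also have "\<dots> = (LINT p|\<gamma>. f (fst p, S (fst p)) * t) + (LINT p|\<gamma>. f p * (1 - t))"
    proof (rule Bochner_Integration.integral_add)
      have "integrable \<gamma> (\<lambda>p. f (fst p, S (fst p)))" "integrable \<gamma> f"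
        using f(2) measurable_of_borel[OF \<gamma>(2) measurable_compose[OF graph f(1)]]
          measurable_of_borel[OF \<gamma>(2) f(1)]
        by (auto intro!: \<gamma>.integrable_const_bound[of _ B])
      then show "integrable \<gamma> (\<lambda>p. f (fst p, S (fst p)) * t)" "integrable \<gamma> (\<lambda>p. f p * (1 - t))"
        by auto
    qed
    finally show "(LINT p|distr ?P borel m. f p) =
        t * (LINT p|\<gamma>. f (fst p, S (fst p))) + (1 - t) * (LINT p|\<gamma>. f p)"
      by (simp add: mult.commute)
  qed
qed

text \<open>If \<open>f p\<close> lies in \<open>K\<close>, then either \<open>g p\<close> is within
  \<open>e\<close> of \<open>K\<close> or the two values are at least \<open>e\<close> apart. This
  bounds \<open>measure M K\<close> by the measure under \<open>N\<close> of a closed neighbourhood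
  of \<open>K\<close>, plus \<open>e\<close>; the neighbourhoods shrink to \<open>K\<close> because
  it is closed.\<close>

lemma measure_le_of_close_couplings:
  fixes M N :: "'a::euclidean_space measure"
  assumes M: "finite_measure M" "sets M = sets borel" and N: "finite_measure N" "sets N = sets borel"
    and close: "\<And>e. 0 < e \<Longrightarrow> \<exists>(\<gamma>::'c measure) f g. prob_space \<gamma> \<and> f \<in> borel_measurable \<gamma> \<and> g \<in> borel_measurable \<gamma> \<and>
      distr \<gamma> borel f = M \<and> distr \<gamma> borel g = N \<and> measure \<gamma> {p \<in> space \<gamma>. e \<le> dist (f p) (g p)} \<le> e"
    and K: "closed K"
  shows "measure M K \<le> measure N K"
proof (cases "K = {}")
  case False
  interpret N: finite_measure N by fact
  define A where "A = (\<lambda>n. {x. infdist x K \<le> inverse (real (Suc n))})"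
  have meas: "{x. infdist x K \<le> r} \<in> sets borel" for r
    by (intro borel_closed closed_Collect_le continuous_intros)
  have bound: "measure M K \<le> measure N (A n) + inverse (real (Suc n))" for n
  proof -
    define e where "e = inverse (real (Suc n))"
    have "e > 0" by (simp add: e_def)
    from close[OF this] obtain \<gamma> :: "'c measure" and f g where
      \<gamma>: "prob_space \<gamma>" "f \<in> borel_measurable \<gamma>" "g \<in> borel_measurable \<gamma>"
      "distr \<gamma> borel f = M" "distr \<gamma> borel g = N" "measure \<gamma> {p \<in> space \<gamma>. e \<le> dist (f p) (g p)} \<le> e"
      by blast
    interpret \<gamma>: prob_space \<gamma> by fact
    have s1: "f -` K \<inter> space \<gamma> \<in> sets \<gamma>" using \<gamma>(2) borel_closed[OF K] by (rule measurable_sets)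
    have s2: "g -` A n \<inter> space \<gamma> \<in> sets \<gamma>" using \<gamma>(3) meas unfolding A_def by (rule measurable_sets)
    have s3: "{p \<in> space \<gamma>. e \<le> dist (f p) (g p)} \<in> sets \<gamma>"
      using \<gamma>(2,3) by measurable
    have "measure M K = measure \<gamma> (f -` K \<inter> space \<gamma>)"
      unfolding \<gamma>(4)[symmetric] by (rule measure_distr[OF \<gamma>(2) borel_closed[OF K]])
    also have "\<dots> \<le> measure \<gamma> ((g -` A n \<inter> space \<gamma>) \<union> {p \<in> space \<gamma>. e \<le> dist (f p) (g p)})"
    proof (rule \<gamma>.finite_measure_mono)
      show "f -` K \<inter> space \<gamma> \<subseteq> (g -` A n \<inter> space \<gamma>) \<union> {p \<in> space \<gamma>. e \<le> dist (f p) (g p)}"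
      proof (safe, simp)
        fix p assume "p \<in> space \<gamma>" "f p \<in> K" "g p \<notin> A n"
        then have "e < infdist (g p) K" by (simp add: A_def e_def)
        also have "\<dots> \<le> dist (g p) (f p)" using \<open>f p \<in> K\<close> by (rule infdist_le)
        finally show "e \<le> dist (f p) (g p)" by (simp add: dist_commute)
      qed
    qed (use s2 s3 in blast)
    also have "\<dots> \<le> measure \<gamma> (g -` A n \<inter> space \<gamma>) + measure \<gamma> {p \<in> space \<gamma>. e \<le> dist (f p) (g p)}"
      using s2 s3 by (rule measure_Un_le)
    also have "measure \<gamma> (g -` A n \<inter> space \<gamma>) = measure N (A n)"
      unfolding \<gamma>(5)[symmetric] A_def using measure_distr[OF \<gamma>(3) meas] by simp
    finally show ?thesis using \<gamma>(6) by (simp add: e_def)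
  qed
  have "(\<lambda>n. measure N (A n)) \<longlonglongrightarrow> measure N (\<Inter>n. A n)"
  proof (rule N.finite_Lim_measure_decseq)
    show "range A \<subseteq> sets N" using meas N(2) by (auto simp: A_def)
    show "decseq A"
    proof (rule decseq_SucI)
      fix n
      have "inverse (real (Suc (Suc n))) \<le> inverse (real (Suc n))"
        by (rule le_imp_inverse_le) simp_all
      then show "A (Suc n) \<subseteq> A n" unfolding A_def by (meson Collect_mono order_trans)
    qed
  qed
  moreover have "(\<Inter>n. A n) = K"
  proof safe
    fix x assume x: "x \<in> (\<Inter>n. A n)"
    have "infdist x K \<le> 0"
    proof (rule LIMSEQ_le_const[OF LIMSEQ_inverse_real_of_nat])
      show "\<exists>N. \<forall>n\<ge>N. infdist x K \<le> inverse (real (Suc n))" using x by (auto simp: A_def)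
    qed
    then have "infdist x K = 0"
      using infdist_nonneg[of x K] by linarith
    then show "x \<in> K"
      using in_closed_iff_infdist_zero[OF K False] by blast
  next
    fix x n assume "x \<in> K"
    then show "x \<in> A n" by (simp add: A_def)
  qed
  ultimately have "(\<lambda>n. measure N (A n) + inverse (real (Suc n))) \<longlonglongrightarrow> measure N K + 0"
    by (intro tendsto_add LIMSEQ_inverse_real_of_nat) simp
  then show ?thesis
    using LIMSEQ_le_const[of "\<lambda>n. measure N (A n) + inverse (real (Suc n))" _ "measure M K"] bound by auto
qed simp

text \<open>The hypothesis is symmetric in the two measures, so both inequalities hold on closed
  sets, which form an intersection-stable generator of the Borel sets.\<close>

lemma measure_eq_of_close_couplings:
  fixes M N :: "'a::euclidean_space measure"
  assumes M: "finite_measure M" "sets M = sets borel" and N: "finite_measure N" "sets N = sets borel"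
    and close: "\<And>e. 0 < e \<Longrightarrow> \<exists>(\<gamma>::'c measure) f g. prob_space \<gamma> \<and> f \<in> borel_measurable \<gamma> \<and> g \<in> borel_measurable \<gamma> \<and>
      distr \<gamma> borel f = M \<and> distr \<gamma> borel g = N \<and> measure \<gamma> {p \<in> space \<gamma>. e \<le> dist (f p) (g p)} \<le> e"
  shows "M = N"
proof (rule measure_eqI_generator_eq[where E = "{K. closed K}" and \<Omega> = UNIV and A = "\<lambda>_. UNIV"])
  show "Int_stable {K. closed K}" by (auto simp: Int_stable_def)
  show "sets M = sigma_sets UNIV {K. closed K}" "sets N = sigma_sets UNIV {K. closed K}"
    using M N by (simp_all add: borel_eq_closed)
  show "emeasure M UNIV \<noteq> \<infinity>" by (simp add: finite_measure.emeasure_finite[OF M(1)])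
  fix K :: "'a set" assume "K \<in> {K. closed K}"
  then have K: "closed K" by simp
  have "measure M K \<le> measure N K"
    by (rule measure_le_of_close_couplings[OF M N close K])
  moreover have "measure N K \<le> measure M K"
  proof (rule measure_le_of_close_couplings[OF N M _ K])
    fix e :: real assume "0 < e"
    from close[OF this] obtain \<gamma> :: "'c measure" and f g where
      "prob_space \<gamma> \<and> f \<in> borel_measurable \<gamma> \<and> g \<in> borel_measurable \<gamma> \<and>
      distr \<gamma> borel f = M \<and> distr \<gamma> borel g = N \<and> measure \<gamma> {p \<in> space \<gamma>. e \<le> dist (f p) (g p)} \<le> e"
      by blast
    then show "\<exists>(\<gamma>::'c measure) f g. prob_space \<gamma> \<and> f \<in> borel_measurable \<gamma> \<and> g \<in> borel_measurable \<gamma> \<and>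
      distr \<gamma> borel f = N \<and> distr \<gamma> borel g = M \<and> measure \<gamma> {p \<in> space \<gamma>. e \<le> dist (f p) (g p)} \<le> e"
      by (intro exI[of _ \<gamma>] exI[of _ g] exI[of _ f]) (simp only: dist_commute simp_thms)
  qed
  ultimately show "emeasure M K = emeasure N K"
    by (simp add: finite_measure.emeasure_eq_measure[OF M(1)] finite_measure.emeasure_eq_measure[OF N(1)])
qed auto

text \<open>All functions \<open>k x y + g y\<close> of \<open>x\<close> share the modulus of
  continuity of \<open>k\<close>, uniform by compactness, and an attained infimum inherits it. It
  serves for both transforms, \<open>w\<close> and \<open>v\<close>.\<close>

lemma continuous_on_inf_transform:
  fixes k :: "'a::metric_space \<Rightarrow> 'b::metric_space \<Rightarrow> real"
  assumes "compact A" "compact B" and k: "continuous_on (A \<times> B) (\<lambda>(x, y). k x y)"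
    and f: "\<And>x. x \<in> A \<Longrightarrow> \<exists>y\<in>B. f x = k x y + g y" "\<And>x y. x \<in> A \<Longrightarrow> y \<in> B \<Longrightarrow> f x \<le> k x y + g y"
  shows "continuous_on A f"
  unfolding continuous_on_iff
proof (intro ballI allI impI)
  fix x and e :: real assume x: "x \<in> A" and "0 < e"
  have "uniformly_continuous_on (A \<times> B) (\<lambda>(x, y). k x y)"
    using assms by (intro compact_uniformly_continuous compact_Times)
  then obtain d where d: "d > 0" "\<And>p q. p \<in> A \<times> B \<Longrightarrow> q \<in> A \<times> B \<Longrightarrow> dist q p < d \<Longrightarrow>
      dist ((\<lambda>(x, y). k x y) q) ((\<lambda>(x, y). k x y) p) < e"
    using \<open>0 < e\<close> unfolding uniformly_continuous_on_def by meson
  have le: "f u < f v + e" if uv: "u \<in> A" "v \<in> A" "dist u v < d" for u v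
  proof -
    obtain y where y: "y \<in> B" "f v = k v y + g y" using f(1)[OF uv(2)] by blast
    have "dist (k u y) (k v y) < e"
      using d(2)[of "(v, y)" "(u, y)"] uv y by (simp add: dist_Pair_Pair)
    then show ?thesis using f(2)[OF uv(1) y(1)] y(2) by (simp add: dist_real_def)
  qed
  have "dist (f x') (f x) < e" if "x' \<in> A" "dist x' x < d" for x'
    using le[OF that(1) x that(2)] le[OF x that(1)] that(2) by (simp add: dist_real_def dist_commute)
  then show "\<exists>d>0. \<forall>x'\<in>A. dist x' x < d \<longrightarrow> dist (f x') (f x) < e"
    using d(1) by blast
qed

lemma le_of_small_perturbation:
  fixes a b k :: real
  assumes "\<And>t. 0 < t \<Longrightarrow> t < 1 \<Longrightarrow> a \<le> b + t * k"
  shows "a \<le> b"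
proof -
  have "((\<lambda>t. b + t * k) \<longlongrightarrow> b + 0 * k) (at_right 0)"
    by (intro tendsto_intros)
  moreover have "\<forall>\<^sub>F t in at_right 0. a \<le> b + t * k"
    unfolding eventually_at_right_field using assms zero_less_one by blast
  ultimately show ?thesis
    using tendsto_lowerbound[of "\<lambda>t. b + t * k" b "at_right 0" a] by simp
qed

text \<open>The integrals over closures are integrals of functions cut off by an indicator. The
  cut-off is bounded and Borel on the whole space, as the image measure and mixture formulas
  require.\<close>

lemma compact_extension:
  fixes f :: "'a::euclidean_space \<Rightarrow> real"
  assumes "compact K" "continuous_on K f"
  obtains B where "(\<lambda>x. indicator K x *\<^sub>R f x) \<in> borel_measurable borel" "0 \<le> B"
    "\<And>x. \<bar>indicator K x *\<^sub>R f x\<bar> \<le> B"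
proof -
  obtain B where B: "\<And>x. x \<in> K \<Longrightarrow> \<bar>f x\<bar> \<le> B"
    using compact_imp_bounded[OF compact_continuous_image[OF assms(2,1)]]
    by (auto simp: bounded_iff)
  have "\<bar>indicator K x *\<^sub>R f x\<bar> \<le> \<bar>B\<bar>" for x
    using B[of x] by (auto simp: indicator_def)
  then show thesis
    using that[of "\<bar>B\<bar>"] borel_measurable_continuous_on_indicator[OF borel_compact[OF assms(1)] assms(2)] by auto
qed

section \<open>The minimizer as the image of \<open>\<mu>\<close>\<close>

locale equilibrium = smooth_model X Y c V W c' V' W' \<nu> C
  for X :: "(real ^ 'm) set" and Y :: "(real ^ 'n) set" and c V W c' V' W' \<nu> C +
  fixes \<mu> :: "(real ^ 'm) measure"
  assumes \<mu>: "\<mu> \<in> prob_on X"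
    and C2: "Ck_closure 2 (X \<times> Y) (\<lambda>(x, y). c x y)" "Ck_closure 2 Y V" "Ck_closure 2 (Y \<times> Y) (\<lambda>(y, z). W y z)"
    and W_sym: "\<And>y z. y \<in> closure Y \<Longrightarrow> z \<in> closure Y \<Longrightarrow> W y z = W z y"
    and minimizer: "\<And>\<nu>'. \<nu>' \<in> prob_on (closure Y) \<Longrightarrow> energy c V W X Y \<mu> \<nu> \<le> energy c V W X Y \<mu> \<nu>'"
begin

abbreviation cost :: "((real ^ 'm) \<times> (real ^ 'n)) measure \<Rightarrow> real" where
  "cost \<gamma> \<equiv> LINT p:closure X \<times> closure Y|\<gamma>. c (fst p) (snd p)"

definition \<nu>\<^sub>T :: "(real ^ 'n) measure" where
  "\<nu>\<^sub>T = distr \<mu> borel T"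

lemma X_closure: "x \<in> X \<Longrightarrow> x \<in> closure X"
  using closure_subset by blast

lemma c_continuous': "continuous_on (closure X \<times> closure Y) (\<lambda>p. c (fst p) (snd p))"
  using c_continuous by (simp add: case_prod_unfold)

text \<open>A selection made by \<open>SOME\<close> has no regularity of its own; continuity, and
  with it measurability, comes from the equation that \<open>T\<close> solves.\<close>

lemma continuous_on_T: "continuous_on X T"
  using Ck_T[of 0] C2 Ck_upto_continuous_on unfolding numeral_2_eq_2 by blast

lemma T_measurable: "T \<in> borel_measurable borel"
proof -
  have "T = (\<lambda>x. if x \<in> X then T x else SOME y. y \<in> closure Y)"
    by (auto simp: T_def)
  moreover have "(\<lambda>x. if x \<in> X then T x else SOME y. y \<in> closure Y) \<in> borel_measurable borel"
    by (rule borel_measurable_continuous_on_if[OF borel_open[OF X(1)] continuous_on_T continuous_on_const])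
  ultimately show ?thesis by simp
qed

lemma T_measurable_\<mu>: "T \<in> borel_measurable \<mu>"
  using measurable_of_borel[OF prob_onD(2)[OF \<mu>] T_measurable] .

lemma \<nu>\<^sub>T_prob: "\<nu>\<^sub>T \<in> prob_on (closure Y)"
  unfolding \<nu>\<^sub>T_def
proof (rule prob_onI)
  show "prob_space (distr \<mu> borel T)"
    by (rule prob_space.prob_space_distr[OF prob_onD(1)[OF \<mu>] T_measurable_\<mu>])
  show "AE y in distr \<mu> borel T. y \<in> closure Y"
    by (subst AE_distr_iff[OF T_measurable_\<mu>]) (auto simp: T_in_closure)
qed auto

lemma continuous_on_w: "continuous_on (closure X) w"
proof (rule continuous_on_inf_transform[OF compact_closures c_continuous])
  show "\<exists>y\<in>closure Y. w x = c x y + F y" if "x \<in> closure X" for x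
    using w_attained[OF that] by blast
qed (rule w_le)

text \<open>The quadratic gap is known for \<open>x\<close> in \<open>X\<close> only, and
  \<open>\<mu>\<close> is concentrated on \<open>X\<close> itself rather than on its
  closure.\<close>

lemma couplings_AE:
  assumes "\<gamma> \<in> couplings \<mu> N" "N \<in> prob_on (closure Y)"
  shows "AE p in \<gamma>. fst p \<in> X \<and> snd p \<in> closure Y"
proof -
  note \<gamma> = couplingsD[OF assms(1)]
  have "AE p in \<gamma>. fst p \<in> X"
    using AE_prob_on[OF \<mu>] unfolding \<gamma>(3)[symmetric]
    by (rule AE_distrD[OF measurable_of_borel[OF \<gamma>(2) borel_measurable_fst_snd(1)]])
  moreover have "AE p in \<gamma>. snd p \<in> closure Y"
    using AE_prob_on[OF assms(2)] unfolding \<gamma>(4)[symmetric]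
    by (rule AE_distrD[OF measurable_of_borel[OF \<gamma>(2) borel_measurable_fst_snd(2)]])
  ultimately show ?thesis by eventually_elim simp
qed

text \<open>Integral of \<open>gap_lower_bound\<close> over the coupling. It holds for every second
  marginal \<open>N\<close>, so it also yields the bounds for the competitors.\<close>

lemma coupling_gap:
  assumes \<gamma>: "\<gamma> \<in> couplings \<mu> N" and N: "N \<in> prob_on (closure Y)"
  shows "integrable \<gamma> (\<lambda>p. (norm (snd p - T (fst p)))\<^sup>2)" (is ?int)
    and "C / 2 * (LINT p|\<gamma>. (norm (snd p - T (fst p)))\<^sup>2) \<le>
      cost \<gamma> + (LINT y:closure Y|N. F y) - (LINT x:closure X|\<mu>. w x)" (is ?le)
proof -
  note \<gamma>D = couplingsD[OF \<gamma>]
  interpret \<gamma>: prob_space \<gamma> by (rule \<gamma>D)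
  note m = measurable_of_borel[OF \<gamma>D(2)]
  define c0 where "c0 = (\<lambda>p. indicator (closure X \<times> closure Y) p *\<^sub>R c (fst p) (snd p))"
  define F0 where "F0 = (\<lambda>y. indicator (closure Y) y *\<^sub>R F y)"
  define w0 where "w0 = (\<lambda>x. indicator (closure X) x *\<^sub>R w x)"
  obtain B1 where B1: "c0 \<in> borel_measurable borel" "\<And>p. \<bar>c0 p\<bar> \<le> B1"
    using compact_extension[OF compact_Times[OF compact_closures] c_continuous'] unfolding c0_def by metis
  obtain B2 where B2: "F0 \<in> borel_measurable borel" "\<And>p. \<bar>F0 p\<bar> \<le> B2"
    using compact_extension[OF compact_closures(2) F_continuous] unfolding F0_def by metis
  obtain B3 where B3: "w0 \<in> borel_measurable borel" "\<And>p. \<bar>w0 p\<bar> \<le> B3"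
    using compact_extension[OF compact_closures(1) continuous_on_w] unfolding w0_def by metis
  have ic: "integrable \<gamma> c0"
    by (rule \<gamma>.integrable_const_bound[of _ B1]) (use B1 m in auto)
  have iF: "integrable \<gamma> (\<lambda>p. F0 (snd p))"
    by (rule \<gamma>.integrable_const_bound[of _ B2])
      (use B2 m[OF measurable_compose[OF borel_measurable_fst_snd(2) B2(1)]] in auto)
  have iw: "integrable \<gamma> (\<lambda>p. w0 (fst p))"
    by (rule \<gamma>.integrable_const_bound[of _ B3])
      (use B3 m[OF measurable_compose[OF borel_measurable_fst_snd(1) B3(1)]] in auto)
  have "cost \<gamma> = (LINT p|\<gamma>. c0 p)" by (simp add: set_lebesgue_integral_def c0_def)
  moreover have "(LINT y:closure Y|N. F y) = (LINT p|\<gamma>. F0 (snd p))"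
    using integral_distr[OF m[OF borel_measurable_fst_snd(2)] B2(1)]
    by (simp add: set_lebesgue_integral_def F0_def \<gamma>D(4))
  moreover have "(LINT x:closure X|\<mu>. w x) = (LINT p|\<gamma>. w0 (fst p))"
    using integral_distr[OF m[OF borel_measurable_fst_snd(1)] B3(1)]
    by (simp add: set_lebesgue_integral_def w0_def \<gamma>D(3))
  ultimately have sum: "cost \<gamma> + (LINT y:closure Y|N. F y) - (LINT x:closure X|\<mu>. w x) =
      (LINT p|\<gamma>. c0 p + F0 (snd p) - w0 (fst p))"
    by (simp add: ic iF iw)
  obtain R where R: "\<And>y. y \<in> closure Y \<Longrightarrow> norm y \<le> R"
    using compact_imp_bounded[OF compact_closures(2)] by (auto simp: bounded_iff)
  have "(\<lambda>p. snd p - T (fst p)) \<in> borel_measurable borel"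
    by (rule borel_measurable_diff[OF borel_measurable_fst_snd(2)
          measurable_compose[OF borel_measurable_fst_snd(1) T_measurable]])
  then have "(\<lambda>p. (norm (snd p - T (fst p)))\<^sup>2) \<in> borel_measurable borel"
    by (intro borel_measurable_power measurable_compose[OF _ borel_measurable_norm])
  from m[OF this] have meas: "(\<lambda>p. (norm (snd p - T (fst p)))\<^sup>2) \<in> borel_measurable \<gamma>" .
  show ?int
  proof (rule \<gamma>.integrable_const_bound[OF _ meas])
    show "AE p in \<gamma>. norm ((norm (snd p - T (fst p)))\<^sup>2) \<le> (R + R)\<^sup>2"
      using couplings_AE[OF \<gamma> N]
    proof eventually_elim
      case (elim p)
      have "norm (snd p - T (fst p)) \<le> R + R"
        using R[of "snd p"] R[OF T_in_closure, of "fst p"] elim norm_triangle_ineq4[of "snd p" "T (fst p)"] by linarith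
      from power_mono[OF this norm_ge_zero, of 2] show ?case by simp
    qed
  qed
  then have "(LINT p|\<gamma>. C / 2 * (norm (snd p - T (fst p)))\<^sup>2) \<le> (LINT p|\<gamma>. c0 p + F0 (snd p) - w0 (fst p))"
  proof (intro integral_mono_AE)
    show "AE p in \<gamma>. C / 2 * (norm (snd p - T (fst p)))\<^sup>2 \<le> c0 p + F0 (snd p) - w0 (fst p)"
      using couplings_AE[OF \<gamma> N]
    proof eventually_elim
      case (elim p)
      then show ?case
        using gap_lower_bound[of "fst p" "snd p"] X_closure by (simp add: c0_def F0_def w0_def mem_Times_iff)
    qed
  qed (use ic iF iw in auto)
  then show ?le unfolding sum by simp
qed

text \<open>Weak duality for the pair \<open>(w, - F)\<close>. It also keeps the infimum in the
  transport cost away from minus infinity.\<close>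

lemma cost_lower_bound:
  assumes "\<gamma> \<in> couplings \<mu> N" "N \<in> prob_on (closure Y)"
  shows "(LINT x:closure X|\<mu>. w x) - (LINT y:closure Y|N. F y) \<le> cost \<gamma>"
proof -
  have "0 \<le> C / 2 * (LINT p|\<gamma>. (norm (snd p - T (fst p)))\<^sup>2)"
    using C by (intro mult_nonneg_nonneg integral_nonneg) auto
  then show ?thesis using coupling_gap(2)[OF assms] by simp
qed

lemma transport_cost_le:
  assumes "\<gamma> \<in> couplings \<mu> N" "N \<in> prob_on (closure Y)"
  shows "transport_cost c X Y \<mu> N \<le> cost \<gamma>"
  unfolding transport_cost_def
proof (rule cINF_lower[OF _ assms(1)])
  show "bdd_below (cost ` couplings \<mu> N)"
    using cost_lower_bound[OF _ assms(2)] by (auto intro!: bdd_belowI2)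
qed

lemma transport_cost_greatest:
  assumes "N \<in> prob_on (closure Y)" "\<And>\<gamma>. \<gamma> \<in> couplings \<mu> N \<Longrightarrow> a \<le> cost \<gamma>"
  shows "a \<le> transport_cost c X Y \<mu> N"
  unfolding transport_cost_def
proof (rule cINF_greatest)
  show "couplings \<mu> N \<noteq> {}"
    using couplings_nonempty[OF prob_onD(1,2)[OF \<mu>] prob_onD(1,2)[OF assms(1)]] by blast
qed (rule assms(2))

lemma transport_cost_approx:
  assumes "N \<in> prob_on (closure Y)" "0 < \<delta>"
  obtains \<gamma> where "\<gamma> \<in> couplings \<mu> N" "cost \<gamma> < transport_cost c X Y \<mu> N + \<delta>"
proof -
  have "\<not> transport_cost c X Y \<mu> N + \<delta> \<le> transport_cost c X Y \<mu> N" using assms(2) by simp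
  then show thesis using transport_cost_greatest[OF assms(1)] that by (meson not_le)
qed

section \<open>Integrals against \<open>\<nu>\<^sub>T\<close> and along the graph of
  \<open>T\<close>\<close>

lemma integral_\<nu>\<^sub>T:
  fixes f :: "real ^ 'n \<Rightarrow> real"
  assumes "continuous_on (closure Y) f"
  shows "(LINT y:closure Y|\<nu>\<^sub>T. f y) = (LINT x|\<mu>. f (T x))"
proof -
  obtain B where "(\<lambda>y. indicator (closure Y) y *\<^sub>R f y) \<in> borel_measurable borel"
    using compact_extension[OF compact_closures(2) assms] by metis
  from integral_distr[OF T_measurable_\<mu> this] show ?thesis
    by (simp add: set_lebesgue_integral_def \<nu>\<^sub>T_def T_in_closure)
qed

lemma cost_graph:
  assumes S: "S \<in> borel_measurable \<mu>" "S ` X \<subseteq> closure Y"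
  shows "cost (distr \<mu> borel (\<lambda>x. (x, S x))) = (LINT x:X|\<mu>. c x (S x))"
proof -
  define c0 where "c0 = (\<lambda>p. indicator (closure X \<times> closure Y) p *\<^sub>R c (fst p) (snd p))"
  have c0: "c0 \<in> borel_measurable borel"
    using compact_extension[OF compact_Times[OF compact_closures] c_continuous'] unfolding c0_def by metis
  have graph: "(\<lambda>x. (x, S x)) \<in> borel_measurable \<mu>"
    by (rule borel_measurable_Pair[OF measurable_ident_sets[OF prob_onD(2)[OF \<mu>]] S(1)])
  have eq: "indicator X x *\<^sub>R c x (S x) = indicator X x *\<^sub>R c0 (x, S x)" for x
    using S(2) X_closure by (auto simp: c0_def indicator_def)
  have "cost (distr \<mu> borel (\<lambda>x. (x, S x))) = (LINT x|\<mu>. c0 (x, S x))"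
    unfolding set_lebesgue_integral_def c0_def[symmetric] by (rule integral_distr[OF graph c0])
  also have "\<dots> = (LINT x|\<mu>. indicator X x *\<^sub>R c0 (x, S x))"
  proof (rule integral_cong_AE)
    show "(\<lambda>x. c0 (x, S x)) \<in> borel_measurable \<mu>" by (rule measurable_compose[OF graph c0])
    then show "(\<lambda>x. indicator X x *\<^sub>R c0 (x, S x)) \<in> borel_measurable \<mu>"
      using borel_open[OF X(1)] prob_onD(2)[OF \<mu>] by (intro borel_measurable_scaleR borel_measurable_indicator) auto
    show "AE x in \<mu>. c0 (x, S x) = indicator X x *\<^sub>R c0 (x, S x)"
      using AE_prob_on[OF \<mu>] by eventually_elim simp
  qed
  finally show ?thesis unfolding set_lebesgue_integral_def eq .
qed

lemma integrable_w: "integrable \<mu> (\<lambda>x. indicator (closure X) x *\<^sub>R w x)"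
  using set_integrable_compact[OF prob_space.finite_measure[OF prob_onD(1)[OF \<mu>]] prob_onD(2)[OF \<mu>]
      compact_closures(1) continuous_on_w]
  by (simp add: set_integrable_def)

lemma integrable_T:
  fixes f :: "real ^ 'n \<Rightarrow> real"
  assumes "continuous_on (closure Y) f"
  shows "integrable \<mu> (\<lambda>x. f (T x))"
proof -
  obtain B where B: "(\<lambda>y. indicator (closure Y) y *\<^sub>R f y) \<in> borel_measurable borel"
    "\<And>y. \<bar>indicator (closure Y) y *\<^sub>R f y\<bar> \<le> B"
    using compact_extension[OF compact_closures(2) assms] by metis
  have "(\<lambda>x. f (T x)) \<in> borel_measurable \<mu>"
    using measurable_compose[OF T_measurable_\<mu> B(1)] by (simp add: T_in_closure)
  moreover have "\<bar>f (T x)\<bar> \<le> B" for x using B(2)[of "T x"] by (simp add: T_in_closure)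
  ultimately show ?thesis
    by (intro finite_measure.integrable_const_bound[OF prob_space.finite_measure[OF prob_onD(1)[OF \<mu>]], where B = B]) auto
qed

text \<open>The equality case of weak duality: the gap vanishes on the graph of
  \<open>T\<close>.\<close>

lemma cost_graph_T:
  "(LINT x:X|\<mu>. c x (T x)) = (LINT x:closure X|\<mu>. w x) - (LINT y:closure Y|\<nu>\<^sub>T. F y)"
proof -
  note iw = integrable_w and iF = integrable_T[OF F_continuous]
  have "(LINT x:X|\<mu>. c x (T x)) = (LINT x|\<mu>. indicator X x *\<^sub>R (indicator (closure X) x *\<^sub>R w x - F (T x)))"
    unfolding set_lebesgue_integral_def
    using w_T X_closure by (intro Bochner_Integration.integral_cong refl) (auto simp: indicator_def)
  also have "\<dots> = (LINT x|\<mu>. indicator (closure X) x *\<^sub>R w x - F (T x))"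
  proof (rule integral_cong_AE)
    show "(\<lambda>x. indicator (closure X) x *\<^sub>R w x - F (T x)) \<in> borel_measurable \<mu>"
      by (rule borel_measurable_diff[OF borel_measurable_integrable[OF iw] borel_measurable_integrable[OF iF]])
    then show "(\<lambda>x. indicator X x *\<^sub>R (indicator (closure X) x *\<^sub>R w x - F (T x))) \<in> borel_measurable \<mu>"
      using borel_open[OF X(1)] prob_onD(2)[OF \<mu>] by (intro borel_measurable_scaleR borel_measurable_indicator) auto
    show "AE x in \<mu>. indicator X x *\<^sub>R (indicator (closure X) x *\<^sub>R w x - F (T x)) = indicator (closure X) x *\<^sub>R w x - F (T x)"
      using AE_prob_on[OF \<mu>] by eventually_elim simp
  qed
  also have "\<dots> = (LINT x:closure X|\<mu>. w x) - (LINT x|\<mu>. F (T x))"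
    using iw iF by (simp add: set_lebesgue_integral_def)
  finally show ?thesis by (simp add: integral_\<nu>\<^sub>T[OF F_continuous])
qed

text \<open>Convexity of the transport cost, realized on couplings: mixing an arbitrary
  \<open>\<gamma>\<close> with the graph of \<open>T\<close> gives a coupling for the mixed second
  marginal, with a cost that is affine in \<open>t\<close>.\<close>

lemma mixture_competitor:
  assumes \<gamma>: "\<gamma> \<in> couplings \<mu> \<nu>" and t: "0 \<le> t" "t \<le> 1"
  obtains \<eta> N where "\<eta> \<in> couplings \<mu> N" "N \<in> prob_on (closure Y)"
    "cost \<eta> = t * (LINT x:X|\<mu>. c x (T x)) + (1 - t) * cost \<gamma>"
    "\<And>f. continuous_on (closure Y) f \<Longrightarrow>
      (LINT y:closure Y|N. f y) = t * (LINT y:closure Y|\<nu>\<^sub>T. f y) + (1 - t) * (LINT y:closure Y|\<nu>. f y)"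
proof -
  note \<gamma>D = couplingsD[OF \<gamma>]
  note m = measurable_of_borel[OF \<gamma>D(2)]
  obtain \<eta> where \<eta>: "prob_space \<eta>" "sets \<eta> = sets borel" "distr \<eta> borel fst = distr \<gamma> borel fst"
    and mix: "\<And>f B. f \<in> borel_measurable borel \<Longrightarrow> (\<And>p. \<bar>f p\<bar> \<le> (B::real)) \<Longrightarrow>
       (LINT p|\<eta>. f p) = t * (LINT p|\<gamma>. f (fst p, T (fst p))) + (1 - t) * (LINT p|\<gamma>. f p)"
  proof (rule mixture_with_graph[OF \<gamma>D(1,2) T_measurable t])
    fix \<eta> assume "prob_space \<eta>" "sets \<eta> = sets borel" "distr \<eta> borel fst = distr \<gamma> borel fst"
      and "\<And>f B. f \<in> borel_measurable borel \<Longrightarrow> (\<And>p. \<bar>f p\<bar> \<le> (B::real)) \<Longrightarrow>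
       (LINT p|\<eta>. f p) = t * (LINT p|\<gamma>. f (fst p, T (fst p))) + (1 - t) * (LINT p|\<gamma>. f p)"
    then show thesis by (rule that)
  qed
  interpret \<eta>: prob_space \<eta> by (rule \<eta>)
  interpret \<gamma>: prob_space \<gamma> by (rule \<gamma>D)
  define N where "N = distr \<eta> borel snd"
  have \<eta>snd: "snd \<in> borel_measurable \<eta>"
    using measurable_of_borel[OF \<eta>(2) borel_measurable_fst_snd(2)] .
  have graph: "(\<lambda>x. (x, T x)) \<in> borel_measurable \<mu>"
    by (rule borel_measurable_Pair[OF measurable_ident_sets[OF prob_onD(2)[OF \<mu>]] T_measurable_\<mu>])
  have mix': "(LINT p|\<eta>. f p) = t * (LINT x|\<mu>. f (x, T x)) + (1 - t) * (LINT p|\<gamma>. f p)"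
    if f: "f \<in> borel_measurable borel" "\<And>p. \<bar>f p\<bar> \<le> (B::real)" for f B
  proof -
    have "(\<lambda>x. f (x, T x)) \<in> borel_measurable borel"
      by (rule measurable_compose[OF borel_measurable_Pair[OF measurable_ident_sets[OF refl] T_measurable] f(1)])
    from integral_distr[OF m[OF borel_measurable_fst_snd(1)] this] show ?thesis
      unfolding mix[OF f] \<gamma>D(3) by simp
  qed
  have int: "(LINT y|N. f y) = t * (LINT y|\<nu>\<^sub>T. f y) + (1 - t) * (LINT y|\<nu>. f y)"
    if f: "f \<in> borel_measurable borel" "\<And>p. \<bar>f p\<bar> \<le> (B::real)" for f B
  proof -
    have "(LINT y|N. f y) = (LINT p|\<eta>. f (snd p))"
      unfolding N_def by (rule integral_distr[OF \<eta>snd f(1)])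
    also have "\<dots> = t * (LINT x|\<mu>. f (snd (x, T x))) + (1 - t) * (LINT p|\<gamma>. f (snd p))"
      by (rule mix') (use f measurable_compose[OF borel_measurable_fst_snd(2)] in auto)
    also have "(LINT x|\<mu>. f (snd (x, T x))) = (LINT y|\<nu>\<^sub>T. f y)"
      unfolding \<nu>\<^sub>T_def by (simp add: integral_distr[OF T_measurable_\<mu> f(1)])
    also have "(LINT p|\<gamma>. f (snd p)) = (LINT y|\<nu>. f y)"
      unfolding \<gamma>D(4)[symmetric] by (rule integral_distr[OF m[OF borel_measurable_fst_snd(2)] f(1), symmetric])
    finally show ?thesis .
  qed
  show thesis
  proof (rule that)
    show "\<eta> \<in> couplings \<mu> N"
      using \<eta> \<gamma>D(3) by (simp add: couplings_def N_def)
    have N: "prob_space N" "sets N = sets borel"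
      unfolding N_def using \<eta>.prob_space_distr[OF \<eta>snd] by simp_all
    have "(LINT y|N. indicator (closure Y) y) = t * (LINT y|\<nu>\<^sub>T. indicator (closure Y) y) +
        (1 - t) * (LINT y|\<nu>. indicator (closure Y) y :: real)"
    proof (rule int[of _ 1])
      show "(indicator (closure Y) :: _ \<Rightarrow> real) \<in> borel_measurable borel"
        by (rule borel_measurable_indicator) simp
    qed (simp add: indicator_def)
    then have "measure N (closure Y) = 1"
      using prob_onD[OF \<nu>] prob_onD[OF \<nu>\<^sub>T_prob] N by (simp add: measure_def)
    then show "N \<in> prob_on (closure Y)"
      using N prob_space.finite_measure[OF N(1)] by (simp add: prob_on_def finite_measure.emeasure_eq_measure)
    define c0 where "c0 = (\<lambda>p. indicator (closure X \<times> closure Y) p *\<^sub>R c (fst p) (snd p))"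
    obtain B where B: "c0 \<in> borel_measurable borel" "\<And>p. \<bar>c0 p\<bar> \<le> B"
      using compact_extension[OF compact_Times[OF compact_closures] c_continuous'] unfolding c0_def by metis
    have "(LINT x|\<mu>. c0 (x, T x)) = cost (distr \<mu> borel (\<lambda>x. (x, T x)))"
      unfolding set_lebesgue_integral_def c0_def[symmetric] by (rule integral_distr[OF graph B(1), symmetric])
    also have "\<dots> = (LINT x:X|\<mu>. c x (T x))"
      by (rule cost_graph[OF T_measurable_\<mu>]) (use T_in_closure in blast)
    finally show "cost \<eta> = t * (LINT x:X|\<mu>. c x (T x)) + (1 - t) * cost \<gamma>"
      using mix'[OF B] by (simp add: set_lebesgue_integral_def c0_def)
    fix f :: "real ^ 'n \<Rightarrow> real" assume "continuous_on (closure Y) f"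
    then obtain B where "(\<lambda>x. indicator (closure Y) x *\<^sub>R f x) \<in> borel_measurable borel"
      "\<And>x. \<bar>indicator (closure Y) x *\<^sub>R f x\<bar> \<le> B"
      using compact_extension[OF compact_closures(2)] by metis
    from int[OF this]
    show "(LINT y:closure Y|N. f y) = t * (LINT y:closure Y|\<nu>\<^sub>T. f y) + (1 - t) * (LINT y:closure Y|\<nu>. f y)"
      unfolding set_lebesgue_integral_def .
  qed
qed

text \<open>Fubini and the symmetry of \<open>W\<close>. It identifies the two cross terms in the
  expansion of the interaction energy at a mixture.\<close>

lemma interaction_sym:
  assumes M: "M \<in> prob_on (closure Y)" and N: "N \<in> prob_on (closure Y)"
  shows "(LINT y:closure Y|M. LINT z:closure Y|N. W y z) = (LINT y:closure Y|N. LINT z:closure Y|M. W y z)"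
proof -
  interpret M: prob_space M by (rule prob_onD[OF M])
  interpret N: prob_space N by (rule prob_onD[OF N])
  interpret P: pair_prob_space M N ..
  define W0 where "W0 = (\<lambda>p. indicator (closure Y \<times> closure Y) p *\<^sub>R (\<lambda>(y, z). W y z) p)"
  obtain B where B: "W0 \<in> borel_measurable borel" "\<And>p. \<bar>W0 p\<bar> \<le> B"
    using compact_extension[OF compact_Times[OF compact_closures(2,2)] W_continuous] unfolding W0_def by metis
  have "sets (M \<Otimes>\<^sub>M N) = sets borel"
    using sets_pair_measure_cong[OF prob_onD(2)[OF M] prob_onD(2)[OF N]] by (simp only: borel_prod)
  from measurable_of_borel[OF this B(1)] have "integrable (M \<Otimes>\<^sub>M N) W0"
    using B(2) by (intro P.integrable_const_bound[where B = B]) auto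
  then have int: "integrable (M \<Otimes>\<^sub>M N) (case_prod (\<lambda>y z. W0 (y, z)))"
    by (simp add: case_prod_unfold)
  have iter: "(LINT y:closure Y|M'. LINT z:closure Y|N'. W y z) = (LINT y|M'. LINT z|N'. W0 (y, z))" for M' N'
    unfolding set_lebesgue_integral_def W0_def
    by (rule Bochner_Integration.integral_cong[OF refl]) (auto simp: indicator_def intro!: Bochner_Integration.integral_cong)
  have sym: "W0 (y, z) = W0 (z, y)" for y z
    using W_sym by (auto simp: W0_def indicator_def)
  show ?thesis
    unfolding iter using P.Fubini_integral[OF int] sym by simp
qed

text \<open>Comparing \<open>\<nu>\<close> with the mixtures \<open>(1 - t) \<nu> + t \<nu>\<^sub>T\<close> and letting \<open>t\<close> tend to \<open>0\<close> shows that
  \<open>\<nu>\<close> also minimizes the energy linearized at \<open>\<nu>\<close>, whose minimum is the integral of \<open>w\<close>.\<close>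

lemma linearized_minimality:
  "transport_cost c X Y \<mu> \<nu> + (LINT y:closure Y|\<nu>. F y) \<le> (LINT x:closure X|\<mu>. w x)"
proof -
  let ?K = "closure Y"
  define U where "U = (\<lambda>M y. LINT z:?K|M. W y z)"
  define A where "A = (LINT x:X|\<mu>. c x (T x))"
  define \<tau> where "\<tau> = transport_cost c X Y \<mu> \<nu>"
  define V0 where "V0 = (LINT y:?K|\<nu>. V y)"
  define V1 where "V1 = (LINT y:?K|\<nu>\<^sub>T. V y)"
  define J00 where "J00 = (LINT y:?K|\<nu>. U \<nu> y)"
  define J10 where "J10 = (LINT y:?K|\<nu>\<^sub>T. U \<nu> y)"
  define J11 where "J11 = (LINT y:?K|\<nu>\<^sub>T. U \<nu>\<^sub>T y)"
  have J01: "(LINT y:?K|\<nu>. U \<nu>\<^sub>T y) = J10"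
    unfolding J10_def U_def by (rule interaction_sym[OF \<nu> \<nu>\<^sub>T_prob])
  have fin: "finite_measure M" if "M \<in> prob_on ?K" for M :: "(real ^ 'n) measure"
    using prob_onD(1)[OF that] by (rule prob_space.finite_measure)
  have contU: "continuous_on ?K (U M)" if "M \<in> prob_on ?K" for M
    using continuous_on_parameter_integral[OF fin[OF that] prob_onD(2)[OF that] compact_closures(2,2) W_continuous]
    by (simp add: U_def)
  have int: "set_integrable M ?K f" if "M \<in> prob_on ?K" "continuous_on ?K f"
    for M :: "(real ^ 'n) measure" and f :: "real ^ 'n \<Rightarrow> real"
    by (rule set_integrable_compact[OF fin prob_onD(2) compact_closures(2)]) (use that in auto)
  \<comment> \<open>The energy inequality at the mixture, divided by \<open>t\<close>. The
    coefficient of the remaining \<open>t\<close> is half the interaction of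
    \<open>\<nu>\<^sub>T - \<nu>\<close> with itself; its sign is unknown, but its contribution
    disappears as \<open>t\<close> tends to 0.\<close>
  have step: "\<tau> + V0 + J00 \<le> (A + V1 + J10) + t * (J00 / 2 + J11 / 2 - J10)" if t: "0 < t" "t < 1" for t
  proof -
    \<comment> \<open>Arranged so that only the right-hand side depends on \<open>\<gamma>\<close>:
      after division by \<open>1 - t\<close>, the left-hand side is a common lower bound for all
      costs and hence for \<open>\<tau>\<close>.\<close>
    have "\<tau> + V0 + 1 / 2 * J00 - (t * A + (t * V1 + (1 - t) * V0) +
        1 / 2 * (t * (t * J11 + (1 - t) * J10) + (1 - t) * (t * J10 + (1 - t) * J00))) \<le> (1 - t) * cost \<gamma>"
      if \<gamma>: "\<gamma> \<in> couplings \<mu> \<nu>" for \<gamma>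
    proof -
      obtain \<eta> N where \<eta>: "\<eta> \<in> couplings \<mu> N" and N: "N \<in> prob_on ?K"
        and cost: "cost \<eta> = t * (LINT x:X|\<mu>. c x (T x)) + (1 - t) * cost \<gamma>"
        and mix: "\<And>f. continuous_on ?K f \<Longrightarrow>
          (LINT y:?K|N. f y) = t * (LINT y:?K|\<nu>\<^sub>T. f y) + (1 - t) * (LINT y:?K|\<nu>. f y)"
        by (rule mixture_competitor[OF \<gamma>, of t]) (use t in auto)
      have UN: "U N y = t * U \<nu>\<^sub>T y + (1 - t) * U \<nu> y" if "y \<in> ?K" for y
        unfolding U_def by (rule mix) (use continuous_on_Pair_slice[OF W_continuous that] in simp)
      have inner: "(LINT y:?K|M. t * U \<nu>\<^sub>T y + (1 - t) * U \<nu> y) =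
          t * (LINT y:?K|M. U \<nu>\<^sub>T y) + (1 - t) * (LINT y:?K|M. U \<nu> y)" if M: "M \<in> prob_on ?K" for M
      proof -
        have "(LINT y:?K|M. t * U \<nu>\<^sub>T y + (1 - t) * U \<nu> y) =
            (LINT y:?K|M. t * U \<nu>\<^sub>T y) + (LINT y:?K|M. (1 - t) * U \<nu> y)"
          by (intro set_integral_add int[OF M] continuous_on_mult_left contU \<nu> \<nu>\<^sub>T_prob)
        then show ?thesis by simp
      qed
      have "(LINT y:?K|N. U N y) = (LINT y:?K|N. t * U \<nu>\<^sub>T y + (1 - t) * U \<nu> y)"
        using UN prob_onD(2)[OF N] by (intro set_lebesgue_integral_cong) auto
      also have "\<dots> = t * (t * J11 + (1 - t) * J10) + (1 - t) * (t * J10 + (1 - t) * J00)"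
        unfolding inner[OF N] mix[OF contU[OF \<nu>]] mix[OF contU[OF \<nu>\<^sub>T_prob]] J01
        by (simp add: J00_def J10_def J11_def algebra_simps)
      finally have UNN: "(LINT y:?K|N. U N y) = t * (t * J11 + (1 - t) * J10) + (1 - t) * (t * J10 + (1 - t) * J00)" .
      have "energy c V W X Y \<mu> \<nu> \<le> energy c V W X Y \<mu> N"
        by (rule minimizer[OF N])
      moreover have "energy c V W X Y \<mu> \<nu> = \<tau> + V0 + 1 / 2 * J00"
        by (simp add: energy_def \<tau>_def V0_def J00_def U_def)
      moreover have "energy c V W X Y \<mu> N = transport_cost c X Y \<mu> N + (t * V1 + (1 - t) * V0) +
          1 / 2 * (t * (t * J11 + (1 - t) * J10) + (1 - t) * (t * J10 + (1 - t) * J00))"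
        unfolding energy_def UNN[symmetric] V0_def V1_def mix[OF V_continuous] by (simp add: U_def)
      moreover have "transport_cost c X Y \<mu> N \<le> t * A + (1 - t) * cost \<gamma>"
        using transport_cost_le[OF \<eta> N] cost by (simp add: A_def)
      ultimately show ?thesis by linarith
    qed
    then have "(\<tau> + V0 + 1 / 2 * J00 - (t * A + (t * V1 + (1 - t) * V0) +
        1 / 2 * (t * (t * J11 + (1 - t) * J10) + (1 - t) * (t * J10 + (1 - t) * J00)))) / (1 - t) \<le> \<tau>"
      unfolding \<tau>_def using t by (intro transport_cost_greatest[OF \<nu>]) (simp add: pos_divide_le_eq mult.commute)
    then have "\<tau> + V0 + 1 / 2 * J00 - (t * A + (t * V1 + (1 - t) * V0) +
        1 / 2 * (t * (t * J11 + (1 - t) * J10) + (1 - t) * (t * J10 + (1 - t) * J00))) \<le> \<tau> * (1 - t)"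
      using t by (simp add: pos_divide_le_eq)
    then have "t * (\<tau> + V0 + J00) \<le> t * ((A + V1 + J10) + t * (J00 / 2 + J11 / 2 - J10))"
      by (simp add: algebra_simps)
    then show ?thesis using t(1) by simp
  qed
  have "\<tau> + V0 + J00 \<le> A + V1 + J10"
    by (rule le_of_small_perturbation[OF step])
  moreover have "(LINT y:?K|M. F y) = (LINT y:?K|M. V y) + (LINT y:?K|M. U \<nu> y)" if "M \<in> prob_on ?K" for M
  proof -
    have "F = (\<lambda>y. V y + U \<nu> y)" by (simp add: F_def U_def fun_eq_iff)
    then show ?thesis
      using set_integral_add(2)[OF int[OF that V_continuous] int[OF that contU[OF \<nu>]]] by simp
  qed
  ultimately show ?thesis
    using cost_graph_T \<nu> \<nu>\<^sub>T_prob by (simp add: \<tau>_def V0_def V1_def J00_def J10_def A_def)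
qed

lemma transport_cost_eq:
  "transport_cost c X Y \<mu> \<nu> = (LINT x:closure X|\<mu>. w x) - (LINT y:closure Y|\<nu>. F y)"
  using linearized_minimality transport_cost_greatest[OF \<nu> cost_lower_bound[OF _ \<nu>]] by simp

text \<open>Nearly optimal couplings are concentrated near the graph of \<open>T\<close>, by strong convexity; no
  compactness of the set of couplings is needed.\<close>

lemma \<nu>_eq: "\<nu> = \<nu>\<^sub>T"
proof (rule measure_eq_of_close_couplings)
  show "finite_measure \<nu>" "sets \<nu> = sets borel" by (fact \<nu>_finite)+
  show "finite_measure \<nu>\<^sub>T" "sets \<nu>\<^sub>T = sets borel"
    using \<nu>\<^sub>T_prob by (auto simp: prob_on_def prob_space.finite_measure)
  fix e :: real assume e: "0 < e"
  \<comment> \<open>The tolerance for the cost: the factor \<open>C / 2\<close> cancels against the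
    gap estimate, and Markov's inequality at level \<open>e\<^sup>2\<close> reduces the cube to
    \<open>e\<close>.\<close>
  then have "0 < C / 2 * e ^ 3" using C by simp
  from transport_cost_approx[OF \<nu> this] obtain \<gamma> where \<gamma>: "\<gamma> \<in> couplings \<mu> \<nu>"
    "cost \<gamma> < transport_cost c X Y \<mu> \<nu> + C / 2 * e ^ 3" by blast
  note \<gamma>D = couplingsD[OF \<gamma>(1)]
  note gap = coupling_gap[OF \<gamma>(1) \<nu>]
  have "C / 2 * (LINT p|\<gamma>. (norm (snd p - T (fst p)))\<^sup>2) \<le> C / 2 * e ^ 3"
    using gap(2) \<gamma>(2) transport_cost_eq by linarith
  then have le: "(LINT p|\<gamma>. (norm (snd p - T (fst p)))\<^sup>2) \<le> e ^ 3"
    using C by simp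
  have "measure \<gamma> {p \<in> space \<gamma>. e \<le> dist (snd p) (T (fst p))} =
      measure \<gamma> {p \<in> space \<gamma>. e\<^sup>2 \<le> (norm (snd p - T (fst p)))\<^sup>2}"
    using e by (intro arg_cong[where f = "measure \<gamma>"]) (auto simp: dist_norm power_mono_iff)
  also have "\<dots> \<le> (LINT p|\<gamma>. (norm (snd p - T (fst p)))\<^sup>2) / e\<^sup>2"
    by (rule integral_Markov_inequality_measure[OF gap(1) sets.top]) (use e in auto)
  also have "\<dots> \<le> e ^ 3 / e\<^sup>2"
    using le by (rule divide_right_mono) simp
  also have "\<dots> = e" using e by (simp add: power2_eq_square power3_eq_cube)
  finally have m: "measure \<gamma> {p \<in> space \<gamma>. e \<le> dist (snd p) (T (fst p))} \<le> e" .
  note fst = measurable_of_borel[OF \<gamma>D(2) borel_measurable_fst_snd(1)]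
  have "distr \<gamma> borel (\<lambda>p. T (fst p)) = \<nu>\<^sub>T"
    using distr_distr[OF T_measurable fst] by (simp add: \<gamma>D(3) \<nu>\<^sub>T_def comp_def)
  then show "\<exists>(\<gamma>::((real ^ 'm) \<times> (real ^ 'n)) measure) f g. prob_space \<gamma> \<and> f \<in> borel_measurable \<gamma> \<and> g \<in> borel_measurable \<gamma> \<and>
      distr \<gamma> borel f = \<nu> \<and> distr \<gamma> borel g = \<nu>\<^sub>T \<and> measure \<gamma> {p \<in> space \<gamma>. e \<le> dist (f p) (g p)} \<le> e"
    using \<gamma>D m measurable_of_borel[OF \<gamma>D(2) borel_measurable_fst_snd(2)] measurable_compose[OF fst T_measurable]
    by (intro exI[of _ \<gamma>] exI[of _ snd] exI[of _ "\<lambda>p. T (fst p)"] conjI) assumption+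
qed

lemma optimal_map_T: "optimal_map c X Y \<mu> \<nu> T"
  unfolding optimal_map_def
  using T_measurable_\<mu> T_in_closure \<nu>_eq cost_graph_T transport_cost_eq by (auto simp: \<nu>\<^sub>T_def)

text \<open>The graph of an optimal \<open>S\<close> is a coupling of minimal cost, for which the
  integrated squared distance to the graph of \<open>T\<close> must vanish.\<close>

lemma optimal_map_unique:
  assumes "optimal_map c X Y \<mu> \<nu> S"
  shows "AE x in \<mu>. S x = T x"
proof -
  have S: "S \<in> borel_measurable \<mu>" "S ` X \<subseteq> closure Y" "distr \<mu> borel S = \<nu>"
    "(LINT x:X|\<mu>. c x (S x)) = transport_cost c X Y \<mu> \<nu>"
    using assms by (auto simp: optimal_map_def)
  let ?\<gamma> = "distr \<mu> borel (\<lambda>x. (x, S x))"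
  have \<gamma>: "?\<gamma> \<in> couplings \<mu> \<nu>"
    using graph_coupling[OF prob_onD(1,2)[OF \<mu>] S(1)] S(3) by simp
  note gap = coupling_gap[OF \<gamma> \<nu>]
  have "cost ?\<gamma> = transport_cost c X Y \<mu> \<nu>"
    using cost_graph[OF S(1,2)] S(4) by simp
  then have "C / 2 * (LINT p|?\<gamma>. (norm (snd p - T (fst p)))\<^sup>2) \<le> 0"
    using gap(2) transport_cost_eq by linarith
  then have "(LINT p|?\<gamma>. (norm (snd p - T (fst p)))\<^sup>2) \<le> 0"
    using C by (simp add: mult_le_0_iff)
  moreover have "0 \<le> (LINT p|?\<gamma>. (norm (snd p - T (fst p)))\<^sup>2)"
    by (rule Bochner_Integration.integral_nonneg) simp
  ultimately have "(LINT p|?\<gamma>. (norm (snd p - T (fst p)))\<^sup>2) = 0" by (rule antisym)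
  then have "AE p in ?\<gamma>. (norm (snd p - T (fst p)))\<^sup>2 = 0"
    using integral_nonneg_eq_0_iff_AE[OF gap(1)] by simp
  moreover have "(\<lambda>x. (x, S x)) \<in> borel_measurable \<mu>"
    by (rule borel_measurable_Pair[OF measurable_ident_sets[OF prob_onD(2)[OF \<mu>]] S(1)])
  ultimately have "AE x in \<mu>. (norm (snd (x, S x) - T (fst (x, S x))))\<^sup>2 = 0"
    by (rule AE_distrD[rotated])
  then show ?thesis by eventually_elim simp
qed

end

section \<open>Potentials and nestedness\<close>

lemma has_derivative_squeeze:
  fixes f g k :: "'a::real_normed_vector \<Rightarrow> real"
  assumes f: "(f has_derivative D) (at y within S)" and g: "(g has_derivative D) (at y within S)"
    and eq: "f y = k y" "g y = k y" and le: "\<And>z. z \<in> S \<Longrightarrow> f z \<le> k z" "\<And>z. z \<in> S \<Longrightarrow> k z \<le> g z"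
  shows "(k has_derivative D) (at y within S)"
  unfolding has_derivative_within_alt
proof (intro conjI allI impI)
  show "bounded_linear D" using f by (rule has_derivative_bounded_linear)
  fix e :: real assume "0 < e"
  obtain d1 where d1: "d1 > 0" "\<And>z. z \<in> S \<Longrightarrow> norm (z - y) < d1 \<Longrightarrow> norm (f z - f y - D (z - y)) \<le> e * norm (z - y)"
    using f \<open>0 < e\<close> unfolding has_derivative_within_alt by blast
  obtain d2 where d2: "d2 > 0" "\<And>z. z \<in> S \<Longrightarrow> norm (z - y) < d2 \<Longrightarrow> norm (g z - g y - D (z - y)) \<le> e * norm (z - y)"
    using g \<open>0 < e\<close> unfolding has_derivative_within_alt by blast
  have "norm (k z - k y - D (z - y)) \<le> e * norm (z - y)" if z: "z \<in> S" "norm (z - y) < min d1 d2" for z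
  proof -
    have "\<bar>f z - f y - D (z - y)\<bar> \<le> e * norm (z - y)" "\<bar>g z - g y - D (z - y)\<bar> \<le> e * norm (z - y)"
      using d1(2)[of z] d2(2)[of z] z by simp_all
    then show ?thesis using le[OF z(1)] eq by (simp add: abs_le_iff)
  qed
  then show "\<exists>d>0. \<forall>z\<in>S. norm (z - y) < d \<longrightarrow> norm (k z - k y - D (z - y)) \<le> e * norm (z - y)"
    using d1(1) d2(1) by (intro exI[of _ "min d1 d2"]) auto
qed

text \<open>Translates between gradients extended as vectors by \<open>cont_ext\<close> and
  directional derivatives extended one direction at a time. The components of the gradient in the
  basis are such derivatives, so both extensions have the same limits.\<close>

lemma cont_ext_inner:
  fixes d :: "'a::euclidean_space \<Rightarrow> 'b::euclidean_space"
  assumes U: "open U" "U \<subseteq> S" "S \<subseteq> closure U" and d: "\<And>q h. q \<in> U \<Longrightarrow> d q \<bullet> h = D q h"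
    and cont: "\<And>h. continuous_on S (\<lambda>q. D q h)" and p: "p \<in> S"
  shows "cont_ext U d p \<bullet> h = D p h"
proof -
  define g where "g = (\<lambda>q. \<Sum>b\<in>Basis. D q b *\<^sub>R b)"
  have contg: "continuous_on S g"
    unfolding g_def by (intro continuous_intros cont)
  have dg: "d q = g q" if "q \<in> U" for q
    using d[OF that] by (simp add: g_def euclidean_representation flip: d[OF that])
  have "(g \<longlongrightarrow> g p) (at p within U)"
    using contg p U(2) by (metis continuous_on_def tendsto_within_subset)
  then have "(d \<longlongrightarrow> g p) (at p within U)"
    by (rule Lim_transform_eventually) (simp add: eventually_at_filter dg)
  \<comment> \<open>\<open>cont_ext\<close> is defined through \<open>Lim\<close>, whose value is
    determined only when the filter is nontrivial.\<close>
  moreover have "p islimpt U"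
  proof (cases "p \<in> U")
    case True
    then show ?thesis using U(1) by (metis islimpt_UNIV at_within_open trivial_limit_within)
  next
    case False
    then show ?thesis using p U(3) by (auto simp: closure_def)
  qed
  then have "at p within U \<noteq> bot"
    by (simp add: trivial_limit_within)
  ultimately have ext: "cont_ext U d p = g p"
    unfolding cont_ext_def by (intro tendsto_Lim)
  have "D p h = (\<Sum>b\<in>Basis. D p b * (b \<bullet> h))"
  proof (rule closure_eq[OF cont _ U(2,3) _ p])
    show "continuous_on S (\<lambda>q. \<Sum>b\<in>Basis. D q b * (b \<bullet> h))" by (intro continuous_intros cont)
    fix q assume "q \<in> U"
    then show "D q h = (\<Sum>b\<in>Basis. D q b * (b \<bullet> h))"
      using euclidean_inner[of "d q" h] d[OF \<open>q \<in> U\<close>] by (simp add: inner_commute[of h])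
  qed
  then show ?thesis
    unfolding ext g_def by (simp add: inner_sum_left)
qed

lemma grad_fst:
  assumes "((\<lambda>(x, y). f x y) has_derivative f') (at (x, y))"
  shows "grad (\<lambda>x. f x y) x \<bullet> h = f' (h, 0)"
proof (rule grad_has_derivative)
  have "((\<lambda>x. (\<lambda>(x, y). f x y) (x, y)) has_derivative (\<lambda>h. f' (h, 0))) (at x)"
    by (rule has_derivative_compose[where f = "\<lambda>x. (x, y)", OF has_derivative_Pair[OF has_derivative_ident has_derivative_const] assms])
  then show "((\<lambda>x. f x y) has_derivative (\<lambda>h. f' (h, 0))) (at x)" by simp
qed

lemma grad_snd:
  assumes "((\<lambda>(x, y). f x y) has_derivative f') (at (x, y))"
  shows "grad (f x) y \<bullet> h = f' (0, h)"
proof (rule grad_has_derivative)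
  have "((\<lambda>y. (\<lambda>(x, y). f x y) (x, y)) has_derivative (\<lambda>h. f' (0, h))) (at y)"
    by (rule has_derivative_compose[where f = "Pair x", OF has_derivative_Pair[OF has_derivative_const has_derivative_ident] assms])
  then show "(f x has_derivative (\<lambda>h. f' (0, h))) (at y)" by simp
qed

section \<open>The dual pair \<open>(w, v)\<close> and its contact sets\<close>

context equilibrium
begin

lemma D_y_extension:
  assumes "x \<in> X" "y \<in> closure Y"
  shows "cont_ext (X \<times> Y) (\<lambda>(x, y). D_y c x y) (x, y) \<bullet> h = c' (x, y) (0, h)"
proof (rule cont_ext_inner[where S = "X \<times> closure Y"])
  show "open (X \<times> Y)" using X Y by (intro open_Times)
  show "(\<lambda>(x, y). D_y c x y) q \<bullet> h = c' q (0, h)" if "q \<in> X \<times> Y" for q h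
    using grad_snd[of c "c' q" "fst q" "snd q"] c_derivative[OF that]
    by (simp add: D_y_def case_prod_unfold)
  show "continuous_on (X \<times> closure Y) (\<lambda>q. c' q (0, h))" for h
    by (rule continuous_on_subset[OF c'_continuous Times_subset(3)])
qed (use Times_subset assms in auto)

text \<open>The c-transform of \<open>w\<close>, hence the double c-transform of \<open>- F\<close>.
  This is why it lies above \<open>- F\<close>, with equality where \<open>- F\<close> is in contact
  with some \<open>c x - w x\<close>.\<close>

definition v :: "real ^ 'n \<Rightarrow> real" where
  "v y = (INF x\<in>closure X. c x y - w x)"

lemma X_nonempty: "X \<noteq> {}"
  using \<mu> by (auto simp: prob_on_def)

lemma continuous_on_c_minus_w: "y \<in> closure Y \<Longrightarrow> continuous_on (closure X) (\<lambda>x. c x y - w x)"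
proof (intro continuous_on_diff continuous_on_w)
  assume "y \<in> closure Y"
  then have "continuous_on (closure X) (\<lambda>x. (\<lambda>(x, y). c x y) (x, y))"
    by (intro continuous_on_compose2[OF c_continuous]) (auto intro!: continuous_intros)
  then show "continuous_on (closure X) (\<lambda>x. c x y)" by simp
qed

lemma v_attained:
  assumes "y \<in> closure Y"
  obtains x where "x \<in> closure X" "v y = c x y - w x"
proof -
  obtain x where x: "x \<in> closure X" "\<And>z. z \<in> closure X \<Longrightarrow> c x y - w x \<le> c z y - w z"
    using continuous_attains_inf[OF compact_closures(1) _ continuous_on_c_minus_w[OF assms]] X_nonempty by auto
  then have "v y = c x y - w x"
    unfolding v_def by (intro cInf_eq_minimum) auto
  with x(1) show thesis by (rule that)
qed

lemma v_le:
  assumes "x \<in> closure X" "y \<in> closure Y"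
  shows "v y \<le> c x y - w x"
proof -
  have "compact ((\<lambda>x. c x y - w x) ` closure X)"
    by (rule compact_continuous_image[OF continuous_on_c_minus_w[OF assms(2)] compact_closures(1)])
  then have "bdd_below ((\<lambda>x. c x y - w x) ` closure X)"
    by (intro bounded_imp_bdd_below compact_imp_bounded)
  then show ?thesis
    unfolding v_def using assms(1) by (rule cINF_lower)
qed

lemma v_ge:
  assumes "y \<in> closure Y"
  shows "- F y \<le> v y"
proof -
  obtain x where x: "x \<in> closure X" "v y = c x y - w x" using v_attained[OF assms] .
  then show ?thesis using w_le[OF x(1) assms] by simp
qed

lemma v_T:
  assumes "x \<in> X"
  shows "v (T x) = - F (T x)"
  using v_ge[OF T_in_closure[of x]] v_le[OF X_closure[OF assms] T_in_closure[of x]] w_T[OF assms] by simp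

lemma continuous_on_v: "continuous_on (closure Y) v"
proof (rule continuous_on_inf_transform[OF compact_closures(2,1), where k = "\<lambda>y x. c x y" and g = "\<lambda>x. - w x"])
  have "continuous_on (closure Y \<times> closure X) (\<lambda>p. (\<lambda>(x, y). c x y) (snd p, fst p))"
    by (rule continuous_on_compose2[OF c_continuous]) (auto intro!: continuous_intros)
  then show "continuous_on (closure Y \<times> closure X) (\<lambda>(y, x). c x y)"
    by (simp add: case_prod_unfold)
  show "\<exists>x\<in>closure X. v y = c x y + - w x" if "y \<in> closure Y" for y
    using v_attained[OF that] by (metis add_uminus_conv_diff)
qed (use v_le in fastforce)

text \<open>A third transform gives nothing new: since \<open>v\<close> lies between
  \<open>- F\<close> and \<open>c x - w x\<close>, a point where \<open>c x + F\<close> attains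
  \<open>w x\<close> is also one where \<open>c x - v\<close> attains it.\<close>

lemma c_concave_w_v: "c_concave_pair c X Y w v"
  unfolding c_concave_pair_def is_minimum_def
proof (intro conjI ballI)
  fix x assume x: "x \<in> closure X"
  obtain y where y: "y \<in> closure Y" "w x = c x y + F y" using w_attained[OF x] .
  then have "w x = c x y - v y"
    using v_ge[OF y(1)] v_le[OF x y(1)] by simp
  then show "w x \<in> (\<lambda>y. c x y - v y) ` closure Y" using y(1) by blast
  show "w x \<le> b" if "b \<in> (\<lambda>y. c x y - v y) ` closure Y" for b
    using that v_le[OF x] by (force simp: algebra_simps)
next
  fix y assume y: "y \<in> closure Y"
  show "v y \<in> (\<lambda>x. c x y - w x) ` closure X" using v_attained[OF y] by blast
  show "v y \<le> b" if "b \<in> (\<lambda>x. c x y - w x) ` closure X" for b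
    using that v_le[OF _ y] by blast
qed

lemma dual_value_w_v:
  "dual_value X Y \<mu> \<nu> w v = (LINT x:closure X|\<mu>. w x) - (LINT x|\<mu>. F (T x))"
proof -
  have "(LINT y:closure Y|\<nu>. v y) = (LINT x|\<mu>. v (T x))"
    using integral_\<nu>\<^sub>T[OF continuous_on_v] \<nu>_eq by simp
  also have "\<dots> = (LINT x|\<mu>. - F (T x))"
  proof (rule integral_cong_AE)
    show "AE x in \<mu>. v (T x) = - F (T x)"
      using AE_prob_on[OF \<mu>] by eventually_elim (rule v_T)
  qed (use integrable_T[OF continuous_on_v] integrable_T[OF F_continuous] in auto)
  finally show ?thesis by (simp add: dual_value_def)
qed

text \<open>Since \<open>\<nu>\<close> is the image of \<open>\<mu>\<close> under \<open>T\<close>,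
  a dual value is a single integral over \<open>\<mu>\<close> of \<open>u' x + v' (T x)\<close>.
  Admissibility at \<open>(x, T x)\<close> bounds this integrand, and \<open>(w, v)\<close> attains
  the bound pointwise on \<open>X\<close>.\<close>

lemma kantorovich_w_v: "kantorovich_potentials c X Y \<mu> \<nu> w v"
  unfolding kantorovich_potentials_def
proof (intro conjI allI impI c_concave_w_v)
  show "dual_admissible c X Y \<mu> \<nu> w v"
    unfolding dual_admissible_def
  proof (intro conjI ballI)
    show "set_integrable \<mu> (closure X) w" using integrable_w by (simp add: set_integrable_def)
    show "set_integrable \<nu> (closure Y) v"
      by (rule set_integrable_compact[OF \<nu>_finite compact_closures(2) continuous_on_v])
    show "w x + v y \<le> c x y" if "x \<in> closure X" "y \<in> closure Y" for x y
      using v_le[OF that] by simp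
  qed
  fix u' v' assume adm: "dual_admissible c X Y \<mu> \<nu> u' v'"
  define v0 where "v0 = (\<lambda>y. indicator (closure Y) y *\<^sub>R v' y)"
  define u0 where "u0 = (\<lambda>x. indicator (closure X) x *\<^sub>R u' x)"
  have iu: "integrable \<mu> u0" and iv: "integrable \<nu> v0"
    using adm by (simp_all add: dual_admissible_def set_integrable_def u0_def v0_def)
  have v0: "v0 \<in> borel_measurable borel"
    using borel_measurable_integrable[OF iv] measurable_cong_sets[OF \<nu>_finite(2) refl] by blast
  have ivT: "integrable \<mu> (\<lambda>x. v0 (T x))"
    using iv integrable_distr_eq[OF T_measurable_\<mu> v0] \<nu>_eq by (simp add: \<nu>\<^sub>T_def)
  have "(LINT y|\<nu>. v0 y) = (LINT x|\<mu>. v0 (T x))"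
    using integral_distr[OF T_measurable_\<mu> v0] \<nu>_eq by (simp add: \<nu>\<^sub>T_def)
  moreover have "dual_value X Y \<mu> \<nu> u' v' = (LINT x|\<mu>. u0 x) + (LINT y|\<nu>. v0 y)"
    by (simp add: dual_value_def set_lebesgue_integral_def u0_def v0_def)
  ultimately have "dual_value X Y \<mu> \<nu> u' v' = (LINT x|\<mu>. u0 x + v0 (T x))"
    by (simp add: iu ivT)
  also have "\<dots> \<le> (LINT x|\<mu>. indicator (closure X) x *\<^sub>R w x - F (T x))"
  proof (rule integral_mono_AE)
    show "AE x in \<mu>. u0 x + v0 (T x) \<le> indicator (closure X) x *\<^sub>R w x - F (T x)"
      using AE_prob_on[OF \<mu>]
    proof eventually_elim
      case (elim x)
      have "u' x + v' (T x) \<le> c x (T x)"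
        using adm X_closure[OF elim] T_in_closure by (simp add: dual_admissible_def)
      then show ?case using w_T[OF elim] X_closure[OF elim] by (simp add: u0_def v0_def T_in_closure)
    qed
  qed (use iu ivT integrable_w integrable_T[OF F_continuous] in auto)
  also have "\<dots> = dual_value X Y \<mu> \<nu> w v"
    using integrable_w integrable_T[OF F_continuous] by (simp add: dual_value_w_v set_lebesgue_integral_def)
  finally show "dual_value X Y \<mu> \<nu> u' v' \<le> dual_value X Y \<mu> \<nu> w v" .
qed

text \<open>The image of \<open>X\<close> is Borel because \<open>X\<close> is a countable union of
  compact sets and \<open>T\<close> is continuous on it; only then does full measure pass through
  the image measure.\<close>

lemma AE_image_T: "AE y in \<nu>. y \<in> T ` X"
proof -
  obtain K where K: "\<And>n::nat. compact (K n)" "\<And>n. K n \<subseteq> X" "\<Union> (range K) = X"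
    using open_Union_compact_subsets[OF X(1)] by metis
  have "T ` X = (\<Union>n. T ` K n)" using K(3) by blast
  moreover have "T ` K n \<in> sets borel" for n
    using K continuous_on_subset[OF continuous_on_T] by (intro borel_compact compact_continuous_image) auto
  ultimately have "T ` X \<in> sets borel" by auto
  then have "{y \<in> space borel. y \<in> T ` X} \<in> sets borel" by simp
  from AE_distr_iff[OF T_measurable_\<mu> this] have "AE y in distr \<mu> borel T. y \<in> T ` X"
    using AE_prob_on[OF \<mu>] by auto
  then show ?thesis
    unfolding \<nu>\<^sub>T_def[symmetric] \<nu>_eq[symmetric] .
qed

text \<open>At \<open>y = T x0\<close> the potential lies between \<open>- F\<close> and \<open>c x0 - w x0\<close>, which have the same derivative there.\<close>

lemma v_has_derivative:
  assumes "x0 \<in> X"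
  shows "(v has_derivative (\<lambda>h. - F' (T x0) h)) (at (T x0) within closure Y)"
proof (rule has_derivative_squeeze[where f = "\<lambda>y. - F y" and g = "\<lambda>y. c x0 y - w x0"])
  show "((\<lambda>y. - F y) has_derivative (\<lambda>h. - F' (T x0) h)) (at (T x0) within closure Y)"
    by (rule has_derivative_minus[OF F_has_derivative[OF T_in_closure]])
  have "((\<lambda>y. c x0 y - w x0) has_derivative (\<lambda>h. c' (x0, T x0) (0, h) - 0)) (at (T x0) within closure Y)"
    by (intro has_derivative_diff c_has_derivative assms T_in_closure has_derivative_const)
  moreover have "c' (x0, T x0) (0, h) - 0 = - F' (T x0) h" for h
    using critical_T[OF assms, of h] by simp
  ultimately show "((\<lambda>y. c x0 y - w x0) has_derivative (\<lambda>h. - F' (T x0) h)) (at (T x0) within closure Y)"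
    by simp
qed (use assms v_T w_T v_ge v_le[OF X_closure[OF assms]] in auto)

lemma generalized_nestedness_of_unique:
  assumes "unique_potentials c X Y \<mu> \<nu>"
  shows "generalized_nestedness c X Y \<mu> \<nu>"
  unfolding generalized_nestedness_def
proof (intro conjI allI impI)
  show "\<exists>u v. kantorovich_potentials c X Y \<mu> \<nu> u v" using kantorovich_w_v by blast
  fix u' v' assume "kantorovich_potentials c X Y \<mu> \<nu> u' v'"
  \<comment> \<open>The constant cancels in \<open>u' x + v' y\<close> and in the derivative of
    \<open>v'\<close>, so the claim for this pair is the claim for \<open>(w, v)\<close>.\<close>
  then obtain a where a: "\<And>x. x \<in> closure X \<Longrightarrow> u' x = w x + a" "\<And>y. y \<in> closure Y \<Longrightarrow> v' y = v y - a"
    using assms kantorovich_w_v unfolding unique_potentials_def by metis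
  show "AE y in \<nu>. \<exists>p. (v' has_derivative (\<lambda>h. h \<bullet> p)) (at y within closure Y) \<and>
      {x \<in> X. u' x + v' y = c x y} = {x \<in> X. p = cont_ext (X \<times> Y) (\<lambda>(x, y). D_y c x y) (x, y)}"
    using AE_image_T
  proof eventually_elim
    case (elim y)
    then obtain x0 where x0: "x0 \<in> X" "y = T x0" by blast
    have y: "y \<in> closure Y" using x0 T_in_closure by simp
    have lin: "linear (F' y)" using has_derivative_linear[OF F_has_derivative[OF y]] .
    define p where "p = - (\<Sum>b\<in>Basis. F' y b *\<^sub>R b)"
    have p: "h \<bullet> p = - F' y h" for h
    proof -
      have "F' y h = F' y (\<Sum>b\<in>Basis. (h \<bullet> b) *\<^sub>R b)" by (simp only: euclidean_representation)
      also have "\<dots> = (\<Sum>b\<in>Basis. (h \<bullet> b) *\<^sub>R F' y b)"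
        by (simp only: linear_sum[OF lin] linear_scale[OF lin])
      also have "\<dots> = - (h \<bullet> p)"
        by (simp add: p_def inner_sum_right mult.commute)
      finally show ?thesis by simp
    qed
    have "(v has_derivative (\<lambda>h. h \<bullet> p)) (at y within closure Y)"
      unfolding p using v_has_derivative[OF x0(1)] x0(2) by simp
    from has_derivative_diff[OF this has_derivative_const[of a]]
    have "((\<lambda>y. v y - a) has_derivative (\<lambda>h. h \<bullet> p)) (at y within closure Y)" by simp
    then have der: "(v' has_derivative (\<lambda>h. h \<bullet> p)) (at y within closure Y)"
      by (rule has_derivative_transform[OF y, rotated]) (use a(2) in simp)
    have "u' x + v' y = c x y \<longleftrightarrow> p = cont_ext (X \<times> Y) (\<lambda>(x, y). D_y c x y) (x, y)" if x: "x \<in> X" for x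
    proof -
      \<comment> \<open>Here \<open>y = T x0\<close> matters: there \<open>v y = - F y\<close>,
        which turns contact for the potentials into minimality for \<open>c x + F\<close>.\<close>
      have "u' x + v' y = c x y \<longleftrightarrow> w x = c x y + F y"
        using a(1)[OF X_closure[OF x]] a(2)[OF y] v_T[OF x0(1)] x0(2) by auto
      also have "\<dots> \<longleftrightarrow> T x = y"
        using T_unique[OF x y] w_T[OF x] by blast
      also have "\<dots> \<longleftrightarrow> (\<forall>h. c' (x, y) (0, h) + F' y h = 0)"
        using T_unique_critical[OF x y] critical_T[OF x] by blast
      also have "\<dots> \<longleftrightarrow> (\<forall>h. cont_ext (X \<times> Y) (\<lambda>(x, y). D_y c x y) (x, y) \<bullet> h = p \<bullet> h)"
        unfolding D_y_extension[OF x y] inner_commute[of p] p eq_neg_iff_add_eq_0 ..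
      also have "\<dots> \<longleftrightarrow> p = cont_ext (X \<times> Y) (\<lambda>(x, y). D_y c x y) (x, y)"
        using vector_eq_rdot[of "cont_ext (X \<times> Y) (\<lambda>(x, y). D_y c x y) (x, y)" p] by (auto simp: inner_commute)
      finally show ?thesis .
    qed
    with der show ?case by blast
  qed
qed

end

theorem theorem15:
  fixes X :: "(real ^ 'm) set" and Y :: "(real ^ 'n) set"
    and c :: "real ^ 'm \<Rightarrow> real ^ 'n \<Rightarrow> real"
    and V :: "real ^ 'n \<Rightarrow> real"
    and W :: "real ^ 'n \<Rightarrow> real ^ 'n \<Rightarrow> real"
    and \<mu> :: "(real ^ 'm) measure" and \<nu> :: "(real ^ 'n) measure"
    and C :: real
  assumes dim: "CARD('n) < CARD('m)"
    and X: "bounded X" "open X"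
    and Y: "bounded Y" "open Y" "convex Y"
    and c: "Ck_closure 2 (X \<times> Y) (\<lambda>(x, y). c x y)" "twisted c X Y" "nondegenerate c X Y"
    and V: "Ck_closure 2 Y V"
    and W: "Ck_closure 2 (Y \<times> Y) (\<lambda>(y, z). W y z)"
      "\<And>y z. y \<in> closure Y \<Longrightarrow> z \<in> closure Y \<Longrightarrow> W y z = W z y"
    and mu: "\<mu> \<in> prob_on X"
    and C: "C > 0"
    and convexity: "\<And>x y z h. x \<in> X \<Longrightarrow> y \<in> Y \<Longrightarrow> z \<in> Y \<Longrightarrow>
      h \<bullet> ((hessian (c x) y + hessian V y + hessian (W z) y) *v h) \<ge> C * (h \<bullet> h)"
    and boundary: "\<And>x z y p. x \<in> X \<Longrightarrow> z \<in> Y \<Longrightarrow> y \<in> frontier Y \<Longrightarrow>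
      p \<in> outward_unit_normals Y y \<Longrightarrow>
      (cont_ext (X \<times> Y) (\<lambda>(x, y). D_y c x y) (x, y) + cont_ext Y (grad V) y +
       cont_ext (Y \<times> Y) (\<lambda>(y, z). grad (\<lambda>y'. W y' z) y) (y, z)) \<bullet> p \<ge> 0"
    and nu: "\<nu> \<in> prob_on (closure Y)"
    and minimizer: "\<And>\<nu>'. \<nu>' \<in> prob_on (closure Y) \<Longrightarrow> energy c V W X Y \<mu> \<nu> \<le> energy c V W X Y \<mu> \<nu>'"
    and unique: "unique_potentials c X Y \<mu> \<nu>"
  shows "generalized_nestedness c X Y \<mu> \<nu> \<and>
    (\<forall>k\<ge>2. Ck_closure k (X \<times> Y) (\<lambda>(x, y). c x y) \<longrightarrow> Ck_closure k Y V \<longrightarrow>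
      Ck_closure k (Y \<times> Y) (\<lambda>(y, z). W y z) \<longrightarrow>
      (\<exists>T. optimal_map c X Y \<mu> \<nu> T \<and> Ck_open (k - 1) X T \<and>
         (\<forall>S. optimal_map c X Y \<mu> \<nu> S \<longrightarrow> (AE x in \<mu>. S x = T x))))"
proof -
  have c2: "Ck_upto (Suc (Suc 0)) (X \<times> Y) (closure X \<times> closure Y) (\<lambda>(x, y). c x y)"
    and V2: "Ck_upto (Suc (Suc 0)) Y (closure Y) V"
    and W2: "Ck_upto (Suc (Suc 0)) (Y \<times> Y) (closure Y \<times> closure Y) (\<lambda>(y, z). W y z)"
    using c(1) V W(1) unfolding numeral_2_eq_2 closure_Times by blast+
  obtain c' where c': "\<And>p. p \<in> X \<times> Y \<Longrightarrow> ((\<lambda>(x, y). c x y) has_derivative c' p) (at p)"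
    "\<And>h. Ck_upto (Suc 0) (X \<times> Y) (closure X \<times> closure Y) (\<lambda>p. c' p h)"
    using Ck_upto_SucE[OF c2] by blast
  obtain V' where V': "\<And>y. y \<in> Y \<Longrightarrow> (V has_derivative V' y) (at y)"
    "\<And>h. Ck_upto (Suc 0) Y (closure Y) (\<lambda>y. V' y h)"
    using Ck_upto_SucE[OF V2] by blast
  obtain W' where W': "\<And>p. p \<in> Y \<times> Y \<Longrightarrow> ((\<lambda>(y, z). W y z) has_derivative W' p) (at p)"
    "\<And>h. Ck_upto (Suc 0) (Y \<times> Y) (closure Y \<times> closure Y) (\<lambda>p. W' p h)"
    using Ck_upto_SucE[OF W2] by blast
  note sub = closure_subset[of X] closure_subset[of Y]
  have opn: "open (X \<times> Y)" "open (Y \<times> Y)" using X Y by (auto intro: open_Times)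
  have S1: "X \<times> Y \<subseteq> closure X \<times> closure Y" "closure X \<times> closure Y \<subseteq> closure (X \<times> Y)"
    and S2: "Y \<times> Y \<subseteq> closure Y \<times> closure Y" "closure Y \<times> closure Y \<subseteq> closure (Y \<times> Y)"
    using sub by (auto simp: closure_Times)
  \<comment> \<open>The Hessian hypothesis differentiates \<open>W\<close> in its second argument,
    \<open>F\<close> in its first. Symmetry identifies the two functions on \<open>closure Y\<close>
    only, which suffices for derivatives at points of the open set \<open>Y\<close>.\<close>
  have W_grad: "grad (W z) a \<bullet> h = W' (a, z) (h, 0)" if az: "a \<in> Y" "z \<in> Y" for a z h
  proof (rule grad_has_derivative)
    have "((\<lambda>y. (\<lambda>(y, z). W y z) (y, z)) has_derivative (\<lambda>h. W' (a, z) (h, 0))) (at a)"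
      by (rule has_derivative_compose[where f = "\<lambda>y. (y, z)", OF has_derivative_Pair[OF has_derivative_ident has_derivative_const]])
        (use W'(1) az in auto)
    then show "(W z has_derivative (\<lambda>h. W' (a, z) (h, 0))) (at a)"
      by (rule has_derivative_transform_within_open[OF _ Y(2) az(1)]) (use W(2) az sub in auto)
  qed
  interpret equilibrium X Y c V W c' V' W' \<nu> C \<mu>
  proof unfold_locales
    fix x a b z assume xabz: "x \<in> X" "a \<in> Y" "b \<in> Y" "z \<in> Y"
    have "C / 2 * (norm (b - a))\<^sup>2 \<le> (c x b + V b + W z b) - (c x a + V a + W z a) -
        (grad (c x) a + grad V a + grad (W z) a) \<bullet> (b - a)"
    proof (rule hessian_sum_strongly_convex[OF Y(2,3)])
      show "Ck_upto 2 Y Y (c x)" "Ck_upto 2 Y Y V" "Ck_upto 2 Y Y (W z)"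
        using Ck_upto_slice[OF Ck_upto_subset[OF c2 order_refl, of "X \<times> Y"] xabz(1,1)]
          Ck_upto_subset[OF V2 order_refl, of Y]
          Ck_upto_slice[OF Ck_upto_subset[OF W2 order_refl, of "Y \<times> Y"] xabz(4,4)] sub
        unfolding numeral_2_eq_2 by (blast intro: Sigma_mono)+
    qed (use convexity xabz in auto)
    moreover have "grad (c x) a \<bullet> (b - a) = c' (x, a) (0, b - a)"
      by (rule grad_snd[OF c'(1)]) (use xabz in simp)
    moreover have "W z b = W b z" "W z a = W a z" using W(2) xabz sub by auto
    ultimately show "C / 2 * (norm (b - a))\<^sup>2 \<le> (c x b + V b + W b z) - (c x a + V a + W a z) -
        (c' (x, a) (0, b - a) + V' a (b - a) + W' (a, z) (b - a, 0))"
      using W_grad[OF xabz(2,4)] grad_has_derivative[OF V'(1)[OF xabz(2)]] by (simp add: inner_add_left)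
  next
    fix x y z p assume *: "x \<in> X" "z \<in> Y" "y \<in> frontier Y" "p \<in> outward_unit_normals Y y"
    have y: "y \<in> closure Y" using *(3) by (simp add: frontier_def)
    have "cont_ext (X \<times> Y) (\<lambda>(x, y). D_y c x y) (x, y) \<bullet> p = c' (x, y) (0, p)"
    proof (rule cont_ext_inner[where D = "\<lambda>q h. c' q (0, h)", OF opn(1) S1 _ Ck_upto_continuous_on[OF c'(2)]])
      show "(\<lambda>(x, y). D_y c x y) q \<bullet> h = c' q (0, h)" if "q \<in> X \<times> Y" for q h
        using grad_snd[of c "c' q" "fst q" "snd q"] c'(1)[OF that] by (simp add: D_y_def case_prod_unfold)
      show "(x, y) \<in> closure X \<times> closure Y" using *(1) y sub by blast
    qed
    moreover have "cont_ext Y (grad V) y \<bullet> p = V' y p"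
      by (rule cont_ext_inner[where D = V', OF Y(2) closure_subset order_refl _ Ck_upto_continuous_on[OF V'(2)] y])
        (rule grad_has_derivative[OF V'(1)])
    moreover have "cont_ext (Y \<times> Y) (\<lambda>(y, z). grad (\<lambda>y'. W y' z) y) (y, z) \<bullet> p = W' (y, z) (p, 0)"
    proof (rule cont_ext_inner[where D = "\<lambda>q h. W' q (h, 0)", OF opn(2) S2 _ Ck_upto_continuous_on[OF W'(2)]])
      show "(\<lambda>(y, z). grad (\<lambda>y'. W y' z) y) q \<bullet> h = W' q (h, 0)" if "q \<in> Y \<times> Y" for q h
        using grad_fst[of W "W' q" "fst q" "snd q"] W'(1)[OF that] by (simp add: case_prod_unfold)
      show "(y, z) \<in> closure Y \<times> closure Y" using *(2) y sub by blast
    qed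
    ultimately show "0 \<le> c' (x, y) (0, p) + V' y p + W' (y, z) (p, 0)"
      using boundary[OF *] by (simp add: inner_add_left)
  next
    show "continuous_on (closure X \<times> closure Y) (\<lambda>(x, y). c x y)" by (rule Ck_upto_continuous_on[OF c2])
    show "continuous_on (closure Y) V" by (rule Ck_upto_continuous_on[OF V2])
    show "continuous_on (closure Y \<times> closure Y) (\<lambda>(y, z). W y z)" by (rule Ck_upto_continuous_on[OF W2])
    show "continuous_on (closure X \<times> closure Y) (\<lambda>p. c' p h)" for h by (rule Ck_upto_continuous_on[OF c'(2)])
    show "continuous_on (closure Y) (\<lambda>y. V' y h)" for h by (rule Ck_upto_continuous_on[OF V'(2)])
    show "continuous_on (closure Y \<times> closure Y) (\<lambda>p. W' p h)" for h by (rule Ck_upto_continuous_on[OF W'(2)])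
  qed (fact X Y nu C mu c(1) V W minimizer c'(1) V'(1) W'(1))+
  have "\<exists>T. optimal_map c X Y \<mu> \<nu> T \<and> Ck_open (k - 1) X T \<and>
      (\<forall>S. optimal_map c X Y \<mu> \<nu> S \<longrightarrow> (AE x in \<mu>. S x = T x))"
    if k: "2 \<le> k" and Ck: "Ck_closure k (X \<times> Y) (\<lambda>(x, y). c x y)" "Ck_closure k Y V"
      "Ck_closure k (Y \<times> Y) (\<lambda>(y, z). W y z)" for k
  proof -
    \<comment> \<open>With order \<open>j + 2\<close> of the data, \<open>Ck_T\<close> yields order
      \<open>j + 1\<close>, which is \<open>k - 1\<close>.\<close>
    obtain j where j: "k = Suc (Suc j)" using le_Suc_ex[OF k] by auto
    have "Ck_open (k - 1) X T" using Ck_T[OF Ck[unfolded j]] unfolding j diff_Suc_1 .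
    then show ?thesis using optimal_map_T optimal_map_unique by blast
  qed
  with generalized_nestedness_of_unique[OF unique] show ?thesis by blast
qed

end
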